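(* Let $n\ge1$, $\alpha>-1$, $q\ge1$, $0<p\le1$, $\Phi_1\in\mathscr U^q$ and $\Phi_2\in\mathscr L_p$. Let $\Psi_1$ be the complementary function of $\Phi_1$. Suppose that there is $C>0$ with $\int_0^t\frac{\Phi_1(s)}{s^2}ds\le C\frac{\Phi_1(t)}{t}$ for all $t>0$, and that $\int_1^\infty\frac{\Phi_2(t)}{t^2}dt<\infty$. Then $h_b$ extends as a bounded operator from $\mathcal A_\alpha^{\Phi_1}(\mathbb B^n)$ to $\mathcal A_\alpha^{\Phi_2}(\mathbb B^n)$ if and only if $b\in\mathcal A_\alpha^{\Psi_1}(\mathbb B^n)$.
   Context: $\mathbb B^n$ is the unit ball of $\mathbb C^n$, $d\nu$ is Lebesgue measure on it, and $d\nu_\alpha(z)=c_\alpha(1-|z|^2)^\alpha d\nu(z)$ with $\nu_\alpha(\mathbb B^n)=1$. A growth function is a continuous non-decreasing function from $[0,\infty)$ onto itself. $\mathscr U^q$ ($q\ge1$): growth functions $\Phi$ of upper type $q$ ($\Phi(st)\le Ct^q\Phi(s)$ for all $s>0$, $t\ge1$, some $C>0$) with $\Phi(t)/t$ non-decreasing. $\mathscr L_p$ ($0<p\le1$): growth functions $\Phi$ of lower type $p$ ($\Phi(st)\le Ct^p\Phi(s)$ for all $s>0$, $0<t\le1$, some $C>0$) with $\Phi(t)/t$ non-increasing. Equivalent growth functions ($c\Phi_1(ct)\le\Phi_2(t)\le c^{-1}\Phi_1(c^{-1}t)$ for some $c>0$) define the same spaces; by convention members of $\mathscr U^q$ (resp.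 $\mathscr L_p$) are supposed convex (resp. concave) and $C^1$ with $\Phi'(t)\simeq\Phi(t)/t$. The complementary function of a convex growth function $\Phi$ is $\Psi(s)=\sup_{t\ge0}\{ts-\Phi(t)\}$. $\mathcal A_\alpha^\Phi(\mathbb B^n)$ is the space of holomorphic $f$ on $\mathbb B^n$ with $\int_{\mathbb B^n}\Phi(|f|)\,d\nu_\alpha<\infty$, with (quasi-)norm $\|f\|^{lux}_{\alpha,\Phi}=\inf\{\lambda>0:\int\Phi(|f|/\lambda)\,d\nu_\alpha\le1\}$. $\mathcal A^2_\alpha$ is the case $\Phi(t)=t^2$. $P_\alpha f(z)=\int_{\mathbb B^n}\frac{f(\xi)}{(1-\langle z,\xi\rangle)^{n+1+\alpha}}d\nu_\alpha(\xi)$ is the Bergman projection. For a symbol $b\in\mathcal A_\alpha^2(\mathbb B^n)$ the small Hankel operator is defined on bounded holomorphic $f$ by $h_b(f)=P_\alpha(b\overline f)$. "$h_b$ extends as a bounded operator from $\mathcal A_\alpha^{\Phi_1}$ to $\mathcal A_\alpha^{\Phi_2}$" means there is $C$ with $\|h_b(f)\|^{lux}_{\alpha,\Phi_2}\le C\|f\|^{lux}_{\alpha,\Phi_1}$ for all bounded holomorphic $f$. *)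

theory Defs
  imports "HOL-Analysis.Analysis"
begin

section \<open>Growth functions\<close>

text \<open>Growth functions are modelled as functions on the reals of which only the restriction to
  the half-line \<open>{0..}\<close> matters.\<close>

definition growth_function :: "(real \<Rightarrow> real) \<Rightarrow> bool" where
  "growth_function \<Phi> \<longleftrightarrow>
     continuous_on {0..} \<Phi> \<and> mono_on {0..} \<Phi> \<and> \<Phi> ` {0..} = {0..}"

definition upper_type :: "real \<Rightarrow> (real \<Rightarrow> real) \<Rightarrow> bool" where
  "upper_type q \<Phi> \<longleftrightarrow> (\<exists>C>0. \<forall>s>0. \<forall>t\<ge>1. \<Phi> (s * t) \<le> C * t powr q * \<Phi> s)"

definition lower_type :: "real \<Rightarrow> (real \<Rightarrow> real) \<Rightarrow> bool" where
  "lower_type p \<Phi> \<longleftrightarrow> (\<exists>C>0. \<forall>s>0. \<forall>t. 0 < t \<and> t \<le> 1 \<longrightarrow> \<Phi> (s * t) \<le> C * t powr p * \<Phi> s)"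

text \<open>The standing regularity convention: \<open>\<Phi>\<close> is continuously differentiable with
  \<open>\<Phi>' t\<close> comparable to \<open>\<Phi> t / t\<close>. Differentiability is only required on the open
  half-line, since for instance \<open>t powr p\<close> with \<open>p < 1\<close> is not differentiable at 0.\<close>

definition regular_growth :: "(real \<Rightarrow> real) \<Rightarrow> bool" where
  "regular_growth \<Phi> \<longleftrightarrow> \<Phi> C1_differentiable_on {0<..} \<and>
     (\<exists>c>0. \<exists>C>0. \<forall>t>0. c * (\<Phi> t / t) \<le> deriv \<Phi> t \<and> deriv \<Phi> t \<le> C * (\<Phi> t / t))"

text \<open>The classes \<open>\<U>\<^sup>q\<close> and \<open>\<L>\<^sub>p\<close>. Every growth function satisfying the type and
  monotonicity conditions is equivalent to a convex, respectively concave, regular one; by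
  convention the members of the classes are of this form.\<close>

definition class_U :: "real \<Rightarrow> (real \<Rightarrow> real) set" where
  "class_U q = {\<Phi>. growth_function \<Phi> \<and> upper_type q \<Phi> \<and> mono_on {0<..} (\<lambda>t. \<Phi> t / t) \<and>
     convex_on {0..} \<Phi> \<and> regular_growth \<Phi>}"

definition class_L :: "real \<Rightarrow> (real \<Rightarrow> real) set" where
  "class_L p = {\<Phi>. growth_function \<Phi> \<and> lower_type p \<Phi> \<and> antimono_on {0<..} (\<lambda>t. \<Phi> t / t) \<and>
     concave_on {0..} \<Phi> \<and> regular_growth \<Phi>}"

text \<open>The supremum is finite as soon as \<open>\<Phi> t / t\<close> tends to infinity with \<open>t\<close>. This is the
  case when \<open>\<Phi> t / t\<close> is non-decreasing and the integral of \<open>\<Phi> s / s\<^sup>2\<close> over \<open>(0, t)\<close> is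
  \<open>O (\<Phi> t / t)\<close>: that integral is at least \<open>\<Phi> 1 * ln t\<close> for \<open>t \<ge> 1\<close>.\<close>

definition complementary :: "(real \<Rightarrow> real) \<Rightarrow> real \<Rightarrow> real" where
  "complementary \<Phi> s = (SUP t\<in>{0..}. t * s - \<Phi> t)"


section \<open>Bergman--Orlicz spaces on the unit ball of \<open>\<complex>\<^sup>n\<close>\<close>

abbreviation unit_ball :: "(complex ^ 'n) set" where
  "unit_ball \<equiv> ball 0 1"

text \<open>The Hermitian product, linear in the first argument; the library's \<open>\<bullet>\<close> is its real part.\<close>

definition hermitian :: "complex ^ 'n \<Rightarrow> complex ^ 'n \<Rightarrow> complex" where
  "hermitian z w = (\<Sum>i\<in>UNIV. z $ i * cnj (w $ i))"

text \<open>The library's \<open>holomorphic_on\<close> covers one variable only. In several variables: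
  Frechet differentiable with complex-linear derivative.\<close>

definition holomorphic_Cn :: "(complex ^ 'n \<Rightarrow> complex) \<Rightarrow> (complex ^ 'n) set \<Rightarrow> bool" where
  "holomorphic_Cn f S \<longleftrightarrow>
     (\<forall>z\<in>S. \<exists>D. (f has_derivative D) (at z within S) \<and> (\<forall>c v. D (c *s v) = c * D v))"

text \<open>\<open>c\<^sub>\<alpha>\<close> is the constant that makes \<open>nu \<alpha>\<close> a probability measure (for \<open>\<alpha> > -1\<close>).\<close>

definition c_const :: "'n::finite itself \<Rightarrow> real \<Rightarrow> real" where
  "c_const _ \<alpha> = 1 / (LINT z : (unit_ball :: (complex ^ 'n) set) | lborel. (1 - (norm z)\<^sup>2) powr \<alpha>)"

text \<open>The underlying space of \<open>nu \<alpha>\<close> is the ball itself, so that the values of functions outside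
  the ball are irrelevant, also for measurability.\<close>

definition nu :: "real \<Rightarrow> (complex ^ 'n) measure" where
  "nu \<alpha> = density (restrict_space lborel unit_ball)
     (\<lambda>z. ennreal (c_const TYPE('n) \<alpha> * (1 - (norm z)\<^sup>2) powr \<alpha>))"

definition bergman_orlicz :: "real \<Rightarrow> (real \<Rightarrow> real) \<Rightarrow> (complex ^ 'n \<Rightarrow> complex) set" where
  "bergman_orlicz \<alpha> \<Phi> = {f. holomorphic_Cn f unit_ball \<and>
     (\<integral>\<^sup>+ z. ennreal (\<Phi> (norm (f z))) \<partial>nu \<alpha>) < \<infinity>}"

text \<open>The Luxemburg (quasi-)norm is \<open>\<infinity>\<close> if no \<open>\<lambda>\<close> is admissible.\<close>

definition lux_norm :: "real \<Rightarrow> (real \<Rightarrow> real) \<Rightarrow> (complex ^ 'n \<Rightarrow> complex) \<Rightarrow> ennreal" where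
  "lux_norm \<alpha> \<Phi> f =
     Inf {ennreal l |l. l > 0 \<and> (\<integral>\<^sup>+ z. ennreal (\<Phi> (norm (f z) / l)) \<partial>nu \<alpha>) \<le> 1}"

definition bergman_space2 :: "real \<Rightarrow> (complex ^ 'n \<Rightarrow> complex) set" where
  "bergman_space2 \<alpha> = bergman_orlicz \<alpha> (\<lambda>t. t\<^sup>2)"


section \<open>Small Hankel operators\<close>

text \<open>For \<open>z\<close> and \<open>\<xi>\<close> in the ball, \<open>1 - hermitian z \<xi>\<close> has positive real part, so the principal
  branch chosen by \<open>powr\<close> is the intended one.\<close>

definition bergman_proj ::
    "real \<Rightarrow> (complex ^ 'n \<Rightarrow> complex) \<Rightarrow> complex ^ 'n \<Rightarrow> complex" where
  "bergman_proj \<alpha> f z =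
     (LINT \<xi>|nu \<alpha>. f \<xi> / (1 - hermitian z \<xi>) powr of_real (real CARD('n) + 1 + \<alpha>))"

definition small_hankel ::
    "real \<Rightarrow> (complex ^ 'n \<Rightarrow> complex) \<Rightarrow> (complex ^ 'n \<Rightarrow> complex) \<Rightarrow> complex ^ 'n \<Rightarrow> complex" where
  "small_hankel \<alpha> b f = bergman_proj \<alpha> (\<lambda>\<xi>. b \<xi> * cnj (f \<xi>))"

definition bounded_holomorphic :: "(complex ^ 'n \<Rightarrow> complex) set" where
  "bounded_holomorphic = {f. holomorphic_Cn f unit_ball \<and> bounded (f ` unit_ball)}"

definition hankel_extends_bounded ::
    "real \<Rightarrow> (real \<Rightarrow> real) \<Rightarrow> (real \<Rightarrow> real) \<Rightarrow> (complex ^ 'n \<Rightarrow> complex) \<Rightarrow> bool" where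
  "hankel_extends_bounded \<alpha> \<Phi>1 \<Phi>2 b \<longleftrightarrow>
     (\<exists>C::real. \<forall>f\<in>bounded_holomorphic.
        lux_norm \<alpha> \<Phi>2 (small_hankel \<alpha> b f) \<le> ennreal C * lux_norm \<alpha> \<Phi>1 f)"

end

theory Submission
  imports Defs "HOL-Complex_Analysis.Complex_Analysis"
begin

text \<open>Write \<open>P\<close> for the Bergman projection and \<open>K\<close> for its kernel.

  If \<open>b\<close> lies in the space of \<open>\<Psi>1\<close>, then \<open>b * cnj f\<close> is integrable by Young's inequality, and it remains
  to see that \<open>P\<close> maps \<open>L\<^sup>1\<close> to \<open>L\<^sup>\<Phi>\<close> for \<open>\<Phi> = \<Phi>2\<close>. For \<open>t z = (1 - |z|\<^sup>2) powr (- a)\<close> with small \<open>a\<close>,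
  monotonicity of \<open>\<Phi> t / t\<close> gives \<open>\<Phi> u \<le> w z * u + \<Phi> (t z)\<close> with \<open>w z = \<Phi> (t z) / t z\<close>. Here
  \<open>\<Phi> (t z)\<close> is integrable, and the integral condition on \<open>\<Phi>\<close> makes \<open>w\<close> integrated
  against \<open>|K|\<close> a bounded function; no weak-type estimate is needed.

  Conversely, for \<open>f = P g\<close> the value of \<open>h\<^sub>b f\<close> at the origin is the pairing of \<open>b\<close> with \<open>g\<close>, because
  \<open>P\<close> is self-adjoint and reproduces \<open>b\<close>. Point evaluations are bounded on the space of \<open>\<Phi>2\<close>,
  and \<open>P\<close> is bounded on \<open>L\<^sup>\<Phi>\<close> for \<open>\<Phi> = \<Phi>1\<close> by a Schur test with powers of \<open>1 - |z|\<^sup>2\<close> and Jensen's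
  inequality, since the Dini condition makes \<open>\<Phi>1\<close> of lower type greater than \<open>1\<close>. So the pairing is bounded
  on the unit ball of \<open>L\<^sup>\<Phi>\<close>, and the extremal \<open>g\<close> of Young's inequality shows that \<open>\<Psi>1 |b|\<close> is integrable.

  The reproducing formula is reduced to homogeneous components and to the Gaussian weight, where
  it follows by completing the square from the mean value property. The kernel estimates rest on the volume
  of nonisotropic balls, found by averaging over translations and dilations.\<close>

section \<open>Rotations and means over circles\<close>

text \<open>The quasi-norm of the target need not be a norm, so no duality is available there. The
  converse uses a single functional on it, evaluation at the origin, where the kernel is 1. The
  functions \<open>g\<close> paired with \<open>b\<close> are bounded and supported in a smaller
  ball: P g is then bounded and holomorphic, hence an admissible argument of the operator, and the
  interchanges of integrals ask no more of \<open>b\<close> than integrability.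

  In the direct part t z is a threshold: values of P g below it are paid for by an integrable
  function independent of \<open>g\<close>, values above it are linearised. The condition on \<Phi>2
  at infinity becomes a Dini condition on the weight at \<rho> = 0, because for t a negative power
  of \<rho>, dt/t is a multiple of d\<rho>/\<rho>.

  In the reproducing formula, rotations by unimodular scalars stand in for polar coordinates and for
  the orthogonality of monomials. The Gaussian is the weight under which a translation can be
  undone. The Gamma factors from the change of weight are, up to normalisation, the quotients of the
  Taylor coefficients of the kernel by those of the exponential.\<close>

lemma nn_integral_lborel_affine:
  fixes f :: "'a::euclidean_space \<Rightarrow> ennreal"
  assumes [measurable]: "f \<in> borel_measurable borel" and c: "c \<noteq> 0"
  shows "(\<integral>\<^sup>+x. f x \<partial>lborel) = ennreal (\<bar>c\<bar> ^ DIM('a)) * (\<integral>\<^sup>+x. f (t + c *\<^sub>R x) \<partial>lborel)"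
proof -
  have "(\<integral>\<^sup>+x. f x \<partial>lborel)
      = (\<integral>\<^sup>+x. f x \<partial>density (distr lborel borel (\<lambda>x. t + c *\<^sub>R x)) (\<lambda>_. ennreal (\<bar>c\<bar> ^ DIM('a))))"
    by (subst lborel_affine[OF c, of t]) simp
  also have "\<dots> = ennreal (\<bar>c\<bar> ^ DIM('a)) * (\<integral>\<^sup>+x. f (t + c *\<^sub>R x) \<partial>lborel)"
    by (subst nn_integral_density) (auto simp: nn_integral_distr nn_integral_cmult)
  finally show ?thesis .
qed

lemma nn_integral_lborel_translate:
  fixes f :: "'a::euclidean_space \<Rightarrow> ennreal"
  assumes "f \<in> borel_measurable borel"
  shows "(\<integral>\<^sup>+x. f (x + t) \<partial>lborel) = (\<integral>\<^sup>+x. f x \<partial>lborel)"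
  using nn_integral_lborel_affine[OF assms, of 1 t] by (simp add: add.commute)

lemma nn_integral_lborel_reflect:
  fixes f :: "'a::euclidean_space \<Rightarrow> ennreal"
  assumes "f \<in> borel_measurable borel"
  shows "(\<integral>\<^sup>+x. f (t - x) \<partial>lborel) = (\<integral>\<^sup>+x. f x \<partial>lborel)"
  using nn_integral_lborel_affine[OF assms, of "-1" t] by simp

text \<open>The image measure under an isometry is translation invariant, hence proportional to Lebesgue
  measure; the factor is \<open>1\<close> because the unit ball is preserved.\<close>

lemma distr_lborel_linear_isometry:
  fixes T :: "'a::euclidean_space \<Rightarrow> 'a"
  assumes T: "linear T" and iso: "\<And>x. norm (T x) = norm x"
  shows "distr lborel borel T = lborel"
proof -
  have inj: "inj T"
    using T iso by (metis linear_injective_0 norm_eq_zero)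
  hence surj: "surj T"
    using T linear_injective_imp_surjective by blast
  have [measurable]: "T \<in> borel_measurable borel"
    using T linear_continuous_on[of T UNIV] by (simp add: borel_measurable_continuous_onI linear_conv_bounded_linear)
  have "emeasure (distr lborel borel T) A = emeasure lborel A" if [measurable]: "A \<in> sets borel" for A
  proof -
    let ?B = "ball (0::'a) 1"
    have [measurable]: "?B \<in> sets borel" by simp
    have A: "emeasure (distr lborel borel T) A = (\<integral>\<^sup>+x. indicator A (T x) \<partial>lborel)"
      by (subst nn_integral_indicator[symmetric], simp, subst nn_integral_distr) auto
    have "emeasure (distr lborel borel T) A * emeasure lborel ?B
       = (\<integral>\<^sup>+x. indicator A (T x) \<partial>lborel) * (\<integral>\<^sup>+y. indicator ?B y \<partial>lborel)"
      using A by (simp only: nn_integral_indicator sets_lborel borel_open[OF open_ball])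
    also have "\<dots> = (\<integral>\<^sup>+x. indicator A (T x) * (\<integral>\<^sup>+y. indicator ?B y \<partial>lborel) \<partial>lborel)"
      by (subst nn_integral_multc) auto
    also have "\<dots> = (\<integral>\<^sup>+x. \<integral>\<^sup>+y. indicator A (T x) * indicator ?B (y + T x) \<partial>lborel \<partial>lborel)"
    proof (rule nn_integral_cong)
      fix x
      have "(\<integral>\<^sup>+y. indicator A (T x) * indicator ?B (y + T x) \<partial>lborel)
          = indicator A (T x) * (\<integral>\<^sup>+y. indicator ?B (y + T x) \<partial>lborel)"
        by (rule nn_integral_cmult) measurable
      also have "(\<integral>\<^sup>+y. indicator ?B (y + T x) \<partial>lborel) = (\<integral>\<^sup>+y. indicator ?B y \<partial>lborel)"
        by (rule nn_integral_lborel_translate) auto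
      finally show "indicator A (T x) * (\<integral>\<^sup>+y. indicator ?B y \<partial>lborel)
          = (\<integral>\<^sup>+y. indicator A (T x) * indicator ?B (y + T x) \<partial>lborel)" ..
    qed
    also have "\<dots> = (\<integral>\<^sup>+y. \<integral>\<^sup>+x. indicator A (T x) * indicator ?B (y + T x) \<partial>lborel \<partial>lborel)"
      by (rule lborel_pair.Fubini') measurable
    also have "\<dots> = (\<integral>\<^sup>+y. \<integral>\<^sup>+x. indicator A (T x - y) * indicator ?B (T x) \<partial>lborel \<partial>lborel)"
    proof (rule nn_integral_cong)
      fix y :: 'a
      \<comment> \<open>A preimage of \<open>y\<close> lets translation invariance in
        \<open>x\<close> move the shift from the ball to \<open>A\<close>. Integrating over
        \<open>y\<close> first afterwards separates \<open>A\<close> from \<open>T\<close>.\<close>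
      obtain y' where y': "T y' = y" using surj by (metis surjD)
      show "(\<integral>\<^sup>+x. indicator A (T x) * indicator ?B (y + T x) \<partial>lborel)
          = (\<integral>\<^sup>+x. indicator A (T x - y) * indicator ?B (T x) \<partial>lborel)"
        using T y'
        by (subst nn_integral_lborel_translate[where t="y'", symmetric, of "\<lambda>x. indicator A (T x - y)
            * indicator ?B (T x)"])
           (auto simp: linear_add add.commute)
    qed
    also have "\<dots> = (\<integral>\<^sup>+x. \<integral>\<^sup>+y. indicator A (T x - y) * indicator ?B (T x) \<partial>lborel \<partial>lborel)"
      by (rule lborel_pair.Fubini') measurable
    also have "\<dots> = (\<integral>\<^sup>+x. emeasure lborel A * indicator ?B (T x) \<partial>lborel)"
      by (intro nn_integral_cong, subst nn_integral_multc)
         (auto simp: nn_integral_lborel_reflect[where f="indicator A"])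
    also have "\<dots> = emeasure lborel A * (\<integral>\<^sup>+x. indicator ?B x \<partial>lborel)"
    proof -
      have "indicator ?B (T x) = (indicator ?B x :: ennreal)" for x
        by (simp add: indicator_def iso)
      thus ?thesis by (simp only:) (rule nn_integral_cmult, measurable)
    qed
    also have "\<dots> = emeasure lborel A * emeasure lborel ?B"
      by simp
    finally have eq: "emeasure lborel ?B * emeasure (distr lborel borel T) A = emeasure lborel ?B * emeasure lborel A"
      by (simp add: mult.commute)
    have "emeasure lborel ?B \<noteq> \<infinity>" "emeasure lborel ?B \<noteq> 0"
      using emeasure_lborel_ball_finite[of "0::'a" 1] less_imp_neq[OF unit_ball_vol_pos[of "real DIM('a)"]]
      by (auto simp: emeasure_ball)
    thus ?thesis using eq by (simp add: ennreal_mult_cancel_left)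
  qed
  thus ?thesis by (intro measure_eqI) auto
qed

lemma norm_vector_smult [simp]: "norm (c *s z) = norm c * norm (z :: complex ^ 'n)"
proof -
  have "L2_set (\<lambda>i. norm ((c *s z) $ i)) UNIV = L2_set (\<lambda>i. norm c * norm (z $ i)) UNIV"
    by (simp add: norm_mult)
  thus ?thesis by (simp add: norm_vec_def L2_set_right_distrib)
qed

lemma linear_vector_smult: "linear (\<lambda>z. c *s (z :: complex ^ 'n))"
  by (rule linearI) (auto simp: vec_eq_iff algebra_simps)

lemma continuous_on_smult [continuous_intros]:
  fixes g :: "'a::topological_space \<Rightarrow> complex ^ 'n"
  assumes "continuous_on S f" "continuous_on S g"
  shows "continuous_on S (\<lambda>x. f x *s g x)"
  unfolding vector_scalar_mult_def using assms by (intro continuous_intros)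

lemma measurable_smult [measurable]:
  fixes g :: "'a \<Rightarrow> complex ^ 'n"
  assumes "f \<in> borel_measurable M" "g \<in> borel_measurable M"
  shows "(\<lambda>x. f x *s g x) \<in> borel_measurable M"
proof -
  have "continuous_on UNIV (\<lambda>p::complex \<times> (complex ^ 'n). fst p *s snd p)"
    by (intro continuous_intros)
  from borel_measurable_continuous_Pair[OF assms this] show ?thesis .
qed

lemma distr_lborel_rotation:
  assumes "norm c = 1"
  shows "distr lborel borel (\<lambda>z. c *s (z :: complex ^ 'n)) = lborel"
  using assms by (intro distr_lborel_linear_isometry linear_vector_smult) simp

lemma nn_integral_rotation:
  fixes f :: "complex ^ 'n \<Rightarrow> ennreal"
  assumes "norm c = 1" "f \<in> borel_measurable borel"
  shows "(\<integral>\<^sup>+z. f (c *s z) \<partial>lborel) = (\<integral>\<^sup>+z. f z \<partial>lborel)"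
proof -
  have "(\<integral>\<^sup>+z. f z \<partial>lborel) = (\<integral>\<^sup>+z. f z \<partial>distr lborel borel (\<lambda>z. c *s z))"
    by (simp add: distr_lborel_rotation[OF assms(1)])
  also have "\<dots> = (\<integral>\<^sup>+z. f (c *s z) \<partial>lborel)"
    using assms by (subst nn_integral_distr) auto
  finally show ?thesis ..
qed

lemma integral_rotation:
  fixes f :: "complex ^ 'n \<Rightarrow> 'b::{banach, second_countable_topology}"
  assumes "norm c = 1" "f \<in> borel_measurable borel"
  shows "(\<integral>z. f (c *s z) \<partial>lborel) = (\<integral>z. f z \<partial>lborel)"
proof -
  have "(\<integral>z. f z \<partial>lborel) = (\<integral>z. f z \<partial>distr lborel borel (\<lambda>z. c *s z))"
    by (simp add: distr_lborel_rotation[OF assms(1)])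
  also have "\<dots> = (\<integral>z. f (c *s z) \<partial>lborel)"
    using assms by (subst integral_distr) auto
  finally show ?thesis ..
qed

section \<open>Means over the unit circle, and Taylor coefficients as such means\<close>

abbreviation circ :: "real measure" where
  "circ \<equiv> restrict_space lborel {0..1}"

abbreviation cisp :: "real \<Rightarrow> complex" where
  "cisp t \<equiv> cis (2 * pi * t)"

lemma finite_measure_circ: "finite_measure circ"
  by (rule finite_measureI) (simp add: emeasure_restrict_space space_restrict_space)

lemma integral_const_circ [simp]:
  "(\<integral>t. k \<partial>circ) = (k :: 'a :: {banach, second_countable_topology})"
proof -
  have "measure circ {0..1} = 1"
    by (subst measure_restrict_space) auto
  thus ?thesis by (simp add: space_restrict_space)
qed

lemma measurable_cisp [measurable]: "cisp \<in> borel_measurable borel"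
  by (intro borel_measurable_continuous_onI continuous_intros)

lemma measurable_cisp_circ [measurable]: "cisp \<in> borel_measurable circ"
  by (rule measurable_restrict_space1) simp

lemma measurable_cnj [measurable]: "cnj \<in> borel_measurable borel"
  by (intro borel_measurable_continuous_onI continuous_intros)

text \<open>Every rotation preserves Lebesgue measure, so the integrand may be replaced by its mean
  over all of them; all rotated copies of \<open>F\<close> have the same integral norm, which
  justifies Fubini. Applied around the origin this selects a homogeneous degree; applied after a
  translation it evaluates a holomorphic factor at the centre.\<close>

lemma integral_rotation_mean:
  fixes F :: "complex ^ 'n \<Rightarrow> complex"
  assumes F: "integrable lborel F" and G: "\<And>z. (\<integral>t. F (cisp t *s z) \<partial>circ) = G z"
  shows "(\<integral>z. F z \<partial>lborel) = (\<integral>z. G z \<partial>lborel)"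
proof -
  have [measurable]: "F \<in> borel_measurable borel" using F by auto
  interpret circ: finite_measure circ by (rule finite_measure_circ)
  interpret pair_sigma_finite circ "lborel :: (complex ^ 'n) measure"
    by unfold_locales
  have "(\<integral>\<^sup>+p. norm (case p of (t, z) \<Rightarrow> F (cisp t *s z)) \<partial>(circ \<Otimes>\<^sub>M lborel))
      = (\<integral>\<^sup>+t. \<integral>\<^sup>+z. norm (F (cisp t *s z)) \<partial>lborel \<partial>circ)"
    by (subst lborel.nn_integral_fst[symmetric]) (auto simp: case_prod_beta)
  also have "\<dots> = (\<integral>\<^sup>+t. \<integral>\<^sup>+z. norm (F z) \<partial>lborel \<partial>circ)"
    by (intro nn_integral_cong nn_integral_rotation[where f="\<lambda>z. ennreal (norm (F z))"]) auto
  also have "\<dots> < \<infinity>"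
    using F by (auto simp: integrable_iff_bounded nn_integral_const emeasure_restrict_space space_restrict_space)
  finally have int: "integrable (circ \<Otimes>\<^sub>M lborel) (\<lambda>(t, z). F (cisp t *s z))"
    by (intro integrableI_bounded) (auto simp: case_prod_beta)
  have "(\<integral>z. F z \<partial>lborel) = (\<integral>t. (\<integral>z. F z \<partial>lborel) \<partial>circ)"
    by (rule integral_const_circ[symmetric])
  also have "\<dots> = (\<integral>t. (\<integral>z. F (cisp t *s z) \<partial>lborel) \<partial>circ)"
    by (intro Bochner_Integration.integral_cong refl integral_rotation[symmetric]) auto
  also have "\<dots> = (\<integral>z. (\<integral>t. F (cisp t *s z) \<partial>circ) \<partial>lborel)"
    using Fubini_integral[OF int] by simp
  also have "\<dots> = (\<integral>z. G z \<partial>lborel)" by (simp add: G)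
  finally show ?thesis .
qed

text \<open>The bridge from contour integrals, which are gauge integrals over \<open>{0..1}\<close>,
  to Lebesgue integrals over \<open>circ\<close>, where Fubini applies.\<close>

lemma circ_has_integral:
  fixes h :: "real \<Rightarrow> complex"
  assumes "continuous_on {0..1} h" "(h has_integral I) {0..1}"
  shows "(\<integral>t. h t \<partial>circ) = I" "integrable circ h"
proof -
  have *: "set_integrable lborel {0..1} h"
    by (rule borel_integrable_atLeastAtMost'[OF assms(1)])
  show "integrable circ h"
    using * unfolding set_integrable_def
    by (subst integrable_restrict_space) (auto simp: )
  have "(\<integral>t. h t \<partial>circ) = (LINT t:{0..1}|lborel. h t)"
    by (subst integral_restrict_space) (auto simp: set_lebesgue_integral_def)
  also have "\<dots> = integral {0..1} h"
    by (rule set_borel_integral_eq_integral(2)[OF *])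
  also have "\<dots> = I" using assms(2) by (rule integral_unique)
  finally show "(\<integral>t. h t \<partial>circ) = I" .
qed

text \<open>Cauchy's formula for derivatives on the circle of radius \<open>r\<close>. The
  derivative of the parametrisation supplies one factor of the variable, which cancels one of the
  \<open>Suc m\<close> powers in the denominator.\<close>

lemma Taylor_coeff_circ:
  assumes h: "h holomorphic_on ball 0 R" and r: "0 < r" "r < R"
  shows "(\<integral>t. h (of_real r * cisp t) * cisp t powi (- int m) \<partial>circ)
          = of_real r ^ m * (deriv ^^ m) h 0 / fact m"
proof -
  have "continuous_on (cball 0 r) h"
    using r by (intro holomorphic_on_imp_continuous_on holomorphic_on_subset[OF h]) auto
  moreover have "h holomorphic_on ball 0 r"
    using r by (intro holomorphic_on_subset[OF h]) auto
  ultimately have ci: "((\<lambda>u. h u / (u - 0) ^ Suc m) has_contour_integral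
        (2 * pi * \<i>) / fact m * (deriv ^^ m) h 0) (circlepath 0 r)"
    using r by (intro Cauchy_has_contour_integral_higher_derivative_circlepath) auto
  have nz: "cisp t \<noteq> 0" for t by simp
  have *: "h (circlepath 0 r t) / (circlepath 0 r t - 0) ^ Suc m * vector_derivative (circlepath 0 r) (at t)
      = (2 * pi * \<i> / of_real r ^ m) * (h (of_real r * cisp t) * cisp t powi (- int m))" for t
  proof -
    have 1: "circlepath 0 r t = of_real r * cisp t"
      by (simp add: circlepath cis_conv_exp mult_ac)
    have 2: "vector_derivative (circlepath 0 r) (at t) = 2 * pi * \<i> * (of_real r * cisp t)"
      by (simp add: vector_derivative_circlepath cis_conv_exp mult_ac)
    show ?thesis
      using r nz[of t] unfolding 1 2
      by (simp add: power_int_minus field_simps power_mult_distrib del: cis_neq_zero)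
  qed
  have "((\<lambda>t. (2 * pi * \<i> / of_real r ^ m) * (h (of_real r * cisp t) * cisp t powi (- int m)))
      has_integral (2 * pi * \<i>) / fact m * (deriv ^^ m) h 0) {0..1}"
    using ci unfolding has_contour_integral by (simp only: *)
  hence "((\<lambda>t. (of_real r ^ m / (2 * pi * \<i>)) * ((2 * pi * \<i> / of_real r ^ m) * (h (of_real r * cisp t)
      * cisp t powi (- int m))))
      has_integral (of_real r ^ m / (2 * pi * \<i>)) * ((2 * pi * \<i>) / fact m * (deriv ^^ m) h 0)) {0..1}"
    by (rule has_integral_mult_right)
  hence hi: "((\<lambda>t. h (of_real r * cisp t) * cisp t powi (- int m))
      has_integral of_real r ^ m * (deriv ^^ m) h 0 / fact m) {0..1}"
    using r by (simp add: field_simps)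
  have "continuous_on {0..1} (\<lambda>t. h (of_real r * cisp t) * cisp t powi (- int m))"
    by (intro continuous_intros continuous_on_compose2[OF holomorphic_on_imp_continuous_on[OF h]])
       (use r in \<open>auto simp: norm_mult\<close>)
  from circ_has_integral(1)[OF this hi] show ?thesis .
qed

lemma circ_mean_value:
  assumes h: "h holomorphic_on ball 0 R" and r: "0 < r" "r < R"
  shows "(\<integral>t. h (of_real r * cisp t) \<partial>circ) = h 0"
  using Taylor_coeff_circ[OF assms, of 0] by simp

section \<open>Radial integrals\<close>

lemma measurable_ball [measurable]: "ball (x :: 'a :: metric_space) r \<in> sets borel"
  by (intro borel_open open_ball)

lemma ennreal_mult_eq_imp_eq_divide:
  assumes "ennreal A = ennreal G * X" "G > 0" "A \<ge> 0"
  shows "X = ennreal (A / G)"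
proof -
  have "ennreal (1 / G) * ennreal G = 1"
    using assms by (simp flip: ennreal_mult')
  hence "X = ennreal (1 / G) * ennreal A"
    unfolding assms(1) by (simp flip: mult.assoc)
  also have "\<dots> = ennreal (A / G)"
    using assms(2,3) by (simp flip: ennreal_mult')
  finally show ?thesis .
qed

text \<open>Both sides arise from integrating \<open>exp (-R) * h z * (R - (norm z)\<^sup>2) powr a\<close> over the region
  \<open>(norm z)\<^sup>2 < R\<close>, once in \<open>R\<close> first and once in \<open>z\<close> first.\<close>

lemma nn_integral_homogeneous_gauss:
  fixes h :: "complex ^ 'n \<Rightarrow> ennreal"
  assumes [measurable]: "h \<in> borel_measurable borel"
    and hom: "\<And>t z. t > 0 \<Longrightarrow> h (t *\<^sub>R z) = ennreal (t ^ k) * h z"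
    and a: "a > -1"
  shows "ennreal (Gamma (a + 1)) * (\<integral>\<^sup>+z. h z * ennreal (exp (- (norm z)\<^sup>2)) \<partial>lborel)
    = ennreal (Gamma (real k / 2 + real CARD('n) + a + 1)) *
      (\<integral>\<^sup>+z. h z * ennreal ((1 - (norm z)\<^sup>2) powr a) * indicator unit_ball z \<partial>lborel)"
proof -
  let ?n = "real CARD('n)"
  have s: "real k / 2 + ?n + a + 1 > 0" using a by (simp add: add_nonneg_pos add.assoc)
  define F where "F = (\<lambda>R (z :: complex ^ 'n). ennreal (exp (- R)) * (h z * (ennreal ((R - (norm z)\<^sup>2) powr a) *
      indicator {R. (norm z)\<^sup>2 < R} R)))"
  have [measurable]: "(\<lambda>(R, z). F R z) \<in> borel_measurable (borel \<Otimes>\<^sub>M borel)"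
    unfolding F_def indicator_def by measurable
  define I where "I = (\<integral>\<^sup>+z. h z * ennreal ((1 - (norm z)\<^sup>2) powr a) * indicator unit_ball z \<partial>lborel)"
  \<comment> \<open>Substituting \<open>sqrt R *\<^sub>R z\<close> pulls out
    \<open>R powr (k / 2)\<close> from \<open>h\<close>, \<open>R powr a\<close> from the weight and
    R to the power n from the Jacobian in real dimension 2n. The exponent is left in the form s - 1
    of the Gamma integral.\<close>
  have inner_z: "(\<integral>\<^sup>+z. F R z \<partial>lborel)
      = ennreal (indicator {0..} R * R powr (real k / 2 + ?n + a + 1 - 1) / exp R) * I" for R
  proof (cases "R > 0")
    case False
    hence "F R z = 0" for z
      unfolding F_def by (smt (verit, best) indicator_simps(2) mem_Collect_eq mult_zero_right zero_le_power2)
    moreover have "R powr (real k / 2 + ?n + a + 1 - 1) = 0" if "R = 0"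
      using that by simp
    ultimately show ?thesis using False by (cases "R = 0") auto
  next
    case True
    have "(\<integral>\<^sup>+z. F R z \<partial>lborel) = ennreal (sqrt R ^ (2 * CARD('n))) * (\<integral>\<^sup>+z. F R (sqrt R *\<^sub>R z) \<partial>lborel)"
      using True nn_integral_lborel_affine[of "\<lambda>z. F R z" "sqrt R" 0] by (simp add: mult.commute)
    also have "sqrt R ^ (2 * CARD('n)) = R powr ?n"
      using True by (simp add: power_mult powr_realpow)
    also have "(\<integral>\<^sup>+z. F R (sqrt R *\<^sub>R z) \<partial>lborel) = (\<integral>\<^sup>+z. ennreal (exp (- R) * R powr (k / 2) * R powr a) *
        (h z * ennreal ((1 - (norm z)\<^sup>2) powr a) * indicator unit_ball z) \<partial>lborel)"
    proof (rule nn_integral_cong)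
      fix z :: "complex ^ 'n"
      have 1: "R - (norm (sqrt R *\<^sub>R z))\<^sup>2 = R * (1 - (norm z)\<^sup>2)"
        using True by (simp add: power_mult_distrib algebra_simps)
      have 2: "(norm (sqrt R *\<^sub>R z))\<^sup>2 < R \<longleftrightarrow> norm z < 1"
        using True by (simp add: power_mult_distrib abs_square_less_1)
      have 3: "sqrt R ^ k = R powr (k / 2)"
        using True by (simp add: powr_half_sqrt[symmetric] powr_powr flip: powr_realpow)
      show "F R (sqrt R *\<^sub>R z) = ennreal (exp (- R) * R powr (k / 2) * R powr a) *
        (h z * ennreal ((1 - (norm z)\<^sup>2) powr a) * indicator unit_ball z)"
      proof (cases "norm z < 1")
        case False
        thus ?thesis unfolding F_def indicator_def using 2 by simp
      next
        case z: True
        hence "(norm z)\<^sup>2 \<le> 1" by (simp add: power_le_one)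
        hence "(R * (1 - (norm z)\<^sup>2)) powr a = R powr a * (1 - (norm z)\<^sup>2) powr a"
          using True by (simp add: powr_mult)
        thus ?thesis using z True hom[of "sqrt R" z] 2 unfolding F_def 1 indicator_def
          by (simp add: 3 ennreal_mult mult_ac)
      qed
    qed
    also have "\<dots> = ennreal (exp (- R) * R powr (k / 2) * R powr a) * I"
      unfolding I_def by (rule nn_integral_cmult) measurable
    finally show ?thesis using True
      by (simp add: mult.assoc[symmetric] ennreal_mult[symmetric] powr_add[symmetric] exp_minus field_simps)
  qed
  \<comment> \<open>Translating \<open>R\<close> by the squared norm of \<open>z\<close> splits off
    the Gaussian and leaves the Gamma integral for \<open>a + 1\<close>.\<close>
  have inner_R: "(\<integral>\<^sup>+R. F R z \<partial>lborel) = h z * ennreal (exp (- (norm z)\<^sup>2)) * ennreal (Gamma (a + 1))" for z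
  proof -
    have "(\<integral>\<^sup>+R. F R z \<partial>lborel) = (\<integral>\<^sup>+R. F (R + (norm z)\<^sup>2) z \<partial>lborel)"
      by (rule nn_integral_lborel_translate[symmetric]) measurable
    also have "\<dots> = (\<integral>\<^sup>+R. h z * ennreal (exp (- (norm z)\<^sup>2)) * ennreal (indicator {0..} R * R powr (a
        + 1 - 1) / exp R) \<partial>lborel)"
    proof (rule nn_integral_cong)
      fix R :: real
      show "F (R + (norm z)\<^sup>2) z = h z * ennreal (exp (- (norm z)\<^sup>2)) * ennreal (indicator {0..} R * R powr (a
          + 1 - 1) / exp R)"
        by (cases "R > 0"; cases "R = 0")
           (auto simp: F_def ennreal_mult[symmetric] mult_ac exp_diff exp_minus divide_simps exp_add
             simp del: ennreal_mult'' intro!: arg_cong2[where f="(*)"])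
    qed
    also have "\<dots> = h z * ennreal (exp (- (norm z)\<^sup>2)) * ennreal (Gamma (a + 1))"
      using a by (subst nn_integral_cmult) (auto simp: Gamma_conv_nn_integral_real[of "a + 1"])
    finally show ?thesis .
  qed
  have "ennreal (Gamma (a + 1)) * (\<integral>\<^sup>+z. h z * ennreal (exp (- (norm z)\<^sup>2)) \<partial>lborel)
      = (\<integral>\<^sup>+z. \<integral>\<^sup>+R. F R z \<partial>lborel \<partial>lborel)"
    unfolding inner_R by (subst nn_integral_multc) (simp_all add: mult.commute)
  also have "\<dots> = (\<integral>\<^sup>+R. \<integral>\<^sup>+z. F R z \<partial>lborel \<partial>lborel)"
    by (rule lborel_pair.Fubini') (simp add: split_beta')
  also have "\<dots> = ennreal (Gamma (real k / 2 + ?n + a + 1)) * I"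
    using s by (simp only: inner_z Gamma_conv_nn_integral_real[OF s]) (subst nn_integral_multc, auto)
  finally show ?thesis unfolding I_def .
qed

text \<open>The identity for nonnegative functions is applied to the absolute value of
  \<open>H\<close> for integrability, then to \<open>H\<close> and \<open>- H\<close>: truncation by
  \<open>ennreal\<close> yields the positive and the negative part, both homogeneous of the same
  degree because t > 0.\<close>

lemma
  fixes H :: "complex ^ 'n \<Rightarrow> real"
  assumes [measurable]: "H \<in> borel_measurable borel"
    and hom: "\<And>t z. t > 0 \<Longrightarrow> H (t *\<^sub>R z) = t ^ k * H z"
    and a: "a > -1"
    and int: "integrable lborel (\<lambda>z. H z * ((1 - (norm z)\<^sup>2) powr a * indicator unit_ball z))"
  shows integral_homogeneous_gauss_real: "Gamma (a + 1) * (\<integral>z. H z * exp (- (norm z)\<^sup>2) \<partial>lborel)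
    = Gamma (real k / 2 + real CARD('n) + a + 1) *
      (\<integral>z. H z * ((1 - (norm z)\<^sup>2) powr a * indicator unit_ball z) \<partial>lborel)" (is ?eq)
    and integrable_homogeneous_gauss_real: "integrable lborel (\<lambda>z. H z * exp (- (norm z)\<^sup>2))" (is ?int)
proof -
  let ?G = "Gamma (a + 1)" and ?G' = "Gamma (real k / 2 + real CARD('n) + a + 1)"
  have G: "?G > 0" "?G' > 0" using a by (auto intro!: Gamma_real_pos simp: add_nonneg_pos add.assoc)
  have key: "ennreal ?G * (\<integral>\<^sup>+z. ennreal (J z * exp (- (norm z)\<^sup>2)) \<partial>lborel)
     = ennreal ?G' * (\<integral>\<^sup>+z. ennreal (J z * ((1 - (norm z)\<^sup>2) powr a * indicator unit_ball z)) \<partial>lborel)"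
    if [measurable]: "J \<in> borel_measurable borel" and J: "\<And>t z. t > 0 \<Longrightarrow> J (t *\<^sub>R z) = t ^ k * J z"
    for J :: "complex ^ 'n \<Rightarrow> real"
  proof -
    have "ennreal (J (t *\<^sub>R z)) = ennreal (t ^ k) * ennreal (J z)" if "t > 0" for t z
      using that J[OF that] by (simp add: ennreal_mult')
    from nn_integral_homogeneous_gauss[of "\<lambda>z. ennreal (J z)" k a, OF _ this a]
    show ?thesis by (simp add: ennreal_mult'' ennreal_indicator mult.assoc)
  qed
  note kA = key[of "\<lambda>z. \<bar>H z\<bar>"]
  have kH': "ennreal ?G * (\<integral>\<^sup>+z. ennreal (H z * exp (- (norm z)\<^sup>2)) \<partial>lborel)
     = ennreal ?G' * (\<integral>\<^sup>+z. ennreal (H z * ((1 - (norm z)\<^sup>2) powr a * indicator unit_ball z)) \<partial>lborel)"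
    by (rule key) (auto simp: hom)
  have kN': "ennreal ?G * (\<integral>\<^sup>+z. ennreal (- (H z * exp (- (norm z)\<^sup>2))) \<partial>lborel)
     = ennreal ?G' * (\<integral>\<^sup>+z. ennreal (- (H z * ((1 - (norm z)\<^sup>2) powr a * indicator unit_ball z))) \<partial>lborel)"
    using key[of "\<lambda>z. - H z"] by (simp add: hom)
  have "(\<integral>\<^sup>+z. ennreal (\<bar>H z\<bar> * ((1 - (norm z)\<^sup>2) powr a * indicator unit_ball z)) \<partial>lborel) < \<infinity>"
    using int by (simp add: integrable_iff_bounded abs_mult)
  hence "ennreal ?G * (\<integral>\<^sup>+z. ennreal (\<bar>H z\<bar> * exp (- (norm z)\<^sup>2)) \<partial>lborel) < \<infinity>"
    by (subst kA) (auto simp: hom abs_mult ennreal_mult_less_top)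
  hence "(\<integral>\<^sup>+z. ennreal (\<bar>H z\<bar> * exp (- (norm z)\<^sup>2)) \<partial>lborel) < \<infinity>"
    using G by (auto simp: ennreal_mult_less_top)
  thus i: ?int by (simp add: integrable_iff_bounded abs_mult)
  have "?G * (\<integral>z. H z * exp (- (norm z)\<^sup>2) \<partial>lborel)
     = enn2real (ennreal ?G * (\<integral>\<^sup>+z. ennreal (H z * exp (- (norm z)\<^sup>2)) \<partial>lborel))
     - enn2real (ennreal ?G * (\<integral>\<^sup>+z. ennreal (- (H z * exp (- (norm z)\<^sup>2))) \<partial>lborel))"
    using G by (subst real_lebesgue_integral_def[OF i]) (simp add: enn2real_mult right_diff_distrib)
  also have "\<dots> = ?G' * (\<integral>z. H z * ((1 - (norm z)\<^sup>2) powr a * indicator unit_ball z) \<partial>lborel)"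
    unfolding kH' kN' real_lebesgue_integral_def[OF int] using G
    by (simp add: enn2real_mult right_diff_distrib)
  finally show ?eq .
qed

lemma integral_homogeneous_gauss:
  fixes H :: "complex ^ 'n \<Rightarrow> complex"
  assumes [measurable]: "H \<in> borel_measurable borel"
    and hom: "\<And>t z. t > 0 \<Longrightarrow> H (t *\<^sub>R z) = of_real t ^ k * H z"
    and a: "a > -1"
    and int: "integrable lborel (\<lambda>z. H z * of_real ((1 - (norm z)\<^sup>2) powr a * indicator unit_ball z))"
  shows "of_real (Gamma (a + 1)) * (\<integral>z. H z * of_real (exp (- (norm z)\<^sup>2)) \<partial>lborel)
    = of_real (Gamma (real k / 2 + real CARD('n) + a + 1)) *
      (\<integral>z. H z * of_real ((1 - (norm z)\<^sup>2) powr a * indicator unit_ball z) \<partial>lborel)"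
    and "integrable lborel (\<lambda>z. H z * of_real (exp (- (norm z)\<^sup>2)))" (is ?int)
proof -
  let ?G = "Gamma (a + 1)" and ?G' = "Gamma (real k / 2 + real CARD('n) + a + 1)"
  have h1: "Re (H (t *\<^sub>R z)) = t ^ k * Re (H z)" "Im (H (t *\<^sub>R z)) = t ^ k * Im (H z)" if "t > 0" for t z
    using that by (simp_all add: hom flip: of_real_power)
  have i1: "integrable lborel (\<lambda>z. Re (H z) * ((1 - (norm z)\<^sup>2) powr a * indicator unit_ball z))"
    "integrable lborel (\<lambda>z. Im (H z) * ((1 - (norm z)\<^sup>2) powr a * indicator unit_ball z))"
    using integrable_Re[OF int] integrable_Im[OF int] by simp_all
  note R = integral_homogeneous_gauss_real[of "\<lambda>z. Re (H z)" k a, OF _ h1(1) a i1(1)]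
    integrable_homogeneous_gauss_real[of "\<lambda>z. Re (H z)" k a, OF _ h1(1) a i1(1)]
  note I = integral_homogeneous_gauss_real[of "\<lambda>z. Im (H z)" k a, OF _ h1(2) a i1(2)]
    integrable_homogeneous_gauss_real[of "\<lambda>z. Im (H z)" k a, OF _ h1(2) a i1(2)]
  have "integrable lborel (\<lambda>z. complex_of_real (Re (H z) * exp (- (norm z)\<^sup>2))
      + \<i> * complex_of_real (Im (H z) * exp (- (norm z)\<^sup>2)))"
    using R(2) I(2) by (intro Bochner_Integration.integrable_add integrable_mult_right integrable_of_real) auto
  moreover have "complex_of_real (Re (H z) * exp (- (norm z)\<^sup>2))
      + \<i> * complex_of_real (Im (H z) * exp (- (norm z)\<^sup>2)) = H z * of_real (exp (- (norm z)\<^sup>2))" for z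
    by (simp add: complex_eq_iff)
  ultimately show int': ?int
    by simp
  show "of_real (Gamma (a + 1)) * (\<integral>z. H z * of_real (exp (- (norm z)\<^sup>2)) \<partial>lborel)
    = of_real (Gamma (real k / 2 + real CARD('n) + a + 1)) *
      (\<integral>z. H z * of_real ((1 - (norm z)\<^sup>2) powr a * indicator unit_ball z) \<partial>lborel)"
  proof (rule complex_eqI)
    show "Re (of_real ?G * (\<integral>z. H z * of_real (exp (- (norm z)\<^sup>2)) \<partial>lborel))
       = Re (of_real ?G' * (\<integral>z. H z * of_real ((1 - (norm z)\<^sup>2) powr a * indicator unit_ball z) \<partial>lborel))"
      using R(1) integral_Re[OF int] integral_Re[OF int'] by simp
    show "Im (of_real ?G * (\<integral>z. H z * of_real (exp (- (norm z)\<^sup>2)) \<partial>lborel))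
       = Im (of_real ?G' * (\<integral>z. H z * of_real ((1 - (norm z)\<^sup>2) powr a * indicator unit_ball z) \<partial>lborel))"
      using I(1) integral_Im[OF int] integral_Im[OF int'] by simp
  qed
qed

text \<open>Kept symbolic: it stands in the denominator of \<open>c_const\<close> and as a factor in
  Fischer's identity, and cancels in \<open>hcomp_orthogonality\<close>.\<close>

definition gauss_integral :: "'n::finite itself \<Rightarrow> real" where
  "gauss_integral _ = (\<integral>z. exp (- (norm (z :: complex ^ 'n))\<^sup>2) \<partial>lborel)"

lemma
  assumes a: "a > -1"
  shows nn_integral_ball_weight:
      "(\<integral>\<^sup>+z. ennreal ((1 - (norm z)\<^sup>2) powr a * indicator unit_ball (z :: complex ^ 'n)) \<partial>lborel)
        = ennreal (Gamma (a + 1) * gauss_integral TYPE('n) / Gamma (real CARD('n) + a + 1))" (is ?nn)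
    and gauss_integral_pos: "gauss_integral TYPE('n) > 0" (is ?pos)
    and integrable_gauss: "integrable lborel (\<lambda>z. exp (- (norm (z :: complex ^ 'n))\<^sup>2))" (is ?int)
proof -
  let ?E = "\<lambda>z::complex ^ 'n. ennreal (exp (- (norm z)\<^sup>2))"
  have key: "ennreal (Gamma (a + 1)) * (\<integral>\<^sup>+z. ?E z \<partial>lborel)
    = ennreal (Gamma (real CARD('n) + a + 1)) *
      (\<integral>\<^sup>+z. ennreal ((1 - (norm z)\<^sup>2) powr a * indicator unit_ball (z :: complex ^ 'n)) \<partial>lborel)"
    if "a > -1" for a
    using nn_integral_homogeneous_gauss[of "\<lambda>_::complex ^ 'n. 1" 0 a] that
    by (simp add: ennreal_mult'' ennreal_indicator)
  \<comment> \<open>At a = 0 the weight is the indicator of the ball, whose finite positive volume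
    shows that the Gaussian integral is finite and positive. The convention
    \<open>0 powr 0 = 0\<close> only affects the unit sphere, which lies outside the open
    ball.\<close>
  have 0: "(\<integral>\<^sup>+z. ennreal ((1 - (norm z)\<^sup>2) powr 0 * indicator unit_ball (z :: complex ^ 'n)) \<partial>lborel)
      = emeasure lborel (unit_ball :: (complex ^ 'n) set)"
  proof -
    have "((1 - (norm z)\<^sup>2) powr 0 * indicator unit_ball z) = indicat_real unit_ball z" for z :: "complex ^ 'n"
      by (auto simp: indicator_def abs_square_eq_1)
    thus ?thesis by (simp only: ennreal_indicator) simp
  qed
  have fin: "emeasure lborel (unit_ball :: (complex ^ 'n) set) < \<infinity>"
    "emeasure lborel (unit_ball :: (complex ^ 'n) set) > 0"
    using emeasure_lborel_ball_finite[of "0 :: complex ^ 'n" 1]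
      unit_ball_vol_pos[of "real DIM(complex ^ 'n)"] by (auto simp: emeasure_ball)
  have E: "(\<integral>\<^sup>+z. ?E z \<partial>lborel) = ennreal (Gamma (real CARD('n)
      + 1)) * emeasure lborel (unit_ball :: (complex ^ 'n) set)"
    using key[of 0] unfolding 0 by simp
  have Gn: "Gamma (real CARD('n) + 1) > 0" by (intro Gamma_real_pos) simp
  show int: ?int
    using fin Gn by (intro integrableI_bounded) (auto simp: E ennreal_mult_less_top)
  have E': "(\<integral>\<^sup>+z. ?E z \<partial>lborel) = ennreal (gauss_integral TYPE('n))"
    unfolding gauss_integral_def by (rule nn_integral_eq_integral[OF int]) simp
  have "(\<integral>\<^sup>+z. ?E z \<partial>lborel) > 0" unfolding E using fin Gn by (simp add: ennreal_zero_less_mult_iff)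
  thus pos: ?pos unfolding E' by simp
  have G: "Gamma (a + 1) > 0" "Gamma (real CARD('n) + a + 1) > 0"
    using a by (auto intro!: Gamma_real_pos simp: add_nonneg_pos add.assoc)
  show ?nn
    using key[OF a] G pos unfolding E'
    by (intro ennreal_mult_eq_imp_eq_divide) (simp_all flip: ennreal_mult')
qed

section \<open>The Hermitian form, the Bergman kernel and the weighted measure\<close>

lemma hermitian_add_left: "hermitian (z + w) u = hermitian z u + hermitian w u"
  by (simp add: hermitian_def algebra_simps sum.distrib)

lemma hermitian_add_right: "hermitian u (z + w) = hermitian u z + hermitian u w"
  by (simp add: hermitian_def algebra_simps sum.distrib)

lemma hermitian_diff_left: "hermitian (z - w) u = hermitian z u - hermitian w u"
  by (simp add: hermitian_def algebra_simps sum_subtractf)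

lemma hermitian_smult_left [simp]: "hermitian (c *s z) u = c * hermitian z u"
  by (simp add: hermitian_def sum_distrib_left mult_ac)

lemma hermitian_smult_right [simp]: "hermitian z (c *s u) = cnj c * hermitian z u"
  by (simp add: hermitian_def sum_distrib_left mult_ac)

lemma cnj_hermitian [simp]: "cnj (hermitian z w) = hermitian w z"
  by (simp add: hermitian_def mult.commute)

lemma hermitian_0 [simp]: "hermitian 0 z = 0" "hermitian z 0 = 0"
  by (simp_all add: hermitian_def)

lemma Re_hermitian: "Re (hermitian z w) = inner z w"
  by (simp add: hermitian_def inner_vec_def inner_complex_def)

lemma hermitian_self: "hermitian z z = of_real ((norm z)\<^sup>2)"
proof (rule complex_eqI)
  show "Re (hermitian z z) = Re (of_real ((norm z)\<^sup>2))"
    by (simp add: Re_hermitian dot_square_norm)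
  have "cnj (hermitian z z) = hermitian z z" by simp
  hence "Im (hermitian z z) = 0" by (metis complex_cnj_cancel_iff complex_eq_iff complex_cnj add.inverse_neutral cnj.simps(2) equal_neg_zero)
  thus "Im (hermitian z z) = Im (of_real ((norm z)\<^sup>2))" by simp
qed

text \<open>The real Cauchy-Schwarz inequality after rotating \<open>z\<close> by a unimodular
  \<open>c\<close> that makes the product nonnegative.\<close>

lemma norm_hermitian_le: "norm (hermitian z w) \<le> norm z * norm w"
proof -
  obtain c where c: "norm c = 1" "c * hermitian z w = of_real (norm (hermitian z w))"
  proof (cases "hermitian z w = 0")
    case True thus ?thesis by (intro that[of 1]) auto
  next
    case False
    thus ?thesis
      by (intro that[of "cnj (hermitian z w) / of_real (norm (hermitian z w))"])
         (auto simp: norm_divide complex_norm_square[symmetric] power2_eq_square mult.commute complex_mult_cnj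
           simp del: cnj_hermitian)
  qed
  have "norm (hermitian z w) = Re (hermitian (c *s z) w)" using c by simp
  also have "\<dots> \<le> norm (c *s z) * norm w" unfolding Re_hermitian by (rule norm_cauchy_schwarz)
  finally show ?thesis using c by simp
qed

lemma hermitian_norm_less_1:
  assumes "norm z < 1" "norm w < 1" shows "norm (hermitian z w) < 1"
  using norm_hermitian_le[of z w] mult_strict_mono'[OF assms] by simp

lemma Re_hermitian_less_1:
  assumes "norm z < 1" "norm w < 1" shows "Re (hermitian z w) < 1"
  using hermitian_norm_less_1[OF assms] complex_Re_le_cmod[of "hermitian z w"] by linarith

lemma continuous_on_hermitian [continuous_intros]:
  assumes "continuous_on S f" "continuous_on S g"
  shows "continuous_on S (\<lambda>x. hermitian (f x) (g x))"
  unfolding hermitian_def using assms by (intro continuous_intros)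

lemma measurable_hermitian [measurable]:
  fixes f g :: "'a \<Rightarrow> complex ^ 'n"
  assumes "f \<in> borel_measurable M" "g \<in> borel_measurable M"
  shows "(\<lambda>x. hermitian (f x) (g x)) \<in> borel_measurable M"
proof -
  have "continuous_on UNIV (\<lambda>p::(complex ^ 'n) \<times> (complex ^ 'n). hermitian (fst p) (snd p))"
    by (intro continuous_intros)
  from borel_measurable_continuous_Pair[OF assms this] show ?thesis .
qed

text \<open>The factor \<open>0\<close> outside the region of interest makes the kernel measurable in both variables
  without discussing the branch cut of \<open>powr\<close>.\<close>

definition bkern :: "real \<Rightarrow> complex ^ 'n \<Rightarrow> complex ^ 'n \<Rightarrow> complex" where
  "bkern s z \<xi> = (if Re (hermitian z \<xi>) < 1 then (1 - hermitian z \<xi>) powr of_real (- s) else 0)"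

lemma bkern_eq: "norm z < 1 \<Longrightarrow> norm \<xi> < 1 \<Longrightarrow> bkern s z \<xi> = (1 - hermitian z \<xi>) powr of_real (- s)"
  by (simp add: bkern_def Re_hermitian_less_1)

lemma bkern_eq_divide:
  "norm z < 1 \<Longrightarrow> norm \<xi> < 1 \<Longrightarrow> bkern s z \<xi> = 1 / (1 - hermitian z \<xi>) powr of_real s"
  by (simp add: bkern_eq powr_minus divide_inverse)

lemma measurable_bkern [measurable]:
  fixes f g :: "'a \<Rightarrow> complex ^ 'n"
  assumes [measurable]: "f \<in> borel_measurable M" "g \<in> borel_measurable M"
  shows "(\<lambda>x. bkern s (f x) (g x)) \<in> borel_measurable M"
proof -
  have "{u. Re u < 1} \<in> sets borel"
    by (intro borel_open open_halfspace_Re_lt)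
  hence "(\<lambda>u::complex. if u \<in> {u. Re u < 1} then (1 - u) powr of_real (- s) else 0) \<in> borel_measurable borel"
    by (rule borel_measurable_continuous_on_if)
       (auto intro!: continuous_intros simp: complex_nonpos_Reals_iff)
  from measurable_compose[OF measurable_hermitian[OF assms] this] show ?thesis
    by (simp add: bkern_def)
qed

lemma cnj_bkern: "cnj (bkern s z \<xi>) = bkern s \<xi> z"
proof -
  have "cnj ((1 - hermitian z \<xi>) powr of_real (- s)) = (1 - hermitian \<xi> z) powr of_real (- s)"
    if "Re (hermitian z \<xi>) < 1"
    using that by (subst cnj_powr) auto
  moreover have "Re (hermitian \<xi> z) = Re (hermitian z \<xi>)"
    by (metis Re_hermitian inner_commute)
  ultimately show ?thesis by (auto simp: bkern_def)
qed

lemma norm_bkern: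
  assumes "Re (hermitian z \<xi>) < 1"
  shows "norm (bkern s z \<xi>) = norm (1 - hermitian z \<xi>) powr (- s)"
  using assms by (auto simp: bkern_def norm_powr_real_powr')

lemma one_minus_hermitian_ge: "1 - norm z * norm \<xi> \<le> norm (1 - hermitian z \<xi>)"
  using norm_hermitian_le[of z \<xi>] norm_triangle_ineq2[of 1 "hermitian z \<xi>"] by simp

lemma norm_bkern_le:
  assumes "norm z * norm \<xi> \<le> r" "r < 1" "s \<ge> 0"
  shows "norm (bkern s z \<xi>) \<le> (1 - r) powr (- s)"
proof -
  have "Re (hermitian z \<xi>) < 1"
    using norm_hermitian_le[of z \<xi>] complex_Re_le_cmod[of "hermitian z \<xi>"] assms by linarith
  moreover have "norm (1 - hermitian z \<xi>) \<ge> 1 - r"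
    using one_minus_hermitian_ge[of z \<xi>] assms by linarith
  ultimately show ?thesis using assms by (auto simp: norm_bkern intro!: powr_mono2')
qed

text \<open>Density of \<open>nu\<close> with respect to Lebesgue measure, extended by zero to the
  whole space, so that translations, dilations and rotations become available.\<close>

definition wt :: "real \<Rightarrow> complex ^ 'n \<Rightarrow> real" where
  "wt \<alpha> z = c_const TYPE('n) \<alpha> * ((1 - (norm z)\<^sup>2) powr \<alpha> * indicator unit_ball z)"

lemma measurable_wt [measurable]: "wt \<alpha> \<in> borel_measurable borel"
  unfolding wt_def by measurable

lemma space_nu [simp]: "space (nu \<alpha>) = unit_ball"
  by (simp add: nu_def space_restrict_space)

lemma sets_nu [measurable_cong]: "sets (nu \<alpha>) = sets (restrict_space borel unit_ball)"
  unfolding nu_def by (simp add: sets_restrict_space)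

lemma borel_measurable_nu_iff:
  fixes f :: "complex ^ 'n \<Rightarrow> 'b::real_normed_vector"
  shows "f \<in> borel_measurable (nu \<alpha>) \<longleftrightarrow> (\<lambda>z. indicator unit_ball z *\<^sub>R f z) \<in> borel_measurable borel"
  by (subst borel_measurable_restrict_space_iff[symmetric])
     (auto simp: measurable_cong_sets[OF sets_nu refl])

lemma measurable_nu_borel [measurable (raw)]:
  "f \<in> borel_measurable borel \<Longrightarrow> f \<in> borel_measurable (nu \<alpha>)"
  by (subst measurable_cong_sets[OF sets_nu refl]) (rule measurable_restrict_space1)

lemma continuous_on_imp_measurable_nu:
  "continuous_on unit_ball f \<Longrightarrow> f \<in> borel_measurable (nu \<alpha>)"
  by (subst measurable_cong_sets[OF sets_nu refl]) (rule borel_measurable_continuous_on_restrict)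

lemma c_const_eq:
  assumes "\<alpha> > -1"
  shows "c_const TYPE('n::finite) \<alpha>
    = Gamma (real CARD('n) + \<alpha> + 1) / (Gamma (\<alpha> + 1) * gauss_integral TYPE('n))"
proof -
  have G: "Gamma (\<alpha> + 1) > 0" "Gamma (real CARD('n) + \<alpha> + 1) > 0"
    using assms by (auto intro!: Gamma_real_pos simp: add_nonneg_pos add.assoc)
  have "(LINT z : (unit_ball :: (complex ^ 'n) set) | lborel. (1 - (norm z)\<^sup>2) powr \<alpha>)
      = (\<integral>z. (1 - (norm z)\<^sup>2) powr \<alpha> * indicator unit_ball (z :: complex ^ 'n) \<partial>lborel)"
    by (simp add: set_lebesgue_integral_def mult.commute)
  also have "\<dots> = enn2real (\<integral>\<^sup>+z. ennreal ((1 - (norm z)\<^sup>2) powr \<alpha> * indicator unit_ball (z :: complex ^ 'n)) \<partial>lborel)"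
    by (intro integral_eq_nn_integral) auto
  also have "\<dots> = Gamma (\<alpha> + 1) * gauss_integral TYPE('n) / Gamma (real CARD('n) + \<alpha> + 1)"
    using G gauss_integral_pos[OF assms, where 'n='n] by (subst nn_integral_ball_weight[OF assms]) simp
  finally show ?thesis by (simp add: c_const_def)
qed

lemma c_const_pos:
  assumes "\<alpha> > -1" shows "c_const TYPE('n::finite) \<alpha> > 0"
proof -
  have G: "Gamma (\<alpha> + 1) > 0" "Gamma (real CARD('n) + \<alpha> + 1) > 0"
    using assms by (auto intro!: Gamma_real_pos simp: add_nonneg_pos add.assoc)
  thus ?thesis using gauss_integral_pos[OF assms, where 'n='n] by (simp add: c_const_eq[OF assms])
qed

lemma wt_nonneg: "\<alpha> > -1 \<Longrightarrow> wt \<alpha> z \<ge> 0"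
  using c_const_pos[of \<alpha>, where 'n='a] by (simp add: wt_def)

lemma nn_integral_nu:
  fixes f :: "complex ^ 'n \<Rightarrow> ennreal"
  assumes a: "\<alpha> > -1" and f: "f \<in> borel_measurable (nu \<alpha>)"
  shows "(\<integral>\<^sup>+z. f z \<partial>nu \<alpha>) = (\<integral>\<^sup>+z. ennreal (wt \<alpha> z) * f z \<partial>lborel)"
proof -
  have f': "f \<in> borel_measurable (restrict_space lborel unit_ball)"
    using f by (simp add: nu_def)
  have "(\<integral>\<^sup>+z. f z \<partial>nu \<alpha>) = (\<integral>\<^sup>+z. ennreal (c_const TYPE('n) \<alpha> * (1 - (norm z)\<^sup>2) powr \<alpha>) * f z
      \<partial>restrict_space lborel unit_ball)"
    unfolding nu_def by (subst nn_integral_density[OF _ f']) (auto intro!: measurable_restrict_space1)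
  also have "\<dots> = (\<integral>\<^sup>+z. ennreal (wt \<alpha> z) * f z \<partial>lborel)"
    by (subst nn_integral_restrict_space) (auto intro!: nn_integral_cong simp: wt_def indicator_def)
  finally show ?thesis .
qed

lemma
  fixes f :: "complex ^ 'n \<Rightarrow> 'b::{banach, second_countable_topology}"
  assumes a: "\<alpha> > -1" and f: "f \<in> borel_measurable (nu \<alpha>)"
  shows integral_nu: "(\<integral>z. f z \<partial>nu \<alpha>) = (\<integral>z. wt \<alpha> z *\<^sub>R f z \<partial>lborel)"
    and integrable_nu_iff: "integrable (nu \<alpha>) f \<longleftrightarrow> integrable lborel (\<lambda>z. wt \<alpha> z *\<^sub>R f z)"
proof -
  have f': "f \<in> borel_measurable (restrict_space lborel unit_ball)"
    using f by (simp add: nu_def)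
  have c: "c_const TYPE('n) \<alpha> \<ge> 0" using c_const_pos[OF a, where 'n='n] by simp
  have eq: "(indicator unit_ball z * (c_const TYPE('n) \<alpha> * (1 - (norm z)\<^sup>2) powr \<alpha>)) *\<^sub>R f z = wt \<alpha> z *\<^sub>R f z" for z
    by (auto simp: wt_def indicator_def)
  show "(\<integral>z. f z \<partial>nu \<alpha>) = (\<integral>z. wt \<alpha> z *\<^sub>R f z \<partial>lborel)"
    unfolding nu_def using c
    by (subst integral_density[OF f'])
       (auto intro!: measurable_restrict_space1 simp: integral_restrict_space eq)
  show "integrable (nu \<alpha>) f \<longleftrightarrow> integrable lborel (\<lambda>z. wt \<alpha> z *\<^sub>R f z)"
    unfolding nu_def using c
    by (subst integrable_density[OF f'])
       (auto intro!: measurable_restrict_space1 simp: integrable_restrict_space eq)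
qed

lemma prob_nu:
  assumes a: "\<alpha> > -1"
  shows "emeasure (nu \<alpha> :: (complex ^ 'n) measure) unit_ball = 1"
proof -
  have G: "Gamma (\<alpha> + 1) > 0" "Gamma (real CARD('n) + \<alpha> + 1) > 0"
    using assms by (auto intro!: Gamma_real_pos simp: add_nonneg_pos add.assoc)
  note g = gauss_integral_pos[OF assms, where 'n='n]
  have "emeasure (nu \<alpha> :: (complex ^ 'n) measure) unit_ball = (\<integral>\<^sup>+z. 1 \<partial>(nu \<alpha> :: (complex ^ 'n) measure))"
    by simp
  also have "\<dots> = (\<integral>\<^sup>+z. ennreal (wt \<alpha> (z :: complex ^ 'n)) \<partial>lborel)"
    by (subst nn_integral_nu[OF a]) auto
  also have "\<dots> = ennreal (c_const TYPE('n) \<alpha>) *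
      (\<integral>\<^sup>+z. ennreal ((1 - (norm z)\<^sup>2) powr \<alpha> * indicator unit_ball (z :: complex ^ 'n)) \<partial>lborel)"
    unfolding wt_def using c_const_pos[OF a, where 'n='n] by (subst nn_integral_cmult[symmetric]) (auto simp: ennreal_mult)
  also have "\<dots> = 1"
    using G g by (subst nn_integral_ball_weight[OF a], subst ennreal_mult[symmetric]) (auto simp: c_const_eq[OF a])
  finally show ?thesis .
qed

lemma finite_measure_nu: "\<alpha> > -1 \<Longrightarrow> finite_measure (nu \<alpha> :: (complex ^ 'n) measure)"
  by (rule finite_measureI) (simp add: prob_nu)

lemma bergman_proj_eq:
  fixes z :: "complex ^ 'n"
  assumes "norm z < 1"
  shows "bergman_proj \<alpha> f z = (\<integral>\<xi>. f \<xi> * bkern (real CARD('n) + 1 + \<alpha>) z \<xi> \<partial>nu \<alpha>)"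
  unfolding bergman_proj_def
  using assms by (intro Bochner_Integration.integral_cong refl) (auto simp: bkern_eq_divide of_real_add)

section \<open>The reproducing formula\<close>

lemma linear_slice: "linear (\<lambda>\<mu>::complex. \<mu> *s (u :: complex ^ 'n))"
  by (rule linearI) (auto simp: vec_eq_iff algebra_simps)

lemma holomorphic_Cn_continuous_on:
  "holomorphic_Cn f S \<Longrightarrow> continuous_on S f"
  unfolding holomorphic_Cn_def continuous_on_eq_continuous_within
  using has_derivative_continuous by blast

lemma holomorphic_Cn_measurable:
  "holomorphic_Cn f unit_ball \<Longrightarrow> f \<in> borel_measurable (nu \<alpha>)"
  by (intro continuous_on_imp_measurable_nu holomorphic_Cn_continuous_on)

text \<open>Complex linearity of the derivative \<open>D\<close> turns \<open>D (\<mu> *s u)\<close>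
  into \<open>\<mu> * D u\<close>, which is what a complex derivative along a line has to
  be.\<close>

lemma holomorphic_Cn_slice:
  fixes f :: "complex ^ 'n \<Rightarrow> complex"
  assumes f: "holomorphic_Cn f S" and S: "\<And>\<mu>. \<mu> \<in> A \<Longrightarrow> z + \<mu> *s u \<in> S"
  shows "(\<lambda>\<mu>. f (z + \<mu> *s u)) holomorphic_on A"
  unfolding holomorphic_on_def field_differentiable_def
proof
  fix \<mu> assume \<mu>: "\<mu> \<in> A"
  from f S[OF \<mu>] obtain D where D: "(f has_derivative D) (at (z + \<mu> *s u) within S)"
    and hom: "\<And>c v. D (c *s v) = c * D v"
    unfolding holomorphic_Cn_def by blast
  have "((\<lambda>\<mu>. z + \<mu> *s u) has_derivative (\<lambda>\<mu>. \<mu> *s u)) (at \<mu> within A)"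
    using linear_slice[of u]
    by (auto intro!: derivative_eq_intros bounded_linear_imp_has_derivative simp: linear_conv_bounded_linear)
  from has_derivative_in_compose2[OF _ _ \<mu> this, of S f "\<lambda>_. D"] D S
  have "((\<lambda>\<mu>. f (z + \<mu> *s u)) has_derivative (\<lambda>\<mu>. D (\<mu> *s u))) (at \<mu> within A)"
    by (intro has_derivative_in_compose[where g=f and f="\<lambda>\<mu>. z + \<mu> *s u", THEN has_derivative_eq_rhs])
       (auto intro: has_derivative_subset[OF D] simp: \<open>((\<lambda>\<mu>. z + \<mu> *s u) has_derivative (\<lambda>\<mu>. \<mu> *s u)) (at \<mu> within A)\<close>)
  hence "((\<lambda>\<mu>. f (z + \<mu> *s u)) has_field_derivative D u) (at \<mu> within A)"
    unfolding has_field_derivative_def by (rule has_derivative_eq_rhs) (auto simp: hom)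
  thus "\<exists>f'. ((\<lambda>\<mu>. f (z + \<mu> *s u)) has_field_derivative f') (at \<mu> within A)" ..
qed

text \<open>Room beyond the circle of radius \<open>r\<close>, as Cauchy's formula demands: \<mu>
  with norm below \<open>R\<close> still takes \<open>z\<close> into the open ball.\<close>

lemma slice_radius:
  assumes "r * norm (z :: complex ^ 'n) < 1" "r > 0"
  obtains R where "R > r" "R * norm z \<le> 1"
  using assms
  by (cases "z = 0") (auto intro: that[of "r + 1"] that[of "1 / norm z"] simp: field_simps)

text \<open>The homogeneous component of degree \<open>m\<close>, as a function on the whole space.\<close>

definition hcomp :: "nat \<Rightarrow> (complex ^ 'n \<Rightarrow> complex) \<Rightarrow> complex ^ 'n \<Rightarrow> complex" where
  "hcomp m f z = (deriv ^^ m) (\<lambda>\<mu>. f (\<mu> *s z)) 0 / fact m"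

context
  fixes f :: "complex ^ 'n \<Rightarrow> complex"
  assumes f: "holomorphic_Cn f unit_ball"
begin

lemma radial_slice_holomorphic: "R * norm z \<le> 1 \<Longrightarrow> (\<lambda>\<mu>. f (\<mu> *s z)) holomorphic_on ball 0 R"
proof -
  assume R: "R * norm z \<le> 1"
  have "norm \<mu> * norm z < 1" if "norm \<mu> < R" for \<mu> :: complex
  proof (cases "z = 0")
    case False
    hence "norm \<mu> * norm z < R * norm z" using that by simp
    thus ?thesis using R by linarith
  qed auto
  thus ?thesis using holomorphic_Cn_slice[OF f, of "ball 0 R" 0 z] by simp
qed

lemma hcomp_circ:
  assumes "r > 0" "r * norm z < 1"
  shows "(\<integral>t. f ((of_real r * cisp t) *s z) * cisp t powi (- int m) \<partial>circ) = of_real r ^ m * hcomp m f z"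
proof -
  obtain R where "R > r" "R * norm z \<le> 1" using slice_radius assms by blast
  thus ?thesis
    using Taylor_coeff_circ[OF radial_slice_holomorphic, of R z r m] assms by (simp add: hcomp_def)
qed

lemma hcomp_homogeneous: "hcomp m f (c *s z) = c ^ m * hcomp m f z"
proof -
  define e where "e = 1 / ((1 + norm c) * (1 + norm z))"
  have pos: "(1 + norm c) * (1 + norm z) > 0" by (intro mult_pos_pos) (simp_all add: add_pos_nonneg)
  hence e: "e > 0" "e * norm c * norm z < 1" "e * norm z \<le> 1"
    by (auto simp: e_def divide_simps algebra_simps add_pos_nonneg intro!: add_pos_nonneg)
  define R where "R = 1 / (1 + norm z)"
  have R: "R * norm z \<le> 1" "R > 0" by (auto simp: R_def divide_simps add_pos_nonneg)
  have "(deriv ^^ m) (\<lambda>\<mu>. f ((c * \<mu>) *s z)) 0 = c ^ m * (deriv ^^ m) (\<lambda>\<mu>. f (\<mu> *s z)) (c * 0)"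
  proof (rule higher_deriv_compose_linear[where S="ball 0 (R / (1 + norm c))" and T="ball 0 R"])
    show "(\<lambda>\<mu>. f (\<mu> *s z)) holomorphic_on ball 0 R" by (rule radial_slice_holomorphic[OF R(1)])
    show "c * w \<in> ball 0 R" if "w \<in> ball 0 (R / (1 + norm c))" for w
    proof -
      have "norm c * norm w \<le> (1 + norm c) * norm w" by (simp add: algebra_simps)
      also have "\<dots> < R" using that by (simp add: field_simps add_pos_nonneg)
      finally show ?thesis by (simp add: norm_mult)
    qed
    show "0 \<in> ball (0::complex) (R / (1 + norm c))" using R by (simp add: add_pos_nonneg)
  qed auto
  thus ?thesis by (simp add: hcomp_def mult.commute)
qed

lemma hcomp_homogeneous_real: "hcomp m f (t *\<^sub>R z) = of_real t ^ m * hcomp m f z"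
proof -
  have "t *\<^sub>R z = of_real t *s z" by (simp add: vec_eq_iff scaleR_conv_of_real[symmetric])
  thus ?thesis by (simp add: hcomp_homogeneous)
qed

lemma measurable_f_cut: "(\<lambda>z. indicator unit_ball z *\<^sub>R f z) \<in> borel_measurable borel"
  using holomorphic_Cn_measurable[OF f, of 0] by (simp add: borel_measurable_nu_iff)

text \<open>The iterated derivative is not visibly measurable in \<open>z\<close>; the circle
  integral is, but represents it only inside the ball. Homogeneity carries it everywhere from the
  point z / (1 + |z|), which always lies in the ball.\<close>

lemma measurable_hcomp [measurable]: "hcomp m f \<in> borel_measurable borel"
proof -
  note [measurable] = measurable_f_cut
  interpret finite_measure circ by (rule finite_measure_circ)
  define g where "g z = (\<integral>t. (indicator unit_ball ((1 * cisp t) *s z) *\<^sub>R f ((1 * cisp t) *s z))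
      * cisp t powi (- int m) \<partial>circ)" for z
  have [measurable]: "g \<in> borel_measurable borel"
    unfolding g_def power_int_minus power_int_of_nat by measurable
  have "hcomp m f z = of_real (1 + norm z) ^ m * g ((1 / (1 + norm z)) *\<^sub>R z)" for z
  proof -
    let ?t = "1 + norm z"
    have t: "?t > 0" by (simp add: add_pos_nonneg)
    have n: "norm ((1 / ?t) *\<^sub>R z) < 1" using t by simp
    have "g ((1 / ?t) *\<^sub>R z) = (\<integral>t. f ((of_real 1 * cisp t) *s ((1 / ?t) *\<^sub>R z)) * cisp t powi (- int m) \<partial>circ)"
      unfolding g_def using n by (intro Bochner_Integration.integral_cong) auto
    also have "\<dots> = of_real 1 ^ m * hcomp m f ((1 / ?t) *\<^sub>R z)"
      using n by (intro hcomp_circ) auto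
    finally have "of_real ?t ^ m * g ((1 / ?t) *\<^sub>R z) = hcomp m f (?t *\<^sub>R ((1 / ?t) *\<^sub>R z))"
      by (simp only: hcomp_homogeneous_real) simp
    thus ?thesis using t by simp
  qed
  hence "hcomp m f = (\<lambda>z. of_real (1 + norm z) ^ m * g ((1 / (1 + norm z)) *\<^sub>R z))" by auto
  also have "\<dots> \<in> borel_measurable borel" by measurable
  finally show ?thesis .
qed

text \<open>Cauchy's estimate on the sphere of radius 1/2 combined with homogeneity, whence the
  factor \<open>2 ^ m\<close>.\<close>

lemma hcomp_bound: "\<exists>B\<ge>0. \<forall>z. norm (hcomp m f z) \<le> B * norm z ^ m"
proof -
  have "compact (f ` cball 0 (1/2))"
    by (intro compact_continuous_image continuous_on_subset[OF holomorphic_Cn_continuous_on[OF f]]) auto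
  then obtain B where B: "\<And>z. norm z \<le> 1/2 \<Longrightarrow> norm (f z) \<le> B"
    using compact_imp_bounded bounded_iff by (metis imageI mem_cball_0)
  have B0: "B \<ge> 0" using order.trans[OF norm_ge_zero B[of 0]] by simp
  interpret finite_measure circ by (rule finite_measure_circ)
  have half: "norm (hcomp m f z) \<le> B" if "norm z = 1/2" for z
  proof -
    have "norm (hcomp m f z) = norm (\<integral>t. f ((of_real 1 * cisp t) *s z) * cisp t powi (- int m) \<partial>circ)"
      using that by (subst hcomp_circ) auto
    also have "\<dots> \<le> (\<integral>t. B \<partial>circ)"
    proof (cases "integrable circ (\<lambda>t. f ((of_real 1 * cisp t) *s z) * cisp t powi (- int m))")
      case True
      show ?thesis
        by (rule order.trans[OF integral_norm_bound], rule integral_mono[OF integrable_norm[OF True]])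
           (use that in \<open>auto intro!: B simp: norm_mult norm_power_int\<close>)
    next
      case False thus ?thesis using B0 by (simp add: not_integrable_integral_eq)
    qed
    also have "(\<integral>t. B \<partial>circ) = B" by (rule integral_const_circ)
    finally show ?thesis .
  qed
  have "norm (hcomp m f z) \<le> (B * 2 ^ m) * norm z ^ m" for z
  \<comment> \<open>The origin is not a multiple of a point of the sphere. For m = 0 the claim there
    is not void, since 0 ^ 0 = 1 and the component is the constant f 0.\<close>
  proof (cases "z = 0")
    case True
    have "hcomp m f 0 = hcomp m f (0 *s 0)" by simp
    also have "\<dots> = 0 ^ m * hcomp m f 0" by (rule hcomp_homogeneous)
    finally have *: "hcomp m f 0 = 0 ^ m * hcomp m f 0" .
    show ?thesis
    proof (cases "m = 0")
      case True
      thus ?thesis using B[of 0] \<open>z = 0\<close> by (simp add: hcomp_def)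
    next
      case False
      hence "hcomp m f 0 = 0" using * by (simp add: power_0_left)
      thus ?thesis using \<open>z = 0\<close> False B0 by simp
    qed
  next
    case False
    let ?w = "(1 / (2 * norm z)) *\<^sub>R z"
    have "hcomp m f z = hcomp m f ((2 * norm z) *\<^sub>R ?w)" using False by simp
    also have "\<dots> = of_real (2 * norm z) ^ m * hcomp m f ?w" by (rule hcomp_homogeneous_real)
    finally have "norm (hcomp m f z) = (2 * norm z) ^ m * norm (hcomp m f ?w)"
      by (simp add: norm_mult norm_power)
    also have "\<dots> \<le> (2 * norm z) ^ m * B" using False by (intro mult_left_mono half) auto
    finally show ?thesis by (simp add: power_mult_distrib mult_ac)
  qed
  moreover have "B * 2 ^ m \<ge> 0" using B0 by simp
  ultimately show ?thesis by blast
qed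

text \<open>Inherited from the mean value property of \<open>f\<close> by Fubini.\<close>

lemma hcomp_exp_mean:
  "(\<integral>t. hcomp m f (cisp t *s w + \<xi>) * exp (- (cisp t * a)) \<partial>circ) = hcomp m f \<xi>"
proof -
  \<comment> \<open>Scaling by \<open>e\<close> brings all points
    \<open>e (\<lambda> w + \<xi>)\<close> with |\<lambda>| \<le> 1 into the ball of radius 1/2 and
    keeps those with |\<lambda>| < 3/2 inside the unit ball. The resulting factor \<open>e\<close>
    to the power \<open>m\<close> is removed at the end.\<close>
  define e where "e = 1 / (2 * (1 + norm w + norm \<xi>))"
  have D: "1 + norm w + norm \<xi> > 0" by (simp add: add_pos_nonneg)
  have e: "e > 0" using D by (simp add: e_def)
  have eb: "e * (norm w + norm \<xi>) \<le> 1/2" using D by (simp add: e_def field_simps)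
  interpret finite_measure circ by (rule finite_measure_circ)
  interpret pair_sigma_finite circ circ by unfold_locales
  define F where "F t \<tau> = f ((of_real e * cisp \<tau>) *s (cisp t *s w + \<xi>)) * cisp \<tau> powi (- int m) * exp (- (cisp t
      * a))" for t \<tau>
  have bnd: "norm (of_real e * cisp \<tau> *s (cisp t *s w + \<xi>)) \<le> 1/2" for t \<tau>
  proof -
    have "e * norm (cisp t *s w + \<xi>) \<le> e * (norm w + norm \<xi>)"
      using e norm_triangle_ineq[of "cisp t *s w" \<xi>] by (intro mult_left_mono) auto
    hence "e * norm (cisp t *s w + \<xi>) \<le> 1/2" using eb by linarith
    thus ?thesis using e by (subst norm_vector_smult) (simp add: norm_mult)
  qed
  obtain B where B: "\<And>z. norm z \<le> 1/2 \<Longrightarrow> norm (f z) \<le> B"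
  proof -
    have "compact (f ` cball 0 (1/2))"
      by (intro compact_continuous_image continuous_on_subset[OF holomorphic_Cn_continuous_on[OF f]]) auto
    thus ?thesis
      using compact_imp_bounded bounded_iff that by (metis imageI mem_cball_0)
  qed
  have B0: "B \<ge> 0" using order.trans[OF norm_ge_zero B[of 0]] by simp
  have "integrable (circ \<Otimes>\<^sub>M circ) (\<lambda>(t, \<tau>). F t \<tau>)"
  proof (rule finite_measure.integrable_const_bound[where B="B * exp (norm a)"])
    show "finite_measure (circ \<Otimes>\<^sub>M circ)"
      by (rule finite_measure_pair_measure) (rule finite_measure_circ)+
    note [measurable] = measurable_f_cut
    \<comment> \<open>Nothing is known about \<open>f\<close> outside the ball, so the indicator is
      inserted for joint measurability; it equals 1 at all the points that occur.\<close>
    have "F t \<tau> = (indicator unit_ball ((of_real e * cisp \<tau>) *s (cisp t *s w + \<xi>)) *\<^sub>R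
        f ((of_real e * cisp \<tau>) *s (cisp t *s w + \<xi>))) * inverse (cisp \<tau> ^ m) * exp (- (cisp t * a))" for t \<tau>
      using bnd[of \<tau> t] by (simp add: F_def power_int_minus)
    thus "(\<lambda>(t, \<tau>). F t \<tau>) \<in> borel_measurable (circ \<Otimes>\<^sub>M circ)"
      by (simp only:) measurable
    have "norm (F t \<tau>) \<le> B * exp (norm a)" for t \<tau>
    proof -
      have "norm (exp (- (cisp t * a))) \<le> exp (norm a)"
        using norm_exp[of "- (cisp t * a)"] by (simp add: norm_mult)
      thus ?thesis using B[OF bnd[of \<tau> t]] B0
        by (auto simp: F_def norm_mult norm_power_int intro!: mult_mono)
    qed
    thus "AE x in circ \<Otimes>\<^sub>M circ. norm (case x of (t, \<tau>) \<Rightarrow> F t \<tau>) \<le> B * exp (norm a)"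
      by auto
  qed
  from Fubini_integral[OF this]
  have fub: "(\<integral>t. \<integral>\<tau>. F t \<tau> \<partial>circ \<partial>circ) = (\<integral>\<tau>. \<integral>t. F t \<tau> \<partial>circ \<partial>circ)" by simp
  have lhs: "(\<integral>\<tau>. F t \<tau> \<partial>circ) = of_real e ^ m * (hcomp m f (cisp t *s w + \<xi>) * exp (- (cisp t * a)))" for t
  proof -
    have "e * norm (cisp t *s w + \<xi>) < 1" using bnd[of 0 t] e unfolding norm_vector_smult by (simp add: norm_mult)
    from hcomp_circ[OF e this] show ?thesis
      unfolding F_def by simp
  qed
  have rhs: "(\<integral>t. F t \<tau> \<partial>circ) = f ((of_real e * cisp \<tau>) *s \<xi>) * cisp \<tau> powi (- int m)" for \<tau>
  proof -
    \<comment> \<open>In the rotation variable the integrand, exponential included, is holomorphic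
      on a disc larger than the unit disc, and its value at the centre involves neither
      \<open>w\<close> nor \<open>a\<close>.\<close>
    let ?h = "\<lambda>\<mu>. f ((of_real e * cisp \<tau>) *s \<xi> + \<mu> *s ((of_real e * cisp \<tau>) *s w)) * cisp \<tau> powi (- int m)
        * exp (- (\<mu> * a))"
    have "?h holomorphic_on ball 0 (3/2)"
    proof (intro holomorphic_intros holomorphic_Cn_slice[OF f])
      fix \<mu> :: complex assume \<mu>: "\<mu> \<in> ball 0 (3/2)"
      have "norm ((of_real e * cisp \<tau>) *s \<xi> + \<mu> *s ((of_real e * cisp \<tau>) *s w)) \<le> e * norm \<xi> + norm \<mu> * (e * norm w)"
        using e norm_triangle_ineq[of "(of_real e * cisp \<tau>) *s \<xi>" "\<mu> *s ((of_real e * cisp \<tau>)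
            *s w)"] by (simp add: norm_mult)
      also have "\<dots> \<le> e * norm \<xi> + 3/2 * (e * norm w)" using \<mu> e by (intro add_left_mono mult_right_mono) auto
      also have "\<dots> \<le> 3/2 * (e * (norm w + norm \<xi>))" using e by (simp add: algebra_simps)
      also have "\<dots> < 1" using eb by linarith
      finally show "(of_real e * cisp \<tau>) *s \<xi> + \<mu> *s ((of_real e * cisp \<tau>) *s w) \<in> unit_ball" by simp
    qed
    from circ_mean_value[OF this, of 1] have "(\<integral>t. ?h (cisp t) \<partial>circ) = ?h 0" by simp
    moreover have "?h (cisp t) = F t \<tau>" for t
      unfolding F_def by (simp add: vec_eq_iff algebra_simps)
    ultimately show ?thesis by simp
  qed
  have "of_real e ^ m * (\<integral>t. hcomp m f (cisp t *s w + \<xi>) * exp (- (cisp t * a)) \<partial>circ) = (\<integral>t. \<integral>\<tau>. F t \<tau> \<partial>circ \<partial>circ)"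
    by (simp add: lhs)
  also have "\<dots> = (\<integral>\<tau>. f ((of_real e * cisp \<tau>) *s \<xi>) * cisp \<tau> powi (- int m) \<partial>circ)"
    by (simp add: fub rhs)
  also have "\<dots> = of_real e ^ m * hcomp m f \<xi>"
  proof (rule hcomp_circ[OF e])
    have "e * norm \<xi> \<le> e * (norm w + norm \<xi>)" using e by (intro mult_left_mono) auto
    thus "e * norm \<xi> < 1" using eb by linarith
  qed
  finally show ?thesis using e by simp
qed

end

section \<open>Gaussian pairings of homogeneous components, and the passage to the kernel\<close>

lemma cisp_powi_minus: "cisp t powi (- int m) = cnj (cisp t) ^ m"
  by (simp only: power_int_minus power_int_of_nat power_inverse[symmetric] cis_inverse cis_cnj)

text \<open>The conjugate of Cauchy's formula for \<open>exp (cnj a * \<mu>)\<close>, as conjugation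
  inverts points of the unit circle. It extracts one term of the exponential series.\<close>

lemma exp_Taylor_coeff_circ:
  "(\<integral>t. cisp t ^ m * exp (cnj (cisp t) * a) \<partial>circ) = a ^ m / fact m"
proof -
  have "(deriv ^^ m) exp = (exp :: complex \<Rightarrow> complex)"
  proof (induction m)
    case (Suc m)
    have "deriv exp = (exp :: complex \<Rightarrow> complex)" by (intro ext DERIV_imp_deriv DERIV_exp)
    thus ?case by (simp only: funpow.simps o_apply Suc)
  qed simp
  hence d: "(deriv ^^ m) (\<lambda>\<mu>. exp (cnj a * \<mu>)) 0 = cnj a ^ m"
    using higher_deriv_compose_linear[of exp UNIV UNIV 0 "cnj a" m]
    by (simp add: holomorphic_on_exp)
  have "(\<lambda>\<mu>. exp (cnj a * \<mu>)) holomorphic_on ball 0 2"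
    by (intro holomorphic_intros)
  from Taylor_coeff_circ[OF this, of 1 m]
  have "(\<integral>t. exp (cnj a * cisp t) * cisp t powi (- int m) \<partial>circ) = cnj a ^ m / fact m"
    by (simp add: d)
  hence "cnj (\<integral>t. exp (cnj a * cisp t) * cisp t powi (- int m) \<partial>circ) = a ^ m / fact m"
    by simp
  also have "cnj (\<integral>t. exp (cnj a * cisp t) * cisp t powi (- int m) \<partial>circ)
      = (\<integral>t. cnj (exp (cnj a * cisp t) * cisp t powi (- int m)) \<partial>circ)"
    by (rule Bochner_Integration.integral_cnj[symmetric])
  also have "\<dots> = (\<integral>t. cisp t ^ m * exp (cnj (cisp t) * a) \<partial>circ)"
    unfolding cisp_powi_minus complex_cnj_mult complex_cnj_power complex_cnj_cnj exp_cnj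
    by (simp only: mult.commute)
  finally show ?thesis .
qed

lemma nn_integral_gauss_scaled_finite:
  assumes "c > 0"
  shows "(\<integral>\<^sup>+z. ennreal (exp (- c * (norm (z :: complex ^ 'n))\<^sup>2)) \<partial>lborel) < \<infinity>"
proof -
  have int: "integrable lborel (\<lambda>z. exp (- (norm (z :: complex ^ 'n))\<^sup>2))"
    by (rule integrable_gauss[of 0]) simp
  have A: "(\<integral>\<^sup>+z. ennreal (exp (- c * (norm (z :: complex ^ 'n))\<^sup>2)) \<partial>lborel)
    = ennreal (\<bar>1 / sqrt c\<bar> ^ DIM(complex ^ 'n)) * (\<integral>\<^sup>+z. ennreal (exp (- c * (norm (0 + (1 / sqrt c) *\<^sub>R (z :: complex ^ 'n)))\<^sup>2)) \<partial>lborel)"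
    using assms by (intro nn_integral_lborel_affine) auto
  have B: "(\<integral>\<^sup>+z. ennreal (exp (- c * (norm (0 + (1 / sqrt c) *\<^sub>R (z :: complex ^ 'n)))\<^sup>2)) \<partial>lborel)
    = (\<integral>\<^sup>+z. ennreal (exp (- (norm (z :: complex ^ 'n))\<^sup>2)) \<partial>lborel)"
    using assms by (intro nn_integral_cong) (simp add: power_divide)
  have C: "(\<integral>\<^sup>+z. ennreal (exp (- (norm (z :: complex ^ 'n))\<^sup>2)) \<partial>lborel)
      < \<infinity>" using int by (simp add: integrable_iff_bounded)
  show ?thesis
    unfolding A unfolding B using C by (simp add: ennreal_mult_less_top)
qed

lemma integrable_exp_gauss:
  fixes g :: "complex ^ 'n \<Rightarrow> complex"
  assumes [measurable]: "g \<in> borel_measurable borel"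
    and bnd: "\<And>z. norm (g z) \<le> K * exp (a * norm z)" and K: "K \<ge> 0"
  shows "integrable lborel (\<lambda>z. g z * of_real (exp (- (norm z)\<^sup>2)))"
proof (rule integrableI_bounded)
  have le: "norm (g z * of_real (exp (- (norm z)\<^sup>2))) \<le> K * exp (a\<^sup>2 / 2) * exp (- (1/2) * (norm z)\<^sup>2)" for z
  proof -
    \<comment> \<open>The square trades half of the Gaussian decay for the constant
      \<open>exp (a\<^sup>2 / 2)\<close>, so that linear growth in the exponent is harmless.\<close>
    have "0 \<le> (a - norm z)\<^sup>2" by simp
    hence "a * norm z - (norm z)\<^sup>2 \<le> a\<^sup>2 / 2 - (1/2) * (norm z)\<^sup>2"
      by (simp add: power2_eq_square algebra_simps)
    hence "exp (a * norm z - (norm z)\<^sup>2) \<le> exp (a\<^sup>2 / 2 - (1/2) * (norm z)\<^sup>2)" by simp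
    hence "K * exp (a * norm z - (norm z)\<^sup>2) \<le> K * exp (a\<^sup>2 / 2 - (1/2) * (norm z)\<^sup>2)"
      using K by (rule mult_left_mono)
    moreover have "norm (g z * of_real (exp (- (norm z)\<^sup>2))) \<le> K * exp (a * norm z) * exp (- (norm z)\<^sup>2)"
      using bnd[of z] by (simp add: norm_mult)
    moreover have "K * exp (a * norm z) * exp (- (norm z)\<^sup>2) = K * exp (a * norm z - (norm z)\<^sup>2)"
      by (simp add: mult_exp_exp)
    moreover have "K * exp (a\<^sup>2 / 2) * exp (- (1/2) * (norm z)\<^sup>2) = K * exp (a\<^sup>2 / 2 - (1/2) * (norm z)\<^sup>2)"
      by (simp add: mult_exp_exp)
    ultimately show ?thesis by linarith
  qed
  have "(\<integral>\<^sup>+z. ennreal (norm (g z * of_real (exp (- (norm z)\<^sup>2)))) \<partial>lborel)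
     \<le> (\<integral>\<^sup>+z. ennreal (K * exp (a\<^sup>2 / 2)) * ennreal (exp (- (1/2) * (norm (z :: complex ^ 'n))\<^sup>2)) \<partial>lborel)"
    using le K by (intro nn_integral_mono) (simp add: ennreal_mult[symmetric] ennreal_leI)
  also have "\<dots> = ennreal (K * exp (a\<^sup>2 / 2)) * (\<integral>\<^sup>+z. ennreal (exp (- (1/2) * (norm (z :: complex ^ 'n))\<^sup>2)) \<partial>lborel)"
    by (rule nn_integral_cmult) measurable
  also have "\<dots> < \<infinity>"
    using nn_integral_gauss_scaled_finite[of "1/2", where 'n='n] by (simp add: ennreal_mult_less_top)
  finally show "(\<integral>\<^sup>+z. ennreal (norm (g z * of_real (exp (- (norm z)\<^sup>2)))) \<partial>lborel) < \<infinity>" .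
qed measurable

lemma power_le_fact_exp: "x \<ge> 0 \<Longrightarrow> x ^ m \<le> fact m * exp (x :: real)"
proof -
  assume x: "x \<ge> 0"
  have sums: "(\<lambda>k. x ^ k / fact k) sums exp x"
    using exp_converges[of x] by (simp add: divide_inverse mult.commute)
  then have "sum (\<lambda>k. x ^ k / fact k) {m} \<le> exp x"
    unfolding sums_unique[OF sums]
    using x by (intro sum_le_suminf sums_summable[OF sums]) auto
  thus ?thesis by (simp add: field_simps)
qed

context
  fixes f :: "complex ^ 'n \<Rightarrow> complex"
  assumes f: "holomorphic_Cn f unit_ball"
begin

lemma hcomp_exp_bound: "\<exists>K\<ge>0. \<forall>z. norm (hcomp m f z) \<le> K * exp (norm z)"
proof -
  obtain B where B: "B \<ge> 0" "\<And>z. norm (hcomp m f z) \<le> B * norm z ^ m"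
    using hcomp_bound[OF f, of m] by blast
  have "norm (hcomp m f z) \<le> (B * fact m) * exp (norm z)" for z
    using B(2)[of z] mult_left_mono[OF power_le_fact_exp[of "norm z" m] B(1)] by (simp add: mult_ac)
  thus ?thesis using B(1) by (intro exI[of _ "B * fact m"]) auto
qed

text \<open>Fischer's identity: completing the square, \<open>\<langle>\<xi>, z\<rangle> - |z|\<^sup>2 = - |w|\<^sup>2 - \<langle>w, \<xi>\<rangle>\<close> with
  \<open>z = w + \<xi>\<close>, turns the integral into a rotation mean around \<open>\<xi>\<close>.\<close>

lemma hcomp_gauss:
  "(\<integral>z. hcomp m f z * hermitian \<xi> z ^ m * of_real (exp (- (norm z)\<^sup>2)) \<partial>lborel)
    = fact m * of_real (gauss_integral TYPE('n)) * hcomp m f \<xi>"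
proof -
  note [measurable] = measurable_hcomp[OF f]
  define F where "F z = hcomp m f z * exp (hermitian \<xi> z) * of_real (exp (- (norm z)\<^sup>2))" for z
  obtain K where K: "K \<ge> 0" "\<And>z. norm (hcomp m f z) \<le> K * exp (norm z)"
    using hcomp_exp_bound by blast
  have intF: "integrable lborel F"
    unfolding F_def
  proof (rule integrable_exp_gauss[where K=K and a="1 + norm \<xi>"])
    show "norm (hcomp m f z * exp (hermitian \<xi> z)) \<le> K * exp ((1 + norm \<xi>) * norm z)" for z
    proof -
      have "norm (exp (hermitian \<xi> z)) \<le> exp (norm \<xi> * norm z)"
        using norm_exp[of "hermitian \<xi> z"] norm_hermitian_le[of \<xi> z] by (meson exp_le_cancel_iff order.trans)
      hence "norm (hcomp m f z) * norm (exp (hermitian \<xi> z)) \<le> (K * exp (norm z)) * exp (norm \<xi> * norm z)"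
        using K by (intro mult_mono) auto
      thus ?thesis by (simp add: norm_mult algebra_simps exp_add)
    qed
  qed (use K in auto)
  \<comment> \<open>The exponential serves as a generating function: the component has degree
    \<open>m\<close>, so the rotation mean retains only the term of degree \<open>m\<close> in the
    antiholomorphic variable. The same integral is evaluated a second time below, after a
    translation by \<xi>.\<close>
  have "(\<integral>z. F z \<partial>lborel) = (\<integral>z. of_real (exp (- (norm (z :: complex ^ 'n))\<^sup>2)) * (hcomp m f z
      * (hermitian \<xi> z ^ m / fact m)) \<partial>lborel)"
  proof (rule integral_rotation_mean[OF intF])
    fix z :: "complex ^ 'n"
    have "(\<integral>t. F (cisp t *s z) \<partial>circ)
      = (\<integral>t. (of_real (exp (- (norm z)\<^sup>2)) * hcomp m f z) * (cisp t ^ m * exp (cnj (cisp t) * hermitian \<xi> z)) \<partial>circ)"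
      by (intro Bochner_Integration.integral_cong refl) (simp add: F_def hcomp_homogeneous[OF f] mult_ac)
    also have "\<dots> = of_real (exp (- (norm z)\<^sup>2)) * (hcomp m f z * (hermitian \<xi> z ^ m / fact m))"
      by (subst integral_mult_right_zero, subst exp_Taylor_coeff_circ) (simp only: mult.assoc)
    finally show "(\<integral>t. F (cisp t *s z) \<partial>circ) = of_real (exp (- (norm z)\<^sup>2)) * (hcomp m f z
        * (hermitian \<xi> z ^ m / fact m))" .
  qed
  also have "\<dots> = (\<integral>z. inverse (fact m) * (hcomp m f z * hermitian \<xi> z ^ m * of_real (exp (- (norm z)\<^sup>2))) \<partial>lborel)"
    by (intro Bochner_Integration.integral_cong refl) (simp add: field_simps)
  also have "\<dots> = inverse (fact m) * (\<integral>z. hcomp m f z * hermitian \<xi> z ^ m * of_real (exp (- (norm z)\<^sup>2)) \<partial>lborel)"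
    by (rule integral_mult_right_zero)
  finally have 1: "(\<integral>z. hcomp m f z * hermitian \<xi> z ^ m * of_real (exp (- (norm z)\<^sup>2)) \<partial>lborel)
      = fact m * (\<integral>z. F z \<partial>lborel)"
    by simp
  have dist: "distr lborel borel ((+) \<xi>) = lborel" by (rule lborel_distr_plus)
  have intF': "integrable lborel (\<lambda>w. F (\<xi> + w))"
    using intF by (subst (asm) dist[symmetric], subst (asm) integrable_distr_eq) auto
  have shift: "(\<integral>z. F z \<partial>lborel) = (\<integral>w. F (\<xi> + w) \<partial>lborel)"
    using intF by (subst dist[symmetric], subst integral_distr) auto
  have gen: "hermitian \<xi> (\<xi> + v) - hermitian (\<xi> + v) (\<xi> + v) = - hermitian v v - hermitian v \<xi>" for v
    by (simp add: hermitian_add_left hermitian_add_right)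
  have "(\<integral>w. F (\<xi> + w) \<partial>lborel) = (\<integral>w. of_real (exp (- (norm (w :: complex ^ 'n))\<^sup>2)) * hcomp m f \<xi> \<partial>lborel)"
  proof (rule integral_rotation_mean[OF intF'])
    fix w :: "complex ^ 'n"
    have "F (\<xi> + cisp t *s w) = of_real (exp (- (norm w)\<^sup>2)) *
        (hcomp m f (cisp t *s w + \<xi>) * exp (- (cisp t * hermitian w \<xi>)))" for t
    proof -
      let ?v = "cisp t *s w"
      have v: "hermitian ?v \<xi> = cisp t * hermitian w \<xi>" "hermitian ?v ?v = of_real ((norm w)\<^sup>2)"
        by (simp, simp only: hermitian_self norm_vector_smult norm_cis mult_1)
      have "hermitian \<xi> (\<xi> + ?v) - hermitian (\<xi> + ?v) (\<xi> + ?v) = - hermitian ?v ?v - hermitian ?v \<xi>"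
        by (rule gen)
      hence "hermitian \<xi> (\<xi> + ?v) - of_real ((norm (\<xi> + ?v))\<^sup>2) = - of_real ((norm w)\<^sup>2) - cisp t * hermitian w \<xi>"
        by (simp only: hermitian_self v(1) norm_vector_smult norm_cis mult_1)
      hence e: "exp (hermitian \<xi> (\<xi> + ?v)) * of_real (exp (- (norm (\<xi> + ?v))\<^sup>2))
          = of_real (exp (- (norm w)\<^sup>2)) * exp (- (cisp t * hermitian w \<xi>))"
        by (simp only: exp_of_real[symmetric] exp_add[symmetric] of_real_minus diff_conv_add_uminus)
      have "F (\<xi> + ?v) = hcomp m f (\<xi> + ?v) * (exp (hermitian \<xi> (\<xi> + ?v)) * of_real (exp (- (norm (\<xi> + ?v))\<^sup>2)))"
        by (simp only: F_def mult.assoc)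
      also have "\<dots> = hcomp m f (\<xi> + ?v) * (of_real (exp (- (norm w)\<^sup>2)) * exp (- (cisp t * hermitian w \<xi>)))"
        by (simp only: e)
      finally show ?thesis
        by (simp only: add.commute[of \<xi>] mult.left_commute)
    qed
    hence "(\<integral>t. F (\<xi> + cisp t *s w) \<partial>circ) = of_real (exp (- (norm w)\<^sup>2)) *
        (\<integral>t. hcomp m f (cisp t *s w + \<xi>) * exp (- (cisp t * hermitian w \<xi>)) \<partial>circ)"
      by simp
    also have "\<dots> = of_real (exp (- (norm w)\<^sup>2)) * hcomp m f \<xi>"
      by (simp add: hcomp_exp_mean[OF f])
    finally show "(\<integral>t. F (\<xi> + cisp t *s w) \<partial>circ) = of_real (exp (- (norm w)\<^sup>2)) * hcomp m f \<xi>" .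
  qed
  also have "\<dots> = of_real (gauss_integral TYPE('n)) * hcomp m f \<xi>"
    by (simp add: gauss_integral_def)
  finally show ?thesis using 1 shift by simp
qed

text \<open>The factor in front is the \<open>m\<close>-th coefficient of the binomial series of the
  kernel. A rotation mean replaces \<open>f\<close> by its component of degree \<open>m\<close>, the
  change of weight leads to the Gaussian, and Fischer's identity evaluates it; the Gamma factors
  then cancel against the coefficient and \<open>c_const\<close>.\<close>

lemma hcomp_orthogonality:
  assumes a: "\<alpha> > -1" and int: "integrable (nu \<alpha>) f" and \<xi>: "norm \<xi> < 1"
  shows "of_real (pochhammer (real CARD('n) + 1 + \<alpha>) m / fact m) * (\<integral>z. f z * hermitian \<xi> z ^ m \<partial>nu \<alpha>) = hcomp m f \<xi>"
proof -
  note [measurable] = measurable_hcomp[OF f]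
  have [measurable]: "f \<in> borel_measurable (nu \<alpha>)" by (rule holomorphic_Cn_measurable[OF f])
  let ?n = "real CARD('n)"
  define G where "G = gauss_integral TYPE('n)"
  define V where "V = (\<integral>z. hcomp m f z * hermitian \<xi> z ^ m * of_real ((1 - (norm z)\<^sup>2) powr \<alpha>
      * indicator unit_ball z) \<partial>lborel)"
  have hle: "norm (hermitian \<xi> z ^ m) \<le> 1" if "norm z < 1" for z
    using hermitian_norm_less_1[OF \<xi> that] by (simp add: norm_power power_le_one)
  have intf: "integrable (nu \<alpha>) (\<lambda>z. f z * hermitian \<xi> z ^ m)"
    by (rule Bochner_Integration.integrable_bound[OF int]) (auto simp: norm_mult intro!: mult_right_le_one_le hle)
  have "(\<integral>z. f z * hermitian \<xi> z ^ m \<partial>nu \<alpha>) = (\<integral>z. wt \<alpha> z *\<^sub>R (f z * hermitian \<xi> z ^ m) \<partial>lborel)"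
    by (rule integral_nu[OF a]) measurable
  also have "\<dots> = (\<integral>z. wt \<alpha> z *\<^sub>R (hcomp m f z * hermitian \<xi> z ^ m) \<partial>lborel)"
  proof (rule integral_rotation_mean)
    show "integrable lborel (\<lambda>z. wt \<alpha> z *\<^sub>R (f z * hermitian \<xi> z ^ m))"
      using intf by (subst (asm) integrable_nu_iff[OF a]) measurable
    fix z :: "complex ^ 'n"
    have wt: "wt \<alpha> (cisp t *s z) = wt \<alpha> z" for t by (simp add: wt_def indicator_def)
    show "(\<integral>t. wt \<alpha> (cisp t *s z) *\<^sub>R (f (cisp t *s z) * hermitian \<xi> (cisp t *s z) ^ m) \<partial>circ)
        = wt \<alpha> z *\<^sub>R (hcomp m f z * hermitian \<xi> z ^ m)"
    proof (cases "norm z < 1")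
      case False thus ?thesis unfolding wt by (simp add: wt_def)
    next
      case True
      have "(\<integral>t. wt \<alpha> (cisp t *s z) *\<^sub>R (f (cisp t *s z) * hermitian \<xi> (cisp t *s z) ^ m) \<partial>circ)
        = (\<integral>t. (of_real (wt \<alpha> z) * hermitian \<xi> z ^ m) * (f ((of_real 1 * cisp t) *s z) * cisp t powi (- int m)) \<partial>circ)"
        unfolding wt cisp_powi_minus hermitian_smult_right scaleR_conv_of_real power_mult_distrib
        by (simp only: of_real_1 mult_1 mult_ac)
      also have "\<dots> = (of_real (wt \<alpha> z) * hermitian \<xi> z ^ m) * (of_real 1 ^ m * hcomp m f z)"
        using True by (simp only: integral_mult_right_zero) (subst hcomp_circ[OF f], auto)
      finally show ?thesis by (simp add: scaleR_conv_of_real mult_ac)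
    qed
  qed
  also have "\<dots> = (\<integral>z. of_real (c_const TYPE('n) \<alpha>) * (hcomp m f z * hermitian \<xi> z ^ m
      * of_real ((1 - (norm z)\<^sup>2) powr \<alpha> * indicator unit_ball z)) \<partial>lborel)"
    by (intro Bochner_Integration.integral_cong refl) (simp add: wt_def scaleR_conv_of_real mult_ac)
  also have "\<dots> = of_real (c_const TYPE('n) \<alpha>) * V"
    unfolding V_def by (rule integral_mult_right_zero)
  finally have 1: "(\<integral>z. f z * hermitian \<xi> z ^ m \<partial>nu \<alpha>) = of_real (c_const TYPE('n) \<alpha>) * V" .
  obtain B where B: "B \<ge> 0" "\<And>z. norm (hcomp m f z) \<le> B * norm z ^ m"
    using hcomp_bound[OF f, of m] by blast
  have intw: "integrable lborel (\<lambda>z. (1 - (norm z)\<^sup>2) powr \<alpha> * indicator unit_ball (z :: complex ^ 'n))"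
    by (intro integrableI_bounded) (auto simp: nn_integral_ball_weight[OF a])
  \<comment> \<open>Under real dilations the integrand has degree \<open>2 * m\<close>:
    \<open>m\<close> from the component and \<open>m\<close> from the conjugate-linear form. This is
    why \<open>m\<close>, and not m / 2, enters the Gamma function.\<close>
  have "of_real (Gamma (\<alpha> + 1)) * (\<integral>z. (hcomp m f z * hermitian \<xi> z ^ m) * of_real (exp (- (norm z)\<^sup>2)) \<partial>lborel)
    = of_real (Gamma (real (2 * m) / 2 + real CARD('n) + \<alpha> + 1)) * V"
    unfolding V_def
  proof (rule integral_homogeneous_gauss(1)[OF _ _ a])
    show "hcomp m f (t *\<^sub>R z) * hermitian \<xi> (t *\<^sub>R z) ^ m
        = of_real t ^ (2 * m) * (hcomp m f z * hermitian \<xi> z ^ m)" for t z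
    proof -
      have "t *\<^sub>R z = of_real t *s z" by (simp add: vec_eq_iff scaleR_conv_of_real[symmetric])
      thus ?thesis by (simp add: hcomp_homogeneous[OF f] power_mult_distrib mult_2 power_add)
    qed
    show "integrable lborel (\<lambda>z. hcomp m f z * hermitian \<xi> z ^ m * of_real ((1 - (norm z)\<^sup>2) powr \<alpha>
        * indicator unit_ball z))"
    proof (rule Bochner_Integration.integrable_bound[OF integrable_mult_right[OF intw, of B]])
      have "norm (hcomp m f z * hermitian \<xi> z ^ m) \<le> B * 1" if "norm z < 1" for z
      proof -
        have "B * norm z ^ m \<le> B * 1" using that B by (intro mult_left_mono) (auto intro: power_le_one)
        hence "norm (hcomp m f z) \<le> B" using B(2)[of z] by simp
        thus ?thesis using hle[OF that] B(1) unfolding norm_mult by (intro mult_mono) auto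
      qed
      thus "AE z in lborel. norm (hcomp m f z * hermitian \<xi> z ^ m * of_real ((1 - (norm z)\<^sup>2) powr \<alpha>
          * indicator unit_ball z))
          \<le> norm (B * ((1 - (norm z)\<^sup>2) powr \<alpha> * indicator unit_ball z))"
        using B(1) by (intro AE_I2) (auto simp: indicator_def norm_mult abs_mult intro!: mult_right_mono)
    qed measurable
  qed measurable
  hence 2: "of_real (Gamma (\<alpha> + 1)) * (fact m * of_real G * hcomp m f \<xi>) = of_real (Gamma (real m + ?n + \<alpha> + 1)) * V"
    by (simp add: hcomp_gauss G_def)
  have g: "Gamma (\<alpha> + 1) > 0" "Gamma (?n + \<alpha> + 1) > 0" "Gamma (real m + ?n + \<alpha> + 1) > 0"
    using assms by (auto intro!: Gamma_real_pos simp: add_nonneg_pos add.assoc)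
  have G: "G > 0" unfolding G_def using gauss_integral_pos[OF a] .
  have s: "?n + \<alpha> + 1 > 0" using a by (simp add: add_nonneg_pos add.assoc)
  have "?n + \<alpha> + 1 \<notin> \<int>\<^sub>\<le>\<^sub>0" using s by (auto dest: nonpos_Ints_nonpos)
  hence p: "pochhammer (?n + \<alpha> + 1) m = Gamma (?n + \<alpha> + 1 + real m) / Gamma (?n + \<alpha> + 1)"
    by (rule pochhammer_Gamma)
  have V: "V = of_real (Gamma (\<alpha> + 1) * fact m * G / Gamma (real m + ?n + \<alpha> + 1)) * hcomp m f \<xi>"
    using 2 g by (simp add: field_simps)
  have "of_real (pochhammer (?n + 1 + \<alpha>) m / fact m) * (of_real (c_const TYPE('n) \<alpha>) * V)
     = of_real (pochhammer (?n + 1 + \<alpha>) m / fact m * c_const TYPE('n) \<alpha> * (Gamma (\<alpha> + 1) * fact m * G / Gamma (real m + ?n + \<alpha> + 1))) * hcomp m f \<xi>"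
    unfolding V by (simp add: mult_ac)
  also have "pochhammer (?n + 1 + \<alpha>) m / fact m * c_const TYPE('n) \<alpha> * (Gamma (\<alpha>
      + 1) * fact m * G / Gamma (real m + ?n + \<alpha> + 1)) = 1"
    using g G p by (simp add: c_const_eq[OF a] G_def[symmetric] add_ac)
  finally show ?thesis unfolding 1 by simp
qed

lemma hcomp_sums:
  assumes "norm \<xi> < 1"
  shows "(\<lambda>m. hcomp m f \<xi>) sums f \<xi>"
proof -
  obtain R where R: "R > 1" "R * norm \<xi> \<le> 1" using slice_radius[of 1 \<xi>] assms by auto
  from holomorphic_power_series[OF radial_slice_holomorphic[OF f R(2)], of 1] R(1)
  show ?thesis by (simp add: hcomp_def)
qed

text \<open>For fixed \<xi> the form is bounded by |\<xi>| < 1 uniformly in \<open>z\<close>, so the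
  series of the kernel has the summable majorant \<open>c m * norm \<xi> ^ m\<close>. Hence
  integrability of \<open>f\<close> is enough for termwise integration.\<close>

theorem bergman_reproducing:
  assumes a: "\<alpha> > -1" and int: "integrable (nu \<alpha>) f" and \<xi>: "norm \<xi> < 1"
  shows "(\<integral>z. f z * bkern (real CARD('n) + 1 + \<alpha>) \<xi> z \<partial>nu \<alpha>) = f \<xi>"
proof -
  let ?s = "real CARD('n) + 1 + \<alpha>"
  have s: "?s > 0" using a by (simp add: add_nonneg_pos add.assoc)
  have [measurable]: "f \<in> borel_measurable (nu \<alpha>)" by (rule holomorphic_Cn_measurable[OF f])
  define c where "c m = pochhammer ?s m / fact m" for m
  have c0: "c m \<ge> 0" for m using s by (simp add: c_def pochhammer_nonneg)
  have expand: "(\<lambda>m. of_real (c m) * u ^ m) sums ((1 - u) powr of_real (- ?s))" if "norm u < 1" for u :: complex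
  proof -
    have "(of_real (- ?s) gchoose m) * (- u) ^ m = of_real (c m) * u ^ m" for m
    proof -
      have "pochhammer (- of_real (- ?s)) m = (of_real (pochhammer ?s m) :: complex)"
        by (simp only: of_real_minus minus_minus pochhammer_of_real)
      moreover have "(- 1) ^ m * (- u) ^ m = u ^ m" by (simp flip: power_mult_distrib)
      ultimately show ?thesis
        unfolding c_def gbinomial_pochhammer by (simp only: of_real_divide of_real_fact) (simp add: mult_ac)
    qed
    thus ?thesis using gen_binomial_complex[of "- u" "of_real (- ?s)"] that by simp
  qed
  have sm: "summable (\<lambda>m. c m * r ^ m)" if "0 \<le> r" "r < 1" for r :: real
  proof -
    have "summable (\<lambda>m. of_real (c m) * (of_real r :: complex) ^ m)"
      using expand[of "of_real r"] that by (simp add: sums_iff)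
    hence "summable (\<lambda>m. complex_of_real (c m * r ^ m))" by simp
    thus ?thesis by (subst (asm) summable_complex_of_real)
  qed
  define T where "T m z = of_real (c m) * (f z * hermitian \<xi> z ^ m)" for m z
  have le: "norm (T m z) \<le> (c m * norm \<xi> ^ m) * norm (f z)" if "norm z < 1" for m z
  proof -
    have "norm (hermitian \<xi> z) \<le> norm \<xi>"
      using norm_hermitian_le[of \<xi> z] that mult_left_le[of "norm z" "norm \<xi>"] by simp
    hence "norm (hermitian \<xi> z ^ m) \<le> norm \<xi> ^ m" by (simp add: norm_power power_mono)
    hence "c m * (norm (f z) * norm (hermitian \<xi> z ^ m)) \<le> c m * (norm (f z) * norm \<xi> ^ m)"
      using c0[of m] by (intro mult_left_mono) auto
    thus ?thesis using c0[of m] by (simp add: T_def norm_mult mult_ac)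
  qed
  have [measurable]: "T m \<in> borel_measurable (nu \<alpha>)" for m
    unfolding T_def by measurable
  have iT: "integrable (nu \<alpha>) (T m)" for m
    by (rule Bochner_Integration.integrable_bound[OF integrable_mult_right[OF integrable_norm[OF int], of "c m
        * norm \<xi> ^ m"]])
       (use le in \<open>auto intro!: order.trans[OF le abs_ge_self]\<close>)
  have smn: "summable (\<lambda>m. norm (T m z))" if "norm z < 1" for z
    by (rule summable_comparison_test'[OF summable_mult2[OF sm[of "norm \<xi>"], of "norm (f
        z)"]]) (use le[OF that] \<xi> in auto)
  have smi: "summable (\<lambda>m. \<integral>z. norm (T m z) \<partial>nu \<alpha>)"
  proof (rule summable_comparison_test'[OF summable_mult2[OF sm[of "norm \<xi>"], of "\<integral>z. norm (f z) \<partial>nu \<alpha>"]])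
    fix m
    have "(\<integral>z. norm (T m z) \<partial>nu \<alpha>) \<le> (\<integral>z. (c m * norm \<xi> ^ m) * norm (f z) \<partial>nu \<alpha>)"
      by (rule integral_mono[OF integrable_norm[OF iT] integrable_mult_right[OF integrable_norm[OF int]]])
         (use le in auto)
    thus "norm (\<integral>z. norm (T m z) \<partial>nu \<alpha>) \<le> c m * norm \<xi> ^ m * (\<integral>z. norm (f z) \<partial>nu \<alpha>)"
      by simp
  qed (use \<xi> in auto)
  have "(\<lambda>m. \<integral>z. T m z \<partial>nu \<alpha>) sums (\<integral>z. (\<Sum>m. T m z) \<partial>nu \<alpha>)"
    by (rule sums_integral[OF iT _ smi]) (use smn in \<open>auto intro!: AE_I2\<close>)
  moreover have "(\<integral>z. T m z \<partial>nu \<alpha>) = hcomp m f \<xi>" for m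
    using hcomp_orthogonality[OF a int \<xi>, of m] by (simp add: T_def c_def)
  moreover have "(\<integral>z. (\<Sum>m. T m z) \<partial>nu \<alpha>) = (\<integral>z. f z * bkern ?s \<xi> z \<partial>nu \<alpha>)"
  proof (intro Bochner_Integration.integral_cong refl)
    fix z :: "complex ^ 'n" assume "z \<in> space (nu \<alpha>)"
    hence z: "norm z < 1" by simp
    have "(\<lambda>m. f z * (of_real (c m) * hermitian \<xi> z ^ m)) sums (f z * bkern ?s \<xi> z)"
      unfolding bkern_eq[OF \<xi> z] by (intro sums_mult expand hermitian_norm_less_1 \<xi> z)
    thus "(\<Sum>m. T m z) = f z * bkern ?s \<xi> z"
      by (simp add: T_def sums_iff mult_ac)
  qed
  ultimately show ?thesis using hcomp_sums[OF \<xi>] by (simp add: sums_unique2)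
qed

end

section \<open>Estimates of Forelli and Rudin\<close>

text \<open>Intersections of the ball with the balls of the nonisotropic quasi-metric.\<close>

definition tent :: "complex ^ 'n \<Rightarrow> real \<Rightarrow> (complex ^ 'n) set" where
  "tent \<xi> \<sigma> = {z. norm z < 1 \<and> norm (1 - hermitian z \<xi>) \<le> \<sigma>}"

lemma measurable_tent [measurable]: "tent \<xi> \<sigma> \<in> sets borel"
proof -
  have "Measurable.pred borel (\<lambda>z. norm z < 1 \<and> norm (1 - hermitian z \<xi>) \<le> \<sigma>)" by measurable
  thus ?thesis by (simp add: tent_def pred_def)
qed

text \<open>Since both points lie in the unit ball, |z - \<xi>|^2 is at most twice the real part of
  1 - <z, \<xi>>.\<close>

lemma tent_dist:
  assumes "z \<in> tent \<xi> \<sigma>" "norm \<xi> < 1"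
  shows "norm (z - \<xi>) \<le> sqrt (2 * \<sigma>)"
proof -
  have z: "norm z < 1" "norm (1 - hermitian z \<xi>) \<le> \<sigma>" using assms(1) by (auto simp: tent_def)
  have "1 - inner z \<xi> \<le> \<sigma>"
    using complex_Re_le_cmod[of "1 - hermitian z \<xi>"] z by (simp add: Re_hermitian)
  moreover have "(norm z)\<^sup>2 \<le> 1" "(norm \<xi>)\<^sup>2 \<le> 1" using z assms(2) by (simp_all add: power_le_one)
  moreover have "(norm (z - \<xi>))\<^sup>2 = (norm z)\<^sup>2 + (norm \<xi>)\<^sup>2 - 2 * inner z \<xi>"
    by (simp add: power2_norm_eq_inner inner_diff inner_commute)
  ultimately have "(norm (z - \<xi>))\<^sup>2 \<le> 2 * \<sigma>" by linarith
  thus ?thesis using real_le_rsqrt by blast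
qed

text \<open>Rests on 1 - |z| \<le> |1 - <z, \<xi>>|. On a tent the weight is thus evaluated only on
  the interval up to \<open>2 * \<sigma>\<close>.\<close>

lemma tent_weight:
  assumes "z \<in> tent \<xi> \<sigma>" "norm \<xi> < 1"
  shows "1 - (norm z)\<^sup>2 \<le> 2 * \<sigma>" "0 < 1 - (norm z)\<^sup>2"
proof -
  have z: "norm z < 1" "norm (1 - hermitian z \<xi>) \<le> \<sigma>" using assms(1) by (auto simp: tent_def)
  have "norm z * norm \<xi> \<le> norm z" using assms(2) by (simp add: mult_left_le)
  hence 1: "1 - norm z \<le> \<sigma>" using one_minus_hermitian_ge[of z \<xi>] z by linarith
  have "(1 - norm z) * (1 + norm z) \<le> (1 - norm z) * 2" using z by (intro mult_left_mono) auto
  hence "1 - (norm z)\<^sup>2 \<le> 2 * (1 - norm z)" by (simp add: power2_eq_square algebra_simps)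
  thus "1 - (norm z)\<^sup>2 \<le> 2 * \<sigma>" by (rule order.trans) (use 1 in simp)
  show "0 < 1 - (norm z)\<^sup>2" using z by (simp add: abs_square_less_1)
qed

text \<open>Averaging over translates by multiples \<open>c *s \<xi>\<close> with \<open>norm c \<le> sqrt \<sigma>\<close>: all of them lie in a
  Euclidean ball of radius \<open>3 * sqrt \<sigma>\<close>, and a given point lies in those with \<open>c\<close> in a disc of
  radius \<open>4 * \<sigma>\<close>.\<close>

lemma emeasure_tent_le:
  fixes \<xi> :: "complex ^ 'n"
  assumes \<xi>: "norm \<xi> < 1" and \<sigma>: "0 < \<sigma>" "\<sigma> \<le> 1/2"
  shows "emeasure lborel (tent \<xi> \<sigma>)
    \<le> ennreal (16 * 9 ^ CARD('n) * unit_ball_vol (real (2 * CARD('n))) * \<sigma> ^ (CARD('n) + 1))"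
proof (cases "norm \<xi> \<le> 1/2")
  case True
  \<comment> \<open>For |\<xi>| \<le> 1/2 the quantity |1 - <z, \<xi>>| exceeds 1/2. In the other
    case |\<xi>|^2 is bounded below by 1/4, so the multiples of \<xi> move points
    effectively.\<close>
  have "tent \<xi> \<sigma> = {}"
  proof (rule equals0I)
    fix z assume "z \<in> tent \<xi> \<sigma>"
    hence z: "norm z < 1" "norm (1 - hermitian z \<xi>) \<le> \<sigma>" by (auto simp: tent_def)
    have "norm z * norm \<xi> < 1/2"
    proof (cases "norm \<xi> = 0")
      case False
      hence "norm z * norm \<xi> < 1 * norm \<xi>" using z by (intro mult_strict_right_mono) auto
      thus ?thesis using True by linarith
    qed auto
    thus False using one_minus_hermitian_ge[of z \<xi>] z \<sigma> by linarith
  qed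
  thus ?thesis by simp
next
  case False
  hence \<xi>2: "norm \<xi> > 1/2" by simp
  let ?u = "unit_ball_vol 2" and ?v = "unit_ball_vol (real (2 * CARD('n)))"
  have u: "?u > 0" by simp
  have v: "?v > 0" by (rule unit_ball_vol_pos) simp
  let ?D = "cball (0::complex) (sqrt \<sigma>)"
  let ?E = "tent \<xi> \<sigma>"
  have [measurable]: "?D \<in> sets borel" by (intro borel_closed closed_cball)
  have [measurable]: "cball (x::complex) r \<in> sets borel" "cball (y::complex ^ 'n) r \<in> sets borel" for x y r
    by (auto intro: borel_closed)
  have D: "emeasure lborel ?D = ennreal (?u * \<sigma>)"
    using \<sigma> by (simp add: emeasure_cball)
  \<comment> \<open>The disc of parameters has area \<open>?u * \<sigma>\<close>. Dividing by it
    reduces the power n + 2 of \<sigma> found on the right to n + 1; the constants are 16 = 4^2 and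
    9^n = 3^(2n).\<close>
  have "ennreal (?u * \<sigma>) * emeasure lborel ?E = (\<integral>\<^sup>+c. indicator ?D c * emeasure lborel ?E \<partial>lborel)"
    by (subst nn_integral_multc) (auto simp: D)
  also have "\<dots> = (\<integral>\<^sup>+c. \<integral>\<^sup>+z. indicator ?D c * indicator ?E (z + (- c *s \<xi>)) \<partial>lborel \<partial>lborel)"
    by (intro nn_integral_cong, subst nn_integral_cmult, measurable)
       (subst nn_integral_lborel_translate, auto)
  also have "\<dots> = (\<integral>\<^sup>+z. \<integral>\<^sup>+c. indicator ?D c * indicator ?E (z + (- c *s \<xi>)) \<partial>lborel \<partial>lborel)"
    by (rule lborel_pair.Fubini') measurable
  also have "\<dots> \<le> (\<integral>\<^sup>+z. ennreal (?u * (4 * \<sigma>)\<^sup>2) * indicator (cball \<xi> (3 * sqrt \<sigma>)) z \<partial>lborel)"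
  proof (rule nn_integral_mono)
    fix z :: "complex ^ 'n"
    let ?c0 = "(hermitian z \<xi> - 1) / of_real ((norm \<xi>)\<^sup>2)"
    have pt: "z \<in> cball \<xi> (3 * sqrt \<sigma>) \<and> c \<in> cball ?c0 (4 * \<sigma>)"
      if c: "c \<in> ?D" and E: "z + (- c *s \<xi>) \<in> ?E" for c
    proof
      have "norm (z - \<xi>) \<le> norm (z + (- c *s \<xi>) - \<xi>) + norm (c *s \<xi>)"
        using norm_triangle_ineq[of "z + (- c *s \<xi>) - \<xi>" "c *s \<xi>"] by simp
      also have "\<dots> \<le> sqrt (2 * \<sigma>) + sqrt \<sigma> * 1"
        using tent_dist[OF E \<xi>] c \<xi> \<sigma> by (intro add_mono) (auto simp del: mult_1_right intro!: mult_mono)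
      also have "\<dots> \<le> 3 * sqrt \<sigma>"
      proof -
        have "sqrt (2 * \<sigma>) \<le> sqrt (2\<^sup>2 * \<sigma>)" using \<sigma> by (intro real_sqrt_le_mono) simp
        also have "\<dots> = 2 * sqrt \<sigma>" by (simp only: real_sqrt_mult) simp
        finally show ?thesis by simp
      qed
      finally show "z \<in> cball \<xi> (3 * sqrt \<sigma>)" by (simp add: dist_norm norm_minus_commute)
      have X: "(norm \<xi>)\<^sup>2 \<ge> 1/4" using power_mono[of "1/2" "norm \<xi>" 2] \<xi>2 by (simp add: power2_eq_square)
      \<comment> \<open>Along the translates this quantity is affine in \<open>c\<close> with slope
        |\<xi>|^2 \<ge> 1/4. A bound \<sigma> on it confines \<open>c\<close> to a disc of radius
        \<open>4 * \<sigma>\<close>.\<close>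
      have "1 - hermitian (z + (- c *s \<xi>)) \<xi> = of_real ((norm \<xi>)\<^sup>2) * (c - ?c0)"
      proof -
        have "norm \<xi> \<noteq> 0" using \<xi>2 by linarith
        thus ?thesis by (simp add: hermitian_diff_left hermitian_self field_simps)
      qed
      hence "(norm \<xi>)\<^sup>2 * norm (c - ?c0) \<le> \<sigma>"
        using E by (simp add: tent_def norm_mult norm_power)
      moreover have "1/4 * norm (c - ?c0) \<le> (norm \<xi>)\<^sup>2 * norm (c - ?c0)"
        using X by (intro mult_right_mono) auto
      ultimately have "norm (c - ?c0) \<le> 4 * \<sigma>" by linarith
      thus "c \<in> cball ?c0 (4 * \<sigma>)" by (simp add: dist_norm norm_minus_commute)
    qed
    have "(\<integral>\<^sup>+c. indicator ?D c * indicator ?E (z + (- c *s \<xi>)) \<partial>lborel)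
        \<le> (\<integral>\<^sup>+c. indicator (cball ?c0 (4 * \<sigma>)) c * indicator (cball \<xi> (3 * sqrt \<sigma>)) z \<partial>lborel)"
      using pt by (intro nn_integral_mono) (auto simp: indicator_def)
    also have "\<dots> = ennreal (?u * (4 * \<sigma>)\<^sup>2) * indicator (cball \<xi> (3 * sqrt \<sigma>)) z"
      using \<sigma> by (subst nn_integral_multc) (auto simp: emeasure_cball)
    finally show "(\<integral>\<^sup>+c. indicator ?D c * indicator ?E (z + (- c *s \<xi>)) \<partial>lborel)
        \<le> ennreal (?u * (4 * \<sigma>)\<^sup>2) * indicator (cball \<xi> (3 * sqrt \<sigma>)) z" .
  qed
  also have "\<dots> = ennreal (?u * (4 * \<sigma>)\<^sup>2) * ennreal (?v * (3 * sqrt \<sigma>) ^ (2 * CARD('n)))"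
    using \<sigma> by (subst nn_integral_cmult) (auto simp: emeasure_cball mult.commute)
  also have "\<dots> = ennreal (?u * \<sigma> * (16 * 9 ^ CARD('n) * ?v * \<sigma> ^ (CARD('n) + 1)))"
  proof -
    have "(3 * sqrt \<sigma>) ^ (2 * CARD('n)) = 9 ^ CARD('n) * \<sigma> ^ CARD('n)"
      using \<sigma> by (simp only: power_mult) (simp add: power_mult_distrib)
    thus ?thesis using \<sigma> u v
      by (subst ennreal_mult[symmetric]) (auto simp: power2_eq_square mult_ac simp del: unit_ball_vol_numeral)
  qed
  finally have le: "ennreal (?u * \<sigma>) * emeasure lborel ?E
      \<le> ennreal (?u * \<sigma>) * ennreal (16 * 9 ^ CARD('n) * ?v * \<sigma> ^ (CARD('n) + 1))"
    using \<sigma> u v by (simp add: ennreal_mult)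
  have "?u * \<sigma> > 0" using u \<sigma> by simp
  thus ?thesis using le by (subst (asm) ennreal_mult_le_mult_iff) (auto simp del: unit_ball_vol_numeral)
qed

text \<open>Averaging over the dilations \<open>z \<mapsto> sqrt \<kappa> *\<^sub>R z\<close>, \<open>\<kappa> \<in> {1..1 + \<sigma>}\<close>, under which
  \<open>1 - (norm z)\<^sup>2\<close> depends linearly on \<open>\<kappa>\<close>.\<close>

lemma nn_integral_tent_le:
  fixes \<xi> :: "complex ^ 'n" and w :: "real \<Rightarrow> ennreal"
  assumes [measurable]: "w \<in> borel_measurable borel"
    and \<xi>: "norm \<xi> < 1" and \<sigma>: "0 < \<sigma>" "\<sigma> \<le> 1/4"
  defines "C \<equiv> 2 ^ CARD('n) * (5/2) * (16 * 9 ^ CARD('n) * unit_ball_vol (real (2 * CARD('n))) * 2 ^ (CARD('n) + 1))"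
  shows "(\<integral>\<^sup>+z. w (1 - (norm z)\<^sup>2) * indicator (tent \<xi> \<sigma>) z \<partial>lborel)
    \<le> ennreal (C * \<sigma> ^ CARD('n)) * (\<integral>\<^sup>+\<rho>. w \<rho> * indicator {0<..2 * \<sigma>} \<rho> \<partial>lborel)"
proof -
  let ?M = "(\<integral>\<^sup>+z. w (1 - (norm z)\<^sup>2) * indicator (tent \<xi> \<sigma>) z \<partial>lborel)"
  let ?W = "(\<integral>\<^sup>+\<rho>. w \<rho> * indicator {0<..2 * \<sigma>} \<rho> \<partial>lborel)"
  let ?v = "unit_ball_vol (real (2 * CARD('n)))"
  have v: "?v > 0" by (rule unit_ball_vol_pos) simp
  \<comment> \<open>The factor \<sigma> is the length of the interval of dilations. The Jacobian
    \<kappa>^n of each is at most 2^n because \<kappa> \<le> 2.\<close>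
  have "ennreal \<sigma> * ?M = (\<integral>\<^sup>+\<kappa>. indicator {1..1 + \<sigma>} \<kappa> * ?M \<partial>lborel)"
    using \<sigma> by (subst nn_integral_multc) auto
  also have "\<dots> \<le> (\<integral>\<^sup>+\<kappa>. ennreal (2 ^ CARD('n)) * (\<integral>\<^sup>+z. indicator {1..1
      + \<sigma>} \<kappa> * (w (1 - \<kappa> * (norm z)\<^sup>2) * indicator (tent \<xi> \<sigma>) (sqrt \<kappa> *\<^sub>R z)) \<partial>lborel) \<partial>lborel)"
  proof (rule nn_integral_mono)
    fix \<kappa> :: real
    show "indicator {1..1 + \<sigma>} \<kappa> * ?M \<le> ennreal (2 ^ CARD('n)) * (\<integral>\<^sup>+z. indicator {1..1
        + \<sigma>} \<kappa> * (w (1 - \<kappa> * (norm z)\<^sup>2) * indicator (tent \<xi> \<sigma>) (sqrt \<kappa> *\<^sub>R z)) \<partial>lborel)"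
    proof (cases "\<kappa> \<in> {1..1 + \<sigma>}")
      case True
      hence k: "\<kappa> \<ge> 1" "\<kappa> \<le> 2" using \<sigma> by auto
      have "?M = ennreal (\<bar>sqrt \<kappa>\<bar> ^ DIM(complex ^ 'n)) * (\<integral>\<^sup>+z. w (1 - (norm (0
          + sqrt \<kappa> *\<^sub>R z))\<^sup>2) * indicator (tent \<xi> \<sigma>) (0 + sqrt \<kappa> *\<^sub>R z) \<partial>lborel)"
        using k by (intro nn_integral_lborel_affine) auto
      also have "\<bar>sqrt \<kappa>\<bar> ^ DIM(complex ^ 'n) = \<kappa> ^ CARD('n)"
        using k by (simp add: power_mult[of _ 2] mult.commute[of _ 2])
      also have "(\<integral>\<^sup>+z. w (1 - (norm (0 + sqrt \<kappa> *\<^sub>R z))\<^sup>2) * indicator (tent \<xi> \<sigma>) (0 + sqrt \<kappa> *\<^sub>R z) \<partial>lborel)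
         = (\<integral>\<^sup>+z. w (1 - \<kappa> * (norm z)\<^sup>2) * indicator (tent \<xi> \<sigma>) (sqrt \<kappa> *\<^sub>R z) \<partial>lborel)"
        using k by (simp add: power_mult_distrib)
      also have "ennreal (\<kappa> ^ CARD('n)) * \<dots> \<le> ennreal (2 ^ CARD('n)) * \<dots>"
        using k by (intro mult_right_mono ennreal_leI power_mono) auto
      finally show ?thesis using True by simp
    qed simp
  qed
  also have "\<dots> = ennreal (2 ^ CARD('n)) * (\<integral>\<^sup>+\<kappa>. \<integral>\<^sup>+z. indicator {1..1
      + \<sigma>} \<kappa> * (w (1 - \<kappa> * (norm z)\<^sup>2) * indicator (tent \<xi> \<sigma>) (sqrt \<kappa> *\<^sub>R z)) \<partial>lborel \<partial>lborel)"
    by (rule nn_integral_cmult) measurable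
  also have "(\<integral>\<^sup>+\<kappa>. \<integral>\<^sup>+z. indicator {1..1 + \<sigma>} \<kappa> * (w (1 - \<kappa> * (norm z)\<^sup>2) * indicator (tent \<xi> \<sigma>) (sqrt \<kappa>
      *\<^sub>R z)) \<partial>lborel \<partial>lborel)
      = (\<integral>\<^sup>+z. \<integral>\<^sup>+\<kappa>. indicator {1..1 + \<sigma>} \<kappa> * (w (1 - \<kappa> * (norm z)\<^sup>2) * indicator (tent \<xi> \<sigma>) (sqrt \<kappa> *\<^sub>R z)) \<partial>lborel \<partial>lborel)"
    by (rule lborel_pair.Fubini') measurable
  also have "\<dots> \<le> (\<integral>\<^sup>+z. indicator (tent \<xi> (2 * \<sigma>)) z * (ennreal (5/2) * ?W) \<partial>lborel)"
  proof (rule nn_integral_mono)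
    fix z :: "complex ^ 'n"
    let ?lhs = "\<integral>\<^sup>+\<kappa>. indicator {1..1 + \<sigma>} \<kappa> * (w (1 - \<kappa> * (norm z)\<^sup>2) * indicator (tent \<xi> \<sigma>) (sqrt \<kappa> *\<^sub>R z)) \<partial>lborel"
    \<comment> \<open>The tent widens to \<open>2 * \<sigma>\<close> because sqrt \<kappa> - 1 \<le>
      \<sigma>. From 1 - \<kappa>|z|^2 \<le> 2\<sigma> \<le> 1/2 and \<kappa> \<le> 5/4 comes |z|^2
      \<ge> 2/5, and the affine substitution in \<kappa> with slope -|z|^2 then costs at most
      5/2.\<close>
    have pt: "z \<in> tent \<xi> (2 * \<sigma>) \<and> (norm z)\<^sup>2 \<ge> 2/5 \<and> 1 - \<kappa> * (norm z)\<^sup>2 \<in> {0<..2 * \<sigma>}"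
      if k: "\<kappa> \<in> {1..1 + \<sigma>}" and E: "sqrt \<kappa> *\<^sub>R z \<in> tent \<xi> \<sigma>" for \<kappa>
    proof -
      have k1: "\<kappa> \<ge> 1" using k by simp
      have n: "(norm (sqrt \<kappa> *\<^sub>R z))\<^sup>2 = \<kappa> * (norm z)\<^sup>2" using k1 by (simp add: power_mult_distrib)
      have 1: "1 - \<kappa> * (norm z)\<^sup>2 \<in> {0<..2 * \<sigma>}"
        using tent_weight[OF E \<xi>] unfolding n by auto
      have "(1 + \<sigma>) * (norm z)\<^sup>2 \<ge> \<kappa> * (norm z)\<^sup>2" using k by (intro mult_right_mono) auto
      hence "(1 + 1/4) * (norm z)\<^sup>2 \<ge> 1/2"
        using 1 \<sigma> mult_right_mono[of "1 + \<sigma>" "1 + 1/4" "(norm z)\<^sup>2"] by simp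
      hence 2: "(norm z)\<^sup>2 \<ge> 2/5" by simp
      let ?h = "hermitian (sqrt \<kappa> *\<^sub>R z) \<xi>"
      have sk: "sqrt \<kappa> \<ge> 1" using k1 by simp
      have h: "norm (1 - ?h) \<le> \<sigma>" "norm (sqrt \<kappa> *\<^sub>R z) < 1" using E by (auto simp: tent_def)
      have "sqrt \<kappa> *\<^sub>R z = of_real (sqrt \<kappa>) *s z" by (simp add: vec_eq_iff scaleR_conv_of_real[symmetric])
      hence hz: "?h = of_real (sqrt \<kappa>) * hermitian z \<xi>" by simp
      have "norm z \<le> sqrt \<kappa> * norm z" using mult_right_mono[OF sk norm_ge_zero[of z]] by simp
      hence nz: "norm z < 1" using h(2) k1 by simp
      have "norm (1 - hermitian z \<xi>) \<le> norm (1 - ?h) + norm (?h - hermitian z \<xi>)"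
        using norm_triangle_ineq[of "1 - ?h" "?h - hermitian z \<xi>"] by simp
      also have "?h - hermitian z \<xi> = of_real (sqrt \<kappa> - 1) * hermitian z \<xi>" by (simp add: hz algebra_simps)
      also have "norm \<dots> \<le> (sqrt \<kappa> - 1) * 1"
        using sk hermitian_norm_less_1[OF nz \<xi>] unfolding norm_mult norm_of_real by (intro mult_mono) auto
      also have "(sqrt \<kappa> - 1) * 1 \<le> \<kappa> - 1"
        using k1 by (simp add: sqrt_le_D real_le_lsqrt power2_eq_square)
      finally have "norm (1 - hermitian z \<xi>) \<le> 2 * \<sigma>" using h(1) k by auto
      thus ?thesis using nz 1 2 by (simp add: tent_def)
    qed
    show "?lhs \<le> indicator (tent \<xi> (2 * \<sigma>)) z * (ennreal (5/2) * ?W)"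
    proof (cases "z \<in> tent \<xi> (2 * \<sigma>) \<and> (norm z)\<^sup>2 \<ge> 2/5")
      case False
      hence "indicator {1..1 + \<sigma>} \<kappa> * (w (1 - \<kappa> * (norm z)\<^sup>2) * indicator (tent \<xi> \<sigma>) (sqrt \<kappa> *\<^sub>R z)) = 0" for \<kappa>
        using pt[of \<kappa>] by (auto simp: indicator_def)
      hence "?lhs = 0" by (simp only: nn_integral_const) simp
      thus ?thesis by (simp only: zero_le)
    next
      case True
      let ?r = "(norm z)\<^sup>2"
      have r: "?r > 0" using True by linarith
      let ?f = "\<lambda>\<rho>. w \<rho> * indicator {0<..2 * \<sigma>} \<rho>"
      have "?lhs \<le> (\<integral>\<^sup>+\<kappa>. ?f (1 + (- ?r) * \<kappa>) \<partial>lborel)"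
        using pt by (intro nn_integral_mono) (auto simp: indicator_def mult.commute)
      also have "\<dots> = ennreal (1 / ?r) * (ennreal \<bar>- ?r\<bar> * (\<integral>\<^sup>+\<kappa>. ?f (1 + (- ?r) * \<kappa>) \<partial>lborel))"
        using r by (simp add: mult.assoc[symmetric] flip: ennreal_mult)
      also have "ennreal \<bar>- ?r\<bar> * (\<integral>\<^sup>+\<kappa>. ?f (1 + (- ?r) * \<kappa>) \<partial>lborel) = ?W"
        using r by (intro nn_integral_real_affine[symmetric]) auto
      also have "ennreal (1 / ?r) * ?W \<le> ennreal (5/2) * ?W"
        using True r by (intro mult_right_mono ennreal_leI) (auto simp: field_simps)
      finally show ?thesis using True by simp
    qed
  qed
  also have "\<dots> = emeasure lborel (tent \<xi> (2 * \<sigma>)) * (ennreal (5/2) * ?W)"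
    by (subst nn_integral_multc) auto
  also have "\<dots> \<le> ennreal (16 * 9 ^ CARD('n) * ?v * (2 * \<sigma>) ^ (CARD('n) + 1)) * (ennreal (5/2) * ?W)"
    using \<sigma> by (intro mult_right_mono emeasure_tent_le \<xi>) auto
  finally have "ennreal \<sigma> * ?M \<le> ennreal (2 ^ CARD('n)) * (ennreal (16 * 9 ^ CARD('n) * ?v * (2 * \<sigma>) ^ (CARD('n)
      + 1)) * (ennreal (5/2) * ?W))"
    by (simp add: mult_left_mono)
  also have "\<dots> = ennreal (2 ^ CARD('n) * (16 * 9 ^ CARD('n) * ?v * (2 * \<sigma>) ^ (CARD('n) + 1)) * (5/2)) * ?W"
  proof -
    have "ennreal a * (ennreal b * (ennreal c * ?W)) = ennreal (a * b * c) * ?W" if "a \<ge> 0" "b \<ge> 0" "c \<ge> 0" for a b c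
      using that by (simp add: ennreal_mult mult.assoc)
    thus ?thesis using v \<sigma> by simp
  qed
  also have "2 ^ CARD('n) * (16 * 9 ^ CARD('n) * ?v * (2 * \<sigma>) ^ (CARD('n) + 1)) * (5/2) = \<sigma> * (C * \<sigma> ^ CARD('n))"
    unfolding C_def power_mult_distrib by (simp add: mult_ac)
  also have "ennreal \<dots> * ?W = ennreal \<sigma> * (ennreal (C * \<sigma> ^ CARD('n)) * ?W)"
    using \<sigma> v by (subst ennreal_mult) (auto simp: C_def mult.assoc)
  finally show ?thesis using \<sigma> by (subst (asm) ennreal_mult_le_mult_iff) auto
qed

section \<open>One-variable integrals and the layer-cake bound for the kernel\<close>

lemma nn_integral_powr_at_top:
  assumes "a > 0" "x > (0::real)"
  shows "(\<integral>\<^sup>+\<sigma>. ennreal (\<sigma> powr (- 1 - a)) * indicator {x..} \<sigma> \<partial>lborel) = ennreal (x powr (- a) / a)"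
proof -
  have "((\<lambda>\<sigma>. \<sigma> powr (- 1 - a)) has_integral - (x powr (- 1 - a + 1)) / (- 1 - a + 1)) {x..}"
    using assms by (intro has_integral_powr_to_inf) auto
  thus ?thesis
    using nn_integral_has_integral_lebesgue'[of "{x..}" "\<lambda>\<sigma>. \<sigma> powr (- 1 - a)"] by simp
qed

lemma nn_integral_powr_from_0:
  assumes "a > -1" "c \<ge> (0::real)"
  shows "(\<integral>\<^sup>+\<rho>. ennreal (\<rho> powr a) * indicator {0<..c} \<rho> \<partial>lborel) = ennreal (c powr (a + 1) / (a + 1))"
proof -
  have "(\<integral>\<^sup>+\<rho>. ennreal (\<rho> powr a) * indicator {0<..c} \<rho> \<partial>lborel)
      = (\<integral>\<^sup>+\<rho>. ennreal (\<rho> powr a) * indicator {0..c} \<rho> \<partial>lborel)"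
    by (intro nn_integral_cong) (auto simp: indicator_def)
  also have "\<dots> = ennreal (c powr (a + 1) / (a + 1))"
    by (rule nn_integral_has_integral_lebesgue'[OF _ has_integral_powr_from_0[OF assms]]) simp
  finally show ?thesis .
qed

text \<open>The integrand is the derivative of \<open>- (\<sigma> powr (- s))\<close>. The cut at
  \<open>b\<close>, later 1/4, confines \<sigma> to the range of the tent estimate; beyond it the
  power is bounded by a constant.\<close>

lemma powr_minus_layer_cake:
  assumes s: "s > 0" and x: "x > (0::real)" and b: "b > 0"
  shows "ennreal (x powr (- s)) \<le> ennreal (b powr (- s)) + (\<integral>\<^sup>+\<sigma>. ennreal (s * \<sigma> powr (- s - 1))
      * indicator {x..b} \<sigma> \<partial>lborel)"
proof (cases "x \<le> b")
  case False
  hence "x powr (- s) \<le> b powr (- s)" using assms by (intro powr_mono2') auto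
  thus ?thesis by (intro add_increasing2 ennreal_leI) auto
next
  case True
  have "((\<lambda>\<sigma>. s * \<sigma> powr (- s - 1)) has_integral (- (b powr (- s))) - (- (x powr (- s)))) {x..b}"
    using True x
    by (intro fundamental_theorem_of_calculus)
       (auto intro!: derivative_eq_intros simp flip: has_real_derivative_iff_has_vector_derivative)
  hence "(\<integral>\<^sup>+\<sigma>. ennreal (s * \<sigma> powr (- s - 1)) * indicator {x..b} \<sigma> \<partial>lborel) = ennreal (x powr (- s) - b powr (- s))"
    using s by (subst nn_integral_has_integral_lebesgue') auto
  moreover have "b powr (- s) \<le> x powr (- s)" using True assms by (intro powr_mono2') auto
  ultimately show ?thesis by (simp flip: ennreal_plus)
qed

lemma one_minus_norm_ge: "norm (\<xi> :: 'a :: real_normed_vector) < 1 \<Longrightarrow> (1 - (norm \<xi>)\<^sup>2) / 2 \<le> 1 - norm \<xi>"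
proof -
  assume "norm \<xi> < 1"
  hence "(1 - norm \<xi>) * (1 + norm \<xi>) \<le> (1 - norm \<xi>) * 2" by (intro mult_left_mono) auto
  thus ?thesis by (simp add: power2_eq_square field_simps)
qed

text \<open>The kernel is written as a superposition of indicators of tents. Its factor
  \<sigma>^(-s-1) and the factor \<sigma>^n of the tent estimate combine to \<sigma>^(-2-\<alpha>),
  independently of n. The lower limit reflects |1 - <z, \<xi>>| \<ge> 1 - |\<xi>|. In both
  applications \<open>w\<close> contains the factor \<open>\<rho> powr \<alpha>\<close> of the
  measure.\<close>

lemma kernel_integral_le:
  fixes w :: "real \<Rightarrow> ennreal"
  assumes [measurable]: "w \<in> borel_measurable borel" and a: "\<alpha> > -1"
  shows "\<exists>C\<ge>0. \<forall>\<xi> :: complex ^ 'n. norm \<xi> < 1 \<longrightarrow>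
    (\<integral>\<^sup>+z. w (1 - (norm z)\<^sup>2) * indicator unit_ball z * ennreal (norm (bkern (real CARD('n) + 1 + \<alpha>) z \<xi>)) \<partial>lborel)
    \<le> ennreal C * (\<integral>\<^sup>+z. w (1 - (norm (z :: complex ^ 'n))\<^sup>2) * indicator unit_ball z \<partial>lborel)
    + ennreal C * (\<integral>\<^sup>+\<sigma>. ennreal (\<sigma> powr (- 2 - \<alpha>)) * indicator {(1 - (norm \<xi>)\<^sup>2) / 2..1/4} \<sigma> *
        (\<integral>\<^sup>+\<rho>. w \<rho> * indicator {0<..2 * \<sigma>} \<rho> \<partial>lborel) \<partial>lborel)"
proof -
  let ?n = "real CARD('n)" let ?s = "?n + 1 + \<alpha>"
  have s: "?s > 0" using a by (simp add: add_nonneg_pos add.assoc)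
  define C0 :: real where "C0 = 2 ^ CARD('n) * (5/2) * (16 * 9 ^ CARD('n) * unit_ball_vol (real (2 * CARD('n)))
      * 2 ^ (CARD('n) + 1))"
  have C0: "C0 \<ge> 0" unfolding C0_def by simp
  define C where "C = max ((1/4) powr (- ?s)) (?s * C0)"
  have C: "C \<ge> 0" "(1/4) powr (- ?s) \<le> C" "?s * C0 \<le> C" using s C0 by (auto simp: C_def intro: max.coboundedI1)
  show ?thesis
  proof (intro exI[of _ C] conjI allI impI C(1))
    fix \<xi> :: "complex ^ 'n" assume \<xi>: "norm \<xi> < 1"
    define d where "d = (1 - (norm \<xi>)\<^sup>2) / 2"
    have d: "d > 0" using \<xi> by (simp add: d_def abs_square_less_1)
    let ?A = "(\<integral>\<^sup>+z. w (1 - (norm (z :: complex ^ 'n))\<^sup>2) * indicator unit_ball z \<partial>lborel)"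
    let ?W = "\<lambda>\<sigma>. (\<integral>\<^sup>+\<rho>. w \<rho> * indicator {0<..2 * \<sigma>} \<rho> \<partial>lborel)"
    have [measurable]: "?W \<in> borel_measurable borel"
      unfolding indicator_def greaterThanAtMost_iff by measurable
    let ?g = "\<lambda>\<sigma>. ennreal (?s * \<sigma> powr (- ?s - 1)) * indicator {d..1/4} \<sigma>"
    have pt: "ennreal (norm (bkern ?s z \<xi>)) \<le> ennreal ((1/4) powr (- ?s))
        + (\<integral>\<^sup>+\<sigma>. ?g \<sigma> * indicator (tent \<xi> \<sigma>) z \<partial>lborel)"
      if z: "norm z < 1" for z
    proof -
      let ?X = "norm (1 - hermitian z \<xi>)"
      have "norm z * norm \<xi> \<le> norm \<xi>" using z by (simp add: mult_left_le_one_le)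
      hence X: "?X \<ge> d" using one_minus_hermitian_ge[of z \<xi>] one_minus_norm_ge[OF \<xi>] unfolding d_def by linarith
      have "ennreal (norm (bkern ?s z \<xi>)) = ennreal (?X powr (- ?s))"
        by (simp add: norm_bkern[OF Re_hermitian_less_1[OF z \<xi>]])
      also have "\<dots> \<le> ennreal ((1/4) powr (- ?s)) + (\<integral>\<^sup>+\<sigma>. ennreal (?s * \<sigma> powr (- ?s - 1))
          * indicator {?X..1/4} \<sigma> \<partial>lborel)"
        using X d s by (intro powr_minus_layer_cake) auto
      also have "(\<integral>\<^sup>+\<sigma>. ennreal (?s * \<sigma> powr (- ?s - 1)) * indicator {?X..1/4} \<sigma> \<partial>lborel)
          \<le> (\<integral>\<^sup>+\<sigma>. ?g \<sigma> * indicator (tent \<xi> \<sigma>) z \<partial>lborel)"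
        using X z by (intro nn_integral_mono) (auto simp: indicator_def tent_def)
      finally show ?thesis by (simp add: add_left_mono)
    qed
    have [measurable]: "(\<lambda>(z, \<sigma>). indicator (tent \<xi> \<sigma>) z :: ennreal) \<in> borel_measurable (borel \<Otimes>\<^sub>M borel)"
      unfolding indicator_def tent_def mem_Collect_eq by measurable
    have [measurable]: "(\<lambda>(\<sigma>, z). indicator (tent \<xi> \<sigma>) z :: ennreal) \<in> borel_measurable (borel \<Otimes>\<^sub>M borel)"
      unfolding indicator_def tent_def mem_Collect_eq by measurable
    let ?w = "\<lambda>z::complex ^ 'n. w (1 - (norm z)\<^sup>2) * indicator unit_ball z"
    have "(\<integral>\<^sup>+z. ?w z * ennreal (norm (bkern ?s z \<xi>)) \<partial>lborel)
        \<le> (\<integral>\<^sup>+z. ?w z * (ennreal ((1/4) powr (- ?s)) + (\<integral>\<^sup>+\<sigma>. ?g \<sigma> * indicator (tent \<xi> \<sigma>) z \<partial>lborel)) \<partial>lborel)"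
      using pt by (intro nn_integral_mono) (auto simp: indicator_def intro!: mult_left_mono)
    also have "\<dots> = (\<integral>\<^sup>+z. ennreal ((1/4) powr (- ?s)) * ?w z + ?w z * (\<integral>\<^sup>+\<sigma>. ?g \<sigma> * indicator (tent \<xi> \<sigma>) z
        \<partial>lborel) \<partial>lborel)"
      by (intro nn_integral_cong) (simp add: distrib_left mult.commute)
    also have "\<dots> = ennreal ((1/4) powr (- ?s)) * ?A + (\<integral>\<^sup>+z. ?w z * (\<integral>\<^sup>+\<sigma>. ?g \<sigma> * indicator (tent \<xi> \<sigma>) z
        \<partial>lborel) \<partial>lborel)"
      by (subst nn_integral_add, measurable, subst nn_integral_cmult) auto
    also have "(\<integral>\<^sup>+z. ?w z * (\<integral>\<^sup>+\<sigma>. ?g \<sigma> * indicator (tent \<xi> \<sigma>) z \<partial>lborel) \<partial>lborel)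
        = (\<integral>\<^sup>+z. \<integral>\<^sup>+\<sigma>. ?w z * (?g \<sigma> * indicator (tent \<xi> \<sigma>) z) \<partial>lborel \<partial>lborel)"
      by (intro nn_integral_cong nn_integral_cmult[symmetric]) measurable
    also have "\<dots> = (\<integral>\<^sup>+\<sigma>. \<integral>\<^sup>+z. ?w z * (?g \<sigma> * indicator (tent \<xi> \<sigma>) z) \<partial>lborel \<partial>lborel)"
      by (rule lborel_pair.Fubini') measurable
    also have "\<dots> = (\<integral>\<^sup>+\<sigma>. ?g \<sigma> * (\<integral>\<^sup>+z. w (1 - (norm z)\<^sup>2) * indicator (tent \<xi> \<sigma>) z \<partial>lborel) \<partial>lborel)"
    proof (rule nn_integral_cong)
      fix \<sigma> :: real
      have "(\<integral>\<^sup>+z. ?w z * (?g \<sigma> * indicator (tent \<xi> \<sigma>) z) \<partial>lborel)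
          = (\<integral>\<^sup>+z. ?g \<sigma> * (w (1 - (norm z)\<^sup>2) * indicator (tent \<xi> \<sigma>) z) \<partial>lborel)"
        by (intro nn_integral_cong) (auto simp: indicator_def tent_def mult_ac)
      also have "\<dots> = ?g \<sigma> * (\<integral>\<^sup>+z. w (1 - (norm z)\<^sup>2) * indicator (tent \<xi> \<sigma>) z \<partial>lborel)"
        by (rule nn_integral_cmult) measurable
      finally show "(\<integral>\<^sup>+z. ?w z * (?g \<sigma> * indicator (tent \<xi> \<sigma>) z) \<partial>lborel) = \<dots>" .
    qed
    also have "\<dots> \<le> (\<integral>\<^sup>+\<sigma>. ennreal (?s * C0) * (ennreal (\<sigma> powr (- 2 - \<alpha>)) * indicator {d..1/4} \<sigma> * ?W \<sigma>) \<partial>lborel)"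
    proof (rule nn_integral_mono)
      fix \<sigma> :: real
      show "?g \<sigma> * (\<integral>\<^sup>+z. w (1 - (norm z)\<^sup>2) * indicator (tent \<xi> \<sigma>) z \<partial>lborel)
        \<le> ennreal (?s * C0) * (ennreal (\<sigma> powr (- 2 - \<alpha>)) * indicator {d..1/4} \<sigma> * ?W \<sigma>)"
      proof (cases "\<sigma> \<in> {d..1/4}")
        case True
        hence \<sigma>: "\<sigma> > 0" "\<sigma> \<le> 1/4" using d by auto
        have "(\<integral>\<^sup>+z. w (1 - (norm z)\<^sup>2) * indicator (tent \<xi> \<sigma>) z \<partial>lborel) \<le> ennreal (C0 * \<sigma> ^ CARD('n)) * ?W \<sigma>"
          unfolding C0_def using \<sigma> by (intro nn_integral_tent_le \<xi>) auto
        hence "ennreal (?s * \<sigma> powr (- ?s - 1)) * (\<integral>\<^sup>+z. w (1 - (norm z)\<^sup>2) * indicator (tent \<xi> \<sigma>) z \<partial>lborel)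
            \<le> ennreal (?s * \<sigma> powr (- ?s - 1)) * (ennreal (C0 * \<sigma> ^ CARD('n)) * ?W \<sigma>)"
          by (intro mult_left_mono) auto
        also have "\<dots> = ennreal (?s * \<sigma> powr (- ?s - 1) * (C0 * \<sigma> ^ CARD('n))) * ?W \<sigma>"
          using s \<sigma> C0 by (subst (2) ennreal_mult) (auto simp: mult.assoc)
        also have "?s * \<sigma> powr (- ?s - 1) * (C0 * \<sigma> ^ CARD('n)) = ?s * C0 * (\<sigma> powr (- ?s - 1) * \<sigma> powr ?n)"
          using \<sigma> by (simp add: powr_realpow mult_ac)
        also have "\<sigma> powr (- ?s - 1) * \<sigma> powr ?n = \<sigma> powr (- 2 - \<alpha>)"
        proof -
          have "- ?s - 1 + ?n = - 2 - \<alpha>" by simp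
          thus ?thesis by (metis powr_add)
        qed
        also have "ennreal (?s * C0 * \<sigma> powr (- 2 - \<alpha>)) * ?W \<sigma>
            = ennreal (?s * C0) * (ennreal (\<sigma> powr (- 2 - \<alpha>)) * ?W \<sigma>)"
          using s C0 by (subst ennreal_mult) (auto simp: mult.assoc)
        finally show ?thesis using True by simp
      qed simp
    qed
    also have "\<dots> = ennreal (?s * C0) * (\<integral>\<^sup>+\<sigma>. ennreal (\<sigma> powr (- 2 - \<alpha>)) * indicator {d..1/4} \<sigma> * ?W \<sigma> \<partial>lborel)"
      by (rule nn_integral_cmult) measurable
    finally have "(\<integral>\<^sup>+z. ?w z * ennreal (norm (bkern ?s z \<xi>)) \<partial>lborel)
      \<le> ennreal ((1/4) powr (- ?s)) * ?A + ennreal (?s * C0) * (\<integral>\<^sup>+\<sigma>. ennreal (\<sigma> powr (- 2 - \<alpha>)) * indicator {d..1/4} \<sigma> * ?W \<sigma> \<partial>lborel)"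
      by (simp add: add_left_mono)
    also have "\<dots> \<le> ennreal C * ?A + ennreal C * (\<integral>\<^sup>+\<sigma>. ennreal (\<sigma> powr (- 2 - \<alpha>)) * indicator {d..1/4} \<sigma> * ?W \<sigma>
        \<partial>lborel)"
      using C by (intro add_mono mult_right_mono ennreal_leI) auto
    finally show "(\<integral>\<^sup>+z. ?w z * ennreal (norm (bkern ?s z \<xi>)) \<partial>lborel)
        \<le> ennreal C * ?A + ennreal C * (\<integral>\<^sup>+\<sigma>. ennreal (\<sigma> powr (- 2 - \<alpha>)) * indicator {(1 - (norm \<xi>)\<^sup>2) / 2..1/4} \<sigma> * ?W \<sigma> \<partial>lborel)"
      unfolding d_def .
  qed
qed

lemma nn_integral_nu_weight:
  fixes w :: "real \<Rightarrow> ennreal" and g :: "complex ^ 'n \<Rightarrow> ennreal"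
  assumes a: "\<alpha> > -1" and [measurable]: "w \<in> borel_measurable borel" "g \<in> borel_measurable borel"
    and v: "\<And>\<rho>. \<rho> > 0 \<Longrightarrow> w \<rho> = ennreal (\<rho> powr \<alpha>) * v \<rho>"
    and [measurable]: "v \<in> borel_measurable borel"
  shows "(\<integral>\<^sup>+z. v (1 - (norm z)\<^sup>2) * g z \<partial>nu \<alpha>)
    = ennreal (c_const TYPE('n) \<alpha>) * (\<integral>\<^sup>+z. w (1 - (norm z)\<^sup>2) * indicator unit_ball z * g z \<partial>lborel)"
proof -
  have c: "c_const TYPE('n) \<alpha> \<ge> 0" using c_const_pos[OF a, where 'n='n] by simp
  have "(\<integral>\<^sup>+z. v (1 - (norm z)\<^sup>2) * g z \<partial>nu \<alpha>) = (\<integral>\<^sup>+z. ennreal (wt \<alpha> z) * (v (1 - (norm z)\<^sup>2) * g z) \<partial>lborel)"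
    by (rule nn_integral_nu[OF a]) measurable
  also have "\<dots> = (\<integral>\<^sup>+z. ennreal (c_const TYPE('n) \<alpha>) * (w (1 - (norm z)\<^sup>2) * indicator unit_ball z * g z) \<partial>lborel)"
    using c by (intro nn_integral_cong) (auto simp: wt_def indicator_def v abs_square_less_1 ennreal_mult mult_ac)
  also have "\<dots> = ennreal (c_const TYPE('n) \<alpha>) * (\<integral>\<^sup>+z. w (1 - (norm z)\<^sup>2) * indicator unit_ball z * g z \<partial>lborel)"
    by (rule nn_integral_cmult) measurable
  finally show ?thesis .
qed

text \<open>With w \<rho> = \<rho>^(\<alpha>-\<delta>) the inner integral is of order
  \<sigma>^(\<alpha>-\<delta>+1), finite for \<delta> < 1 + \<alpha>. This leaves
  \<sigma>^(-1-\<delta>), whose integral from (1 - |\<xi>|^2)/2 on is of the required order for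
  \<delta> > 0.\<close>

lemma Forelli_Rudin:
  assumes a: "\<alpha> > -1" and \<delta>: "0 < \<delta>" "\<delta> < 1 + \<alpha>"
  shows "\<exists>C\<ge>0. \<forall>\<xi> :: complex ^ 'n. norm \<xi> < 1 \<longrightarrow>
    (\<integral>\<^sup>+z. ennreal ((1 - (norm z)\<^sup>2) powr (- \<delta>)) * ennreal (norm (bkern (real CARD('n) + 1 + \<alpha>) z \<xi>)) \<partial>nu \<alpha>)
    \<le> ennreal (C * (1 - (norm \<xi>)\<^sup>2) powr (- \<delta>))"
proof -
  define w where "w \<rho> = ennreal (\<rho> powr (\<alpha> - \<delta>))" for \<rho> :: real
  have [measurable]: "w \<in> borel_measurable borel" unfolding w_def by measurable
  obtain C where C: "C \<ge> 0" and le: "\<And>\<xi> :: complex ^ 'n. norm \<xi> < 1 \<Longrightarrow>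
    (\<integral>\<^sup>+z. w (1 - (norm z)\<^sup>2) * indicator unit_ball z * ennreal (norm (bkern (real CARD('n) + 1 + \<alpha>) z \<xi>)) \<partial>lborel)
    \<le> ennreal C * (\<integral>\<^sup>+z. w (1 - (norm (z :: complex ^ 'n))\<^sup>2) * indicator unit_ball z \<partial>lborel)
    + ennreal C * (\<integral>\<^sup>+\<sigma>. ennreal (\<sigma> powr (- 2 - \<alpha>)) * indicator {(1 - (norm \<xi>)\<^sup>2) / 2..1/4} \<sigma> *
        (\<integral>\<^sup>+\<rho>. w \<rho> * indicator {0<..2 * \<sigma>} \<rho> \<partial>lborel) \<partial>lborel)"
    using kernel_integral_le[OF \<open>w \<in> borel_measurable borel\<close> a, where 'n='n] by blast
  define A where "A = Gamma (\<alpha> - \<delta> + 1) * gauss_integral TYPE('n) / Gamma (real CARD('n) + (\<alpha> - \<delta>) + 1)"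
  have A: "(\<integral>\<^sup>+z. w (1 - (norm (z :: complex ^ 'n))\<^sup>2) * indicator unit_ball z \<partial>lborel) = ennreal A"
    using nn_integral_ball_weight[of "\<alpha> - \<delta>", where 'n='n] \<delta> unfolding A_def w_def
    by (simp add: ennreal_mult'' ennreal_indicator)
  have A0: "A \<ge> 0"
    unfolding A_def using \<delta> gauss_integral_pos[of 0, where 'n='n]
    by (intro divide_nonneg_nonneg mult_nonneg_nonneg less_imp_le[OF Gamma_real_pos]) (auto simp: add_nonneg_pos)
  define B where "B = 2 powr (\<alpha> - \<delta> + 1) / (\<alpha> - \<delta> + 1)"
  have B0: "B \<ge> 0" using \<delta> by (simp add: B_def)
  define c where "c = c_const TYPE('n) \<alpha>"
  have c: "c \<ge> 0" using c_const_pos[OF a, where 'n='n] by (simp add: c_def)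
  define D where "D = c * (C * A + C * (B * (2 powr \<delta> / \<delta>)))"
  show ?thesis
  proof (intro exI[of _ D] conjI allI impI)
    show "D \<ge> 0" unfolding D_def using A0 B0 C c \<delta> by simp
    fix \<xi> :: "complex ^ 'n" assume \<xi>: "norm \<xi> < 1"
    define d where "d = 1 - (norm \<xi>)\<^sup>2"
    have d: "0 < d" "d \<le> 1" using \<xi> by (auto simp: d_def abs_square_less_1)
    have W: "(\<integral>\<^sup>+\<rho>. w \<rho> * indicator {0<..2 * \<sigma>} \<rho> \<partial>lborel) = ennreal (B * \<sigma> powr (\<alpha> - \<delta> + 1))" if "\<sigma> \<ge> 0" for \<sigma>
      unfolding w_def B_def using that \<delta> by (subst nn_integral_powr_from_0) (auto simp: powr_mult)
    have "(\<integral>\<^sup>+\<sigma>. ennreal (\<sigma> powr (- 2 - \<alpha>)) * indicator {d / 2..1/4} \<sigma> * (\<integral>\<^sup>+\<rho>. w \<rho> * indicator {0<..2 * \<sigma>} \<rho>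
        \<partial>lborel) \<partial>lborel)
      \<le> (\<integral>\<^sup>+\<sigma>. ennreal B * (ennreal (\<sigma> powr (- 1 - \<delta>)) * indicator {d / 2..} \<sigma>) \<partial>lborel)"
    proof (rule nn_integral_mono)
      fix \<sigma> :: real
      show "ennreal (\<sigma> powr (- 2 - \<alpha>)) * indicator {d / 2..1/4} \<sigma> * (\<integral>\<^sup>+\<rho>. w \<rho> * indicator {0<..2 * \<sigma>} \<rho> \<partial>lborel)
        \<le> ennreal B * (ennreal (\<sigma> powr (- 1 - \<delta>)) * indicator {d / 2..} \<sigma>)"
      proof (cases "\<sigma> \<in> {d / 2..1/4}")
        case True
        hence \<sigma>: "\<sigma> \<ge> 0" using d by auto
        have "\<sigma> powr (- 2 - \<alpha>) * (B * \<sigma> powr (\<alpha> - \<delta> + 1)) = B * (\<sigma> powr (- 2 - \<alpha>) * \<sigma> powr (\<alpha> - \<delta> + 1))" by simp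
        also have "\<sigma> powr (- 2 - \<alpha>) * \<sigma> powr (\<alpha> - \<delta> + 1) = \<sigma> powr (- 1 - \<delta>)" by (simp flip: powr_add)
        finally have e: "\<sigma> powr (- 2 - \<alpha>) * (B * \<sigma> powr (\<alpha> - \<delta> + 1)) = B * \<sigma> powr (- 1 - \<delta>)" .
        show ?thesis using True B0 by (simp add: W[OF \<sigma>] e flip: ennreal_mult)
      qed simp
    qed
    also have "\<dots> = ennreal B * ennreal ((d / 2) powr (- \<delta>) / \<delta>)"
      using \<delta> d by (subst nn_integral_cmult) (auto simp: nn_integral_powr_at_top)
    also have "\<dots> = ennreal (B * (2 powr \<delta> / \<delta>) * d powr (- \<delta>))"
      using B0 \<delta> d by (simp add: powr_divide powr_minus field_simps flip: ennreal_mult)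
    finally have 1: "(\<integral>\<^sup>+\<sigma>. ennreal (\<sigma> powr (- 2 - \<alpha>)) * indicator {d / 2..1/4} \<sigma> * (\<integral>\<^sup>+\<rho>. w \<rho>
        * indicator {0<..2 * \<sigma>} \<rho> \<partial>lborel) \<partial>lborel)
        \<le> ennreal (B * (2 powr \<delta> / \<delta>) * d powr (- \<delta>))" .
    have "(\<integral>\<^sup>+z. ennreal ((1 - (norm z)\<^sup>2) powr (- \<delta>)) * ennreal (norm (bkern (real CARD('n) + 1 + \<alpha>) z \<xi>)) \<partial>nu \<alpha>)
      = ennreal c * (\<integral>\<^sup>+z. w (1 - (norm z)\<^sup>2) * indicator unit_ball z * ennreal (norm (bkern (real CARD('n) + 1 + \<alpha>) z \<xi>)) \<partial>lborel)"
      unfolding c_def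
      by (rule nn_integral_nu_weight[OF a, where v="\<lambda>\<rho>. ennreal (\<rho> powr (- \<delta>))"])
         (auto simp: w_def ennreal_mult[symmetric] powr_add[symmetric])
    also have "\<dots> \<le> ennreal c * (ennreal C * ennreal A + ennreal C * ennreal (B * (2 powr \<delta> / \<delta>) * d powr (- \<delta>)))"
      by (intro mult_left_mono order.trans[OF le[OF \<xi>, unfolded A]] add_left_mono order.trans[OF _ mult_left_mono[OF 1]])
         (simp_all add: d_def)
    also have "\<dots> = ennreal (c * (C * A + C * (B * (2 powr \<delta> / \<delta>) * d powr (- \<delta>))))"
    proof -
      have "ennreal c * (ennreal C * ennreal A + ennreal C * ennreal x)
          = ennreal (c * (C * A + C * x))" if "x \<ge> 0" for x
        using c C A0 that by (simp add: ennreal_mult ennreal_plus)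
      thus ?thesis using B0 \<delta> by simp
    qed
    also have "\<dots> \<le> ennreal (D * d powr (- \<delta>))"
    proof (rule ennreal_leI)
      \<comment> \<open>The contribution \<open>A\<close> of points where the kernel is bounded does
        not depend on \<xi>; it is absorbed since the power on the right is at least 1.\<close>
      have "1 powr (- \<delta>) \<le> d powr (- \<delta>)" using d \<delta> by (intro powr_mono2') auto
      hence "C * A * 1 \<le> C * A * d powr (- \<delta>)" using C A0 by (intro mult_left_mono) auto
      hence "c * (C * A + C * (B * (2 powr \<delta> / \<delta>) * d powr (- \<delta>)))
          \<le> c * (C * A * d powr (- \<delta>) + C * (B * (2 powr \<delta> / \<delta>) * d powr (- \<delta>)))"
        using c by (intro mult_left_mono) auto
      thus "c * (C * A + C * (B * (2 powr \<delta> / \<delta>) * d powr (- \<delta>))) \<le> D * d powr (- \<delta>)"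
        by (simp add: D_def algebra_simps)
    qed
    finally show "(\<integral>\<^sup>+z. ennreal ((1 - (norm z)\<^sup>2) powr (- \<delta>)) * ennreal (norm (bkern (real CARD('n) + 1
        + \<alpha>) z \<xi>)) \<partial>nu \<alpha>)
      \<le> ennreal (D * (1 - (norm \<xi>)\<^sup>2) powr (- \<delta>))" unfolding d_def .
  qed
qed

text \<open>Integrating over \<sigma> \<ge> \<rho>/2 first gives a multiple of \<rho>^(-1-\<alpha>),
  which meets \<rho>^\<alpha> V(\<rho>) and leaves V(\<rho>)/\<rho>, with no trace of \<xi>. The
  restriction \<sigma> \<le> 1/4 keeps \<rho> below 1, where \<open>V\<close> is controlled.\<close>

lemma kernel_integral_Dini_weight:
  fixes V :: "real \<Rightarrow> real"
  assumes a: "\<alpha> > -1" and [measurable]: "V \<in> borel_measurable borel"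
    and V: "\<And>\<rho>. 0 < \<rho> \<Longrightarrow> \<rho> \<le> 1 \<Longrightarrow> 0 \<le> V \<rho> \<and> V \<rho> \<le> B"
    and fin: "(\<integral>\<^sup>+\<rho>. ennreal (V \<rho> / \<rho>) * indicator {0<..1} \<rho> \<partial>lborel) < \<infinity>"
  shows "\<exists>C\<ge>0. \<forall>\<xi> :: complex ^ 'n. norm \<xi> < 1 \<longrightarrow>
    (\<integral>\<^sup>+z. ennreal (V (1 - (norm z)\<^sup>2)) * ennreal (norm (bkern (real CARD('n) + 1 + \<alpha>) z \<xi>)) \<partial>nu \<alpha>) \<le> ennreal C"
proof -
  define w where "w \<rho> = ennreal (\<rho> powr \<alpha>) * ennreal (V \<rho>)" for \<rho> :: real
  have [measurable]: "w \<in> borel_measurable borel" unfolding w_def by measurable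
  obtain C where C: "C \<ge> 0" and le: "\<And>\<xi> :: complex ^ 'n. norm \<xi> < 1 \<Longrightarrow>
    (\<integral>\<^sup>+z. w (1 - (norm z)\<^sup>2) * indicator unit_ball z * ennreal (norm (bkern (real CARD('n) + 1 + \<alpha>) z \<xi>)) \<partial>lborel)
    \<le> ennreal C * (\<integral>\<^sup>+z. w (1 - (norm (z :: complex ^ 'n))\<^sup>2) * indicator unit_ball z \<partial>lborel)
    + ennreal C * (\<integral>\<^sup>+\<sigma>. ennreal (\<sigma> powr (- 2 - \<alpha>)) * indicator {(1 - (norm \<xi>)\<^sup>2) / 2..1/4} \<sigma> *
        (\<integral>\<^sup>+\<rho>. w \<rho> * indicator {0<..2 * \<sigma>} \<rho> \<partial>lborel) \<partial>lborel)"
    using kernel_integral_le[OF \<open>w \<in> borel_measurable borel\<close> a, where 'n='n] by blast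
  let ?A = "(\<integral>\<^sup>+z. w (1 - (norm (z :: complex ^ 'n))\<^sup>2) * indicator unit_ball z \<partial>lborel)"
  have "?A \<le> (\<integral>\<^sup>+z. ennreal B * ennreal ((1 - (norm z)\<^sup>2) powr \<alpha> * indicator unit_ball (z :: complex ^ 'n)) \<partial>lborel)"
  proof (rule nn_integral_mono)
    fix z :: "complex ^ 'n"
    show "w (1 - (norm z)\<^sup>2) * indicator unit_ball z
        \<le> ennreal B * ennreal ((1 - (norm z)\<^sup>2) powr \<alpha> * indicator unit_ball z)"
    proof (cases "norm z < 1")
      case True
      hence "ennreal (V (1 - (norm z)\<^sup>2)) \<le> ennreal B" using V[of "1 - (norm
          z)\<^sup>2"] by (intro ennreal_leI) (simp add: abs_square_less_1)
      thus ?thesis using True by (simp add: w_def mult.commute mult_right_mono)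
    qed simp
  qed
  also have "\<dots> = ennreal B * (\<integral>\<^sup>+z. ennreal ((1 - (norm z)\<^sup>2) powr \<alpha> * indicator unit_ball (z :: complex ^ 'n))
      \<partial>lborel)"
    by (rule nn_integral_cmult) measurable
  also have "\<dots> < \<infinity>" unfolding nn_integral_ball_weight[OF a] by (simp add: ennreal_mult_less_top)
  finally have A: "?A < \<infinity>" .
  define Q where "Q = (\<integral>\<^sup>+\<rho>. ennreal (V \<rho> / \<rho>) * indicator {0<..1} \<rho> \<partial>lborel)"
  let ?R = "ennreal (2 powr (1 + \<alpha>) / (1 + \<alpha>)) * Q"
  have R: "(\<integral>\<^sup>+\<sigma>. ennreal (\<sigma> powr (- 2 - \<alpha>)) * indicator {d / 2..1/4} \<sigma> * (\<integral>\<^sup>+\<rho>. w \<rho> * indicator {0<..2 * \<sigma>} \<rho>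
      \<partial>lborel) \<partial>lborel) \<le> ?R"
    if d: "d > 0" for d :: real
  proof -
    have m1 [measurable]: "(\<lambda>(\<sigma> :: real, \<rho> :: real). indicator {0<..2
        * \<sigma>} \<rho> :: ennreal) \<in> borel_measurable (borel \<Otimes>\<^sub>M borel)"
      unfolding indicator_def greaterThanAtMost_iff by measurable
    have m2 [measurable]: "(\<lambda>(\<sigma> :: real, \<rho> :: real). indicator {\<rho> / 2..} \<sigma> :: ennreal) \<in> borel_measurable (borel
        \<Otimes>\<^sub>M borel)"
      unfolding indicator_def atLeast_iff by measurable
    have "(\<integral>\<^sup>+\<sigma>. ennreal (\<sigma> powr (- 2 - \<alpha>)) * indicator {d / 2..1/4} \<sigma> * (\<integral>\<^sup>+\<rho>. w \<rho> * indicator {0<..2 * \<sigma>} \<rho>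
        \<partial>lborel) \<partial>lborel)
      = (\<integral>\<^sup>+\<sigma>. \<integral>\<^sup>+\<rho>. ennreal (\<sigma> powr (- 2 - \<alpha>)) * indicator {d / 2..1/4} \<sigma> * (w \<rho> * indicator {0<..2 * \<sigma>} \<rho>) \<partial>lborel \<partial>lborel)"
      by (intro nn_integral_cong nn_integral_cmult[symmetric]) measurable
    also have "\<dots> = (\<integral>\<^sup>+\<rho>. \<integral>\<^sup>+\<sigma>. ennreal (\<sigma> powr (- 2 - \<alpha>)) * indicator {d / 2..1/4} \<sigma> * (w \<rho> * indicator {0<..2
        * \<sigma>} \<rho>) \<partial>lborel \<partial>lborel)"
      by (rule lborel_pair.Fubini') measurable
    also have "\<dots> \<le> (\<integral>\<^sup>+\<rho>. ennreal (2 powr (1 + \<alpha>) / (1 + \<alpha>)) * (ennreal (V \<rho> / \<rho>) * indicator {0<..1} \<rho>) \<partial>lborel)"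
    proof (rule nn_integral_mono)
      fix \<rho> :: real
      let ?l = "\<integral>\<^sup>+\<sigma>. ennreal (\<sigma> powr (- 2 - \<alpha>)) * indicator {d / 2..1/4} \<sigma> * (w \<rho> * indicator {0<..2 * \<sigma>} \<rho>) \<partial>lborel"
      show "?l \<le> ennreal (2 powr (1 + \<alpha>) / (1 + \<alpha>)) * (ennreal (V \<rho> / \<rho>) * indicator {0<..1} \<rho>)"
      proof (cases "\<rho> \<in> {0<..1}")
        case False
        hence "ennreal (\<sigma> powr (- 2 - \<alpha>)) * indicator {d / 2..1/4} \<sigma> * (w \<rho> * indicator {0<..2 * \<sigma>} \<rho>) = 0" for \<sigma>
          by (auto simp: indicator_def)
        hence "?l = 0" by (simp only: nn_integral_const) simp
        thus ?thesis by (simp only: zero_le)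
      next
        case True
        hence \<rho>: "\<rho> > 0" "\<rho> \<le> 1" by auto
        have "?l \<le> (\<integral>\<^sup>+\<sigma>. w \<rho> * (ennreal (\<sigma> powr (- 1 - (1 + \<alpha>))) * indicator {\<rho> / 2..} \<sigma>) \<partial>lborel)"
          by (intro nn_integral_mono) (auto simp: indicator_def mult.commute)
        also have "\<dots> = w \<rho> * ennreal ((\<rho> / 2) powr (- (1 + \<alpha>)) / (1 + \<alpha>))"
          using \<rho> a by (subst nn_integral_cmult, measurable, subst nn_integral_powr_at_top) auto
        also have "\<dots> = ennreal (\<rho> powr \<alpha> * V \<rho> * ((\<rho> / 2) powr (- (1 + \<alpha>)) / (1 + \<alpha>)))"
          using \<rho> V[of \<rho>] a unfolding w_def by (subst ennreal_mult[symmetric], simp, simp, subst ennreal_mult[symmetric]) simp_all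
        also have "\<rho> powr \<alpha> * V \<rho> * ((\<rho> / 2) powr (- (1 + \<alpha>)) / (1 + \<alpha>)) = 2 powr (1 + \<alpha>) / (1 + \<alpha>) * (V \<rho> / \<rho>)"
        proof -
          have "(\<rho> / 2) powr (- (1 + \<alpha>)) = 2 powr (1 + \<alpha>) / \<rho> powr (1 + \<alpha>)"
            using \<rho> by (subst powr_minus) (simp add: powr_divide field_simps)
          moreover have "\<rho> powr (1 + \<alpha>) = \<rho> * \<rho> powr \<alpha>" using \<rho> by (simp add: powr_add)
          ultimately have e: "(\<rho> / 2) powr (- (1 + \<alpha>)) = 2 powr (1 + \<alpha>) / (\<rho> * \<rho> powr \<alpha>)" by (simp only:)
          show ?thesis unfolding e using \<rho> a by (simp add: mult_ac)
        qed
        also have "ennreal (2 powr (1 + \<alpha>) / (1 + \<alpha>) * (V \<rho> / \<rho>))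
            = ennreal (2 powr (1 + \<alpha>) / (1 + \<alpha>)) * ennreal (V \<rho> / \<rho>)"
          using V[of \<rho>] a \<rho> by (intro ennreal_mult) auto
        finally show ?thesis using True by simp
      qed
    qed
    also have "\<dots> = ?R" unfolding Q_def by (rule nn_integral_cmult) measurable
    finally show ?thesis .
  qed
  define T where "T = ennreal (c_const TYPE('n) \<alpha>) * (ennreal C * ?A + ennreal C * ?R)"
  have T: "T < \<infinity>" using A fin unfolding T_def Q_def[symmetric]
    by (simp add: ennreal_mult_less_top)
  have "(\<integral>\<^sup>+z. ennreal (V (1 - (norm z)\<^sup>2)) * ennreal (norm (bkern (real CARD('n) + 1 + \<alpha>) z \<xi>)) \<partial>nu \<alpha>)
      \<le> ennreal (enn2real T)"
    if \<xi>: "norm \<xi> < 1" for \<xi> :: "complex ^ 'n"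
  proof -
    have d: "1 - (norm \<xi>)\<^sup>2 > 0" using \<xi> by (simp add: abs_square_less_1)
    have "(\<integral>\<^sup>+z. ennreal (V (1 - (norm z)\<^sup>2)) * ennreal (norm (bkern (real CARD('n) + 1 + \<alpha>) z \<xi>)) \<partial>nu \<alpha>)
      = ennreal (c_const TYPE('n) \<alpha>) * (\<integral>\<^sup>+z. w (1 - (norm z)\<^sup>2) * indicator unit_ball z * ennreal (norm (bkern (real CARD('n) + 1 + \<alpha>) z \<xi>)) \<partial>lborel)"
      by (rule nn_integral_nu_weight[OF a, where v="\<lambda>\<rho>. ennreal (V \<rho>)"]) (auto simp: w_def)
    also have "\<dots> \<le> T" unfolding T_def
      by (intro mult_left_mono order.trans[OF le[OF \<xi>]] add_left_mono R[OF d]) auto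
    finally show ?thesis using T by simp
  qed
  thus ?thesis by (intro exI[of _ "enn2real T"]) auto
qed

section \<open>Growth functions\<close>

lemma growth_mono: "growth_function \<Phi> \<Longrightarrow> 0 \<le> s \<Longrightarrow> s \<le> t \<Longrightarrow> \<Phi> s \<le> \<Phi> t"
  by (auto simp: growth_function_def mono_on_def)

lemma growth_nonneg: "growth_function \<Phi> \<Longrightarrow> 0 \<le> t \<Longrightarrow> 0 \<le> \<Phi> t"
  unfolding growth_function_def by (metis atLeast_iff imageI)

lemma growth_surj:
  assumes "growth_function \<Phi>" "y \<ge> 0"
  obtains t where "t \<ge> 0" "\<Phi> t = y"
proof -
  have "y \<in> \<Phi> ` {0..}" using assms by (simp add: growth_function_def)
  thus ?thesis using that by auto
qed

lemma growth_0 [simp]: "growth_function \<Phi> \<Longrightarrow> \<Phi> 0 = 0"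
  by (metis growth_surj growth_mono growth_nonneg order.refl order.antisym)

text \<open>\<Phi> is arbitrary on negative arguments, so composition passes through the continuous
  extension \<open>\<Phi> (max 0 x)\<close>.\<close>

lemma growth_measurable:
  assumes "growth_function \<Phi>" and [measurable]: "f \<in> borel_measurable M"
    and nn: "\<And>x. x \<in> space M \<Longrightarrow> 0 \<le> f x"
  shows "(\<lambda>x. \<Phi> (f x)) \<in> borel_measurable M"
proof -
  have "continuous_on UNIV (\<lambda>x. \<Phi> (max 0 x))"
    using assms(1) unfolding growth_function_def
    by (elim conjE, rule_tac continuous_on_compose2[of "{0..}" \<Phi> UNIV "\<lambda>x. max 0 x"])
       (auto intro!: continuous_intros)
  hence [measurable]: "(\<lambda>x. \<Phi> (max 0 x)) \<in> borel_measurable borel"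
    by (rule borel_measurable_continuous_onI)
  have "(\<lambda>x. \<Phi> (max 0 (f x))) \<in> borel_measurable M" by measurable
  thus ?thesis by (rule measurable_cong[THEN iffD1, rotated]) (simp add: nn max_def)
qed

lemma growth_divide_le:
  assumes "growth_function \<Phi>" "mono_on {0<..} (\<lambda>t. \<Phi> t / t)" "t \<ge> 0" "c \<ge> 1"
  shows "\<Phi> (t / c) \<le> \<Phi> t / c"
proof (cases "t = 0")
  case False
  hence t: "t > 0" using assms by simp
  have "t / c \<le> t" using t assms(4) by (simp add: field_simps)
  hence "\<Phi> (t / c) / (t / c) \<le> \<Phi> t / t"
    using mono_onD[OF assms(2), of "t / c" t] t assms(4) by simp
  thus ?thesis using t assms(4) by (simp add: field_simps)
qed (use assms in simp)

text \<open>By the upper type condition a zero at some t > 0 would spread to all larger arguments,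
  against surjectivity onto the half-line.\<close>

lemma class_U_pos:
  assumes "\<Phi> \<in> class_U q" "t > 0"
  shows "\<Phi> t > 0"
proof (rule ccontr)
  assume "\<not> \<Phi> t > 0"
  have g: "growth_function \<Phi>" and up: "upper_type q \<Phi>" using assms(1) by (auto simp: class_U_def)
  from up obtain C where C: "C > 0" "\<And>s u. s > 0 \<Longrightarrow> u \<ge> 1 \<Longrightarrow> \<Phi> (s * u) \<le> C * u powr q * \<Phi> s"
    unfolding upper_type_def by blast
  have z: "\<Phi> t = 0" using \<open>\<not> \<Phi> t > 0\<close> growth_nonneg[OF g, of t] assms(2) by simp
  obtain v where v: "v \<ge> 0" "\<Phi> v = 1" using growth_surj[OF g, of 1] by auto
  have "\<Phi> (max v t) \<le> 0"
    using C(2)[of t "max v t / t"] assms(2) z by (simp add: field_simps)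
  moreover have "\<Phi> v \<le> \<Phi> (max v t)" using v by (intro growth_mono[OF g]) auto
  ultimately show False using v by simp
qed

lemma class_L_pos:
  assumes "\<Phi> \<in> class_L p" "t > 0"
  shows "\<Phi> t > 0"
proof (rule ccontr)
  assume "\<not> \<Phi> t > 0"
  have g: "growth_function \<Phi>" and am: "antimono_on {0<..} (\<lambda>t. \<Phi> t / t)" using assms(1) by (auto simp: class_L_def)
  have z: "\<Phi> t = 0" using \<open>\<not> \<Phi> t > 0\<close> growth_nonneg[OF g, of t] assms(2) by simp
  obtain v where v: "v \<ge> 0" "\<Phi> v = 1" using growth_surj[OF g, of 1] by auto
  have "\<Phi> (max v t) / max v t \<le> \<Phi> t / t"
    using monotone_onD[OF am, of t "max v t"] assms(2) by auto
  hence "\<Phi> (max v t) \<le> 0" using assms(2) z by (simp add: divide_le_0_iff)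
  moreover have "\<Phi> v \<le> \<Phi> (max v t)" using v by (intro growth_mono[OF g]) auto
  ultimately show False using v by simp
qed

text \<open>A doubling argument: the hypothesis bounds the integral over \<open>(\<lambda> t, t)\<close> of \<open>\<Phi> s / s\<^sup>2\<close>,
  which is at least \<open>ln (1 / \<lambda>) * \<Phi> (\<lambda> t) / (\<lambda> t)\<close>; take \<open>ln (1 / \<lambda>) = 2 * C\<close> and iterate.\<close>

lemma Dini_imp_lower_type:
  assumes g: "growth_function \<Phi>" and mono: "mono_on {0<..} (\<lambda>t. \<Phi> t / t)"
    and C: "C > 0" and Dini: "\<And>t. t > 0 \<Longrightarrow> (\<integral>\<^sup>+ s\<in>{0<..<t}. ennreal (\<Phi> s / s\<^sup>2) \<partial>lborel) \<le> ennreal (C * (\<Phi> t / t))"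
  shows "\<exists>\<eta>>0. \<forall>s t. 0 < s \<longrightarrow> s \<le> 1 \<longrightarrow> 0 \<le> t \<longrightarrow> \<Phi> (s * t) \<le> 2 * s powr (1 + \<eta>) * \<Phi> t"
proof -
  define G where "G t = \<Phi> t / t" for t
  define l where "l = exp (- (2 * C))"
  have l: "0 < l" "l < 1" using C by (auto simp: l_def)
  have Gmono: "G s \<le> G t" if "0 < s" "s \<le> t" for s t
    using mono_onD[OF mono, of s t] that by (simp add: G_def)
  have G0: "G t \<ge> 0" if "t > 0" for t using growth_nonneg[OF g, of t] that by (simp add: G_def)
  have half: "G (l * t) \<le> G t / 2" if t: "t > 0" for t
  proof -
    have lt: "0 < l * t" "l * t < t" using l t by auto
    have xp: "0 < x" if "x \<in> {l * t..t}" for x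
      using that lt(1) unfolding atLeastAtMost_iff by linarith
    have "((\<lambda>s. G (l * t) * (1 / s)) has_integral G (l * t) * (ln t - ln (l * t))) {l * t..t}"
      using lt l t by (intro has_integral_mult_right fundamental_theorem_of_calculus)
        (auto intro!: derivative_eq_intros xp simp: has_real_derivative_iff_has_vector_derivative[symmetric])
    moreover have "ln t - ln (l * t) = 2 * C" using t l by (simp add: ln_mult l_def)
    ultimately have "ennreal (G (l * t) * (2 * C))
        = (\<integral>\<^sup>+s. ennreal (G (l * t) * (1 / s)) * indicator {l * t..t} s \<partial>lborel)"
      using lt G0[OF lt(1)] by (subst nn_integral_has_integral_lebesgue'[where I="G (l * t) * (2 * C)"]) auto
    also have "\<dots> = (\<integral>\<^sup>+s. ennreal (G (l * t) * (1 / s)) * indicator {l * t..<t} s \<partial>lborel)"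
    proof (rule nn_integral_cong_AE)
      show "AE s in lborel. ennreal (G (l * t) * (1 / s)) * indicator {l * t..t} s
          = ennreal (G (l * t) * (1 / s)) * indicator {l * t..<t} s"
        using AE_lborel_singleton[of t] by eventually_elim (auto simp: indicator_def)
    qed
    also have "\<dots> \<le> (\<integral>\<^sup>+ s\<in>{0<..<t}. ennreal (\<Phi> s / s\<^sup>2) \<partial>lborel)"
    proof (rule nn_integral_mono)
      fix s
      show "ennreal (G (l * t) * (1 / s)) * indicator {l * t..<t} s \<le> ennreal (\<Phi> s / s\<^sup>2) * indicator {0<..<t} s"
      proof (cases "s \<in> {l * t..<t}")
        case True
        hence "G (l * t) * (1 / s) \<le> G s * (1 / s)" using lt by (intro mult_right_mono Gmono) auto
        also have "\<dots> = \<Phi> s / s\<^sup>2" by (simp add: G_def power2_eq_square)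
        finally show ?thesis using True lt by (simp add: ennreal_leI)
      qed simp
    qed
    also have "\<dots> \<le> ennreal (C * G t)" using Dini[OF t] by (simp add: G_def)
    finally have "G (l * t) * (2 * C) \<le> C * G t" using C G0[OF t] by (subst (asm) ennreal_le_iff) auto
    hence "C * (2 * G (l * t)) \<le> C * G t" by (simp add: mult_ac)
    thus ?thesis using C by simp
  qed
  have iter: "G (l ^ k * t) \<le> G t / 2 ^ k" if t: "t > 0" for t k
  proof (induction k)
    case (Suc k)
    have "G (l * (l ^ k * t)) \<le> G (l ^ k * t) / 2" using t l by (intro half) auto
    thus ?case using Suc by (simp add: mult.assoc)
  qed simp
  \<comment> \<open>The exponent with \<open>l powr \<eta> = 1/2\<close>: each factor
    \<open>l\<close> in the argument halves the ratio.\<close>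
  define \<eta> where "\<eta> = ln 2 / (2 * C)"
  have \<eta>: "\<eta> > 0" using C by (simp add: \<eta>_def)
  have "\<Phi> (s * t) \<le> 2 * s powr (1 + \<eta>) * \<Phi> t" if s: "0 < s" "s \<le> 1" and t: "0 \<le> t" for s t
  proof (cases "t = 0")
    case False
    hence t: "t > 0" using t by simp
    define x where "x = - ln s / (2 * C)"
    have "ln s \<le> 0" using s by simp
    hence x: "x \<ge> 0" using C by (simp add: x_def divide_nonpos_pos)
    \<comment> \<open>Here s is \<open>l\<close> to the power \<open>x\<close>. Rounding
      \<open>x\<close> down loses at most one halving, which is the factor 2 in the
      conclusion.\<close>
    define k where "k = nat \<lfloor>x\<rfloor>"
    have k: "real k \<le> x" "x - 1 \<le> real k" using x by (auto simp: k_def)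
    have sx: "s = exp (- (2 * C * x))" using s C by (simp add: x_def)
    have "l ^ k = exp (- (2 * C * real k))" by (simp add: l_def exp_of_nat_mult[symmetric] mult_ac)
    moreover have "2 * C * real k \<le> 2 * C * x" using k C by (intro mult_left_mono) auto
    ultimately have "s \<le> l ^ k" by (simp add: sx)
    hence "G (s * t) \<le> G (l ^ k * t)" using s t by (intro Gmono) auto
    also have "\<dots> \<le> G t / 2 ^ k" by (rule iter[OF t])
    also have "1 / (2::real) ^ k = 2 powr (- real k)" by (simp add: powr_minus powr_realpow divide_inverse)
    hence "G t / 2 ^ k = G t * 2 powr (- real k)" by (metis mult.right_neutral times_divide_eq_right)
    also have "\<dots> \<le> G t * 2 powr (1 - x)" using k G0[OF t] by (intro mult_left_mono powr_mono) auto
    also have "2 powr (1 - x) = 2 * s powr \<eta>"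
    proof -
      have "s powr \<eta> = exp (- (ln 2 * x))" using s by (simp add: powr_def \<eta>_def x_def)
      moreover have "2 powr (- x) = exp (- (ln 2 * x))" by (simp add: powr_def mult.commute)
      moreover have "2 powr (1 - x) = 2 powr 1 * 2 powr (- x)" by (simp only: powr_add[symmetric]) simp
      ultimately show ?thesis by simp
    qed
    finally have "\<Phi> (s * t) / (s * t) \<le> \<Phi> t / t * (2 * s powr \<eta>)" by (simp add: G_def)
    hence "\<Phi> (s * t) \<le> (s * t) * (\<Phi> t / t * (2 * s powr \<eta>))" using s t by (simp add: field_simps)
    also have "\<dots> = 2 * (s * s powr \<eta>) * \<Phi> t" using t by simp
    finally show ?thesis using s by (simp add: powr_add)
  qed (use g in simp)
  thus ?thesis using \<eta> by blast
qed

text \<open>What the Dini condition yields for \<Phi>1. A lower exponent above 1 is what makes the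
  complementary function finite and doubling.\<close>

locale lower_type_gt_1 =
  fixes \<Phi> :: "real \<Rightarrow> real" and \<eta> :: real
  assumes growth: "growth_function \<Phi>"
    and ratio_mono: "mono_on {0<..} (\<lambda>t. \<Phi> t / t)"
    and pos: "\<And>t. t > 0 \<Longrightarrow> \<Phi> t > 0"
    and eta_pos: "\<eta> > 0"
    and lower: "\<And>s t. 0 < s \<Longrightarrow> s \<le> 1 \<Longrightarrow> 0 \<le> t \<Longrightarrow> \<Phi> (s * t) \<le> 2 * s powr (1 + \<eta>) * \<Phi> t"
begin

text \<open>The lower type bound read backwards: comparing \<Phi> 1 with \<Phi> t for t \<ge> 1
  shows growth of order t^(1+\<eta>), and \<open>T\<close> is where t^\<eta> overtakes 2|y| / \<Phi>
  1.\<close>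

lemma superlinear: "\<exists>T>0. \<forall>t\<ge>T. y * t \<le> \<Phi> t"
proof -
  define T where "T = max 1 ((2 * \<bar>y\<bar> / \<Phi> 1) powr (1 / \<eta>))"
  have T: "T \<ge> 1" by (simp add: T_def)
  have "y * t \<le> \<Phi> t" if t: "t \<ge> T" for t
  proof -
    have t1: "t \<ge> 1" using t T by simp
    have "\<Phi> ((1 / t) * t) \<le> 2 * (1 / t) powr (1 + \<eta>) * \<Phi> t" using t1 by (intro lower) auto
    hence "\<Phi> 1 * t powr (1 + \<eta>) \<le> 2 * \<Phi> t"
      using t1 by (simp add: powr_divide field_simps)
    moreover have "2 * \<bar>y\<bar> / \<Phi> 1 \<le> t powr \<eta>"
    proof -
      have "2 * \<bar>y\<bar> / \<Phi> 1 = ((2 * \<bar>y\<bar> / \<Phi> 1) powr (1 / \<eta>)) powr \<eta>"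
        using eta_pos pos[of 1] by (simp add: powr_powr)
      also have "\<dots> \<le> t powr \<eta>" using t eta_pos by (intro powr_mono2) (auto simp: T_def)
      finally show ?thesis .
    qed
    hence "2 * \<bar>y\<bar> * t \<le> \<Phi> 1 * t powr \<eta> * t" using pos[of 1] t1 by (intro mult_right_mono) (auto simp: field_simps)
    moreover have "t powr (1 + \<eta>) = t powr \<eta> * t" using t1 by (simp add: powr_add)
    moreover have "y * t \<le> \<bar>y\<bar> * t" using t1 by (intro mult_right_mono) auto
    ultimately show ?thesis by (simp add: mult_ac)
  qed
  thus ?thesis using T by (intro exI[of _ T]) auto
qed

text \<open>Makes the real-valued \<open>SUP\<close> in \<open>complementary\<close> a genuine
  supremum; Young's inequality depends on it.\<close>

lemma bdd_complementary: "bdd_above ((\<lambda>t. t * y - \<Phi> t) ` {0..})"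
proof -
  obtain T where T: "T > 0" "\<And>t. t \<ge> T \<Longrightarrow> y * t \<le> \<Phi> t" using superlinear by blast
  have "t * y - \<Phi> t \<le> T * \<bar>y\<bar>" if t: "t \<ge> 0" for t
  proof (cases "t \<ge> T")
    case True
    have "T * \<bar>y\<bar> \<ge> 0" using T(1) by simp
    thus ?thesis using T(2)[OF True] mult.commute[of t y] by linarith
  next
    case False
    have "t * y \<le> t * \<bar>y\<bar>" using t by (intro mult_left_mono) auto
    also have "\<dots> \<le> T * \<bar>y\<bar>" using False by (intro mult_right_mono) auto
    finally show ?thesis using growth_nonneg[OF growth t] by linarith
  qed
  thus ?thesis by (intro bdd_aboveI2[where M="T * \<bar>y\<bar>"]) auto
qed

lemma Young: "t \<ge> 0 \<Longrightarrow> t * y \<le> \<Phi> t + complementary \<Phi> y"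
  using cSUP_upper[OF _ bdd_complementary, of t y] by (simp add: complementary_def)

lemma complementary_le:
  "(\<And>t. t \<ge> 0 \<Longrightarrow> t * y - \<Phi> t \<le> M) \<Longrightarrow> complementary \<Phi> y \<le> M"
  unfolding complementary_def by (intro cSUP_least) auto

lemma complementary_nonneg: "complementary \<Phi> y \<ge> 0"
  using Young[of 0 y] growth by simp

lemma complementary_mono: "y \<le> y' \<Longrightarrow> complementary \<Phi> y \<le> complementary \<Phi> y'"
proof (rule complementary_le)
  fix t :: real assume "y \<le> y'" "t \<ge> 0"
  hence "t * y \<le> t * y'" by (intro mult_left_mono)
  thus "t * y - \<Phi> t \<le> complementary \<Phi> y'" using Young[OF \<open>t \<ge> 0\<close>, of y'] by linarith
qed

lemma measurable_complementary [measurable]: "complementary \<Phi> \<in> borel_measurable borel"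
  by (rule borel_measurable_mono) (auto intro!: monoI complementary_mono)

text \<open>Dual to the lower type: \<open>s\<close> solves 2 s^(1+\<eta>) = s/K, so \<Phi> (s t)
  \<le> (s/K) \<Phi> t, and Young's inequality at \<open>s * t\<close>, multiplied by K/s, bounds
  the terms of the supremum at \<open>K * y\<close>.\<close>

lemma complementary_doubling:
  assumes "K \<ge> 1"
  shows "\<exists>M\<ge>0. \<forall>y. complementary \<Phi> (K * y) \<le> M * complementary \<Phi> y"
proof -
  define s where "s = (1 / (2 * K)) powr (1 / \<eta>)"
  have s: "0 < s" "s \<le> 1" using assms eta_pos by (auto simp: s_def intro!: powr_le1)
  have "s powr \<eta> = 1 / (2 * K)" using assms eta_pos by (simp add: s_def powr_powr)
  hence s\<eta>: "2 * s powr (1 + \<eta>) = s / K" using s by (simp add: powr_add)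
  have "complementary \<Phi> (K * y) \<le> (K / s) * complementary \<Phi> y" for y
  proof (rule complementary_le)
    fix t :: real assume t: "t \<ge> 0"
    have "\<Phi> (s * t) \<le> s / K * \<Phi> t" using lower[OF s t] by (simp add: s\<eta>)
    hence "(K / s) * \<Phi> (s * t) \<le> \<Phi> t" using s assms by (simp add: field_simps)
    moreover have "(K / s) * ((s * t) * y) \<le> (K / s) * (\<Phi> (s * t) + complementary \<Phi> y)"
      using s assms t by (intro mult_left_mono Young) auto
    moreover have "(K / s) * ((s * t) * y) = t * (K * y)" using s by simp
    ultimately show "t * (K * y) - \<Phi> t \<le> (K / s) * complementary \<Phi> y" by (simp add: distrib_left)
  qed
  thus ?thesis using s assms by (intro exI[of _ "K / s"]) auto
qed

text \<open>The factor \<open>1/2\<close> avoids an appeal to the continuity of \<open>\<Phi>\<close>.\<close>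

lemma growth_complementary_ratio:
  assumes y: "y > 0"
  shows "\<Phi> (complementary \<Phi> y / (2 * y)) \<le> complementary \<Phi> y"
proof (cases "complementary \<Phi> y = 0")
  case True thus ?thesis using growth by simp
next
  case False
  hence c: "complementary \<Phi> y > 0" using complementary_nonneg[of y] by simp
  define t where "t = complementary \<Phi> y / (2 * y)"
  have t: "t > 0" using c y by (simp add: t_def)
  \<comment> \<open>Otherwise the ratio exceeds \<open>y\<close> from \<open>t\<close> on, so only
    arguments below \<open>t\<close> can make a term of the supremum positive. It is then at most
    \<open>t * y\<close>, half of itself.\<close>
  have "\<Phi> t / t \<le> y"
  proof (rule ccontr)
    assume "\<not> \<Phi> t / t \<le> y"
    have "complementary \<Phi> y \<le> t * y"
    proof (rule complementary_le)
      fix u :: real assume u: "u \<ge> 0"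
      show "u * y - \<Phi> u \<le> t * y"
      proof (cases "u \<ge> t")
        case True
        have "\<Phi> t / t \<le> \<Phi> u / u" using mono_onD[OF ratio_mono, of t u] t True by simp
        hence "y \<le> \<Phi> u / u" using \<open>\<not> \<Phi> t / t \<le> y\<close> by linarith
        hence "u * y \<le> \<Phi> u" using True t by (simp add: field_simps)
        moreover have "t * y \<ge> 0" using t y by simp
        ultimately show ?thesis by linarith
      next
        case False
        hence "u * y \<le> t * y" using y by (intro mult_right_mono) auto
        thus ?thesis using growth_nonneg[OF growth u] by linarith
      qed
    qed
    moreover have "t * y = complementary \<Phi> y / 2" using y by (simp add: t_def)
    ultimately show False using c by simp
  qed
  hence "\<Phi> t \<le> y * t" using t by (simp add: field_simps)
  also have "\<dots> \<le> complementary \<Phi> y" using y c by (simp add: t_def)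
  finally show ?thesis by (simp add: t_def)
qed

end

section \<open>Growth functions whose ratio to the identity decreases\<close>

lemma class_L_le_tangent:
  assumes \<Phi>: "\<Phi> \<in> class_L p" and t: "t > 0" and u: "u \<ge> 0"
  shows "\<Phi> u \<le> u * (\<Phi> t / t) + \<Phi> t"
proof -
  have g: "growth_function \<Phi>" and am: "antimono_on {0<..} (\<lambda>t. \<Phi> t / t)" using \<Phi> by (auto simp: class_L_def)
  have n: "\<Phi> t \<ge> 0" using growth_nonneg[OF g] t by simp
  show ?thesis
  proof (cases "u \<le> t")
    case True
    have "u * (\<Phi> t / t) \<ge> 0" using n t u by simp
    thus ?thesis using growth_mono[OF g u True] by linarith
  next
    case False
    hence "\<Phi> u / u \<le> \<Phi> t / t" using monotone_onD[OF am, of t u] t by auto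
    hence "\<Phi> u \<le> u * (\<Phi> t / t)" using False t by (simp add: field_simps)
    thus ?thesis using n by linarith
  qed
qed

lemma class_L_lower_type:
  assumes "\<Phi> \<in> class_L p"
  obtains C where "C > 0" "\<And>u c. u \<ge> 0 \<Longrightarrow> c \<ge> 1 \<Longrightarrow> \<Phi> (u / c) \<le> C * c powr (- p) * \<Phi> u"
proof -
  have g: "growth_function \<Phi>" and lt: "lower_type p \<Phi>" using assms by (auto simp: class_L_def)
  from lt obtain C where C: "C > 0" "\<And>s t. s > 0 \<Longrightarrow> 0 < t \<Longrightarrow> t \<le> 1 \<Longrightarrow> \<Phi> (s * t) \<le> C * t powr p * \<Phi> s"
    unfolding lower_type_def by blast
  show ?thesis
  proof (rule that[OF C(1)])
    fix u c :: real assume "u \<ge> 0" "c \<ge> 1"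
    show "\<Phi> (u / c) \<le> C * c powr (- p) * \<Phi> u"
    proof (cases "u = 0")
      case False
      thus ?thesis using C(2)[of u "1 / c"] \<open>u \<ge> 0\<close> \<open>c \<ge> 1\<close> by (simp add: powr_divide powr_minus field_simps)
    qed (use g in simp)
  qed
qed

text \<open>The lower type bound with argument \<open>t\<close> and factor 1/t. It lets the
  \<Phi>2-modular control an integral of p-th powers in the point evaluation bound.\<close>

lemma class_L_ge_powr:
  assumes "\<Phi> \<in> class_L p"
  obtains c where "c > 0" "\<And>t. t \<ge> 1 \<Longrightarrow> t powr p \<le> c * \<Phi> t"
proof -
  obtain C where C: "C > 0" "\<And>u c. u \<ge> 0 \<Longrightarrow> c \<ge> 1 \<Longrightarrow> \<Phi> (u / c) \<le> C * c powr (- p) * \<Phi> u"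
    using class_L_lower_type[OF assms] by blast
  have p1: "\<Phi> 1 > 0" by (rule class_L_pos[OF assms]) simp
  show ?thesis
  proof (rule that[of "C / \<Phi> 1"])
    show "C / \<Phi> 1 > 0" using C p1 by simp
    fix t :: real assume t: "t \<ge> 1"
    have "\<Phi> 1 \<le> C * t powr (- p) * \<Phi> t" using C(2)[of t t] t by simp
    thus "t powr p \<le> C / \<Phi> 1 * \<Phi> t" using t p1 by (simp add: powr_minus field_simps)
  qed
qed

section \<open>The Bergman projection of integrable functions\<close>

lemma measurable_fst_nu [measurable]:
  "fst \<in> borel_measurable (nu \<alpha> \<Otimes>\<^sub>M M)"
  using measurable_compose[OF measurable_fst measurable_nu_borel[OF measurable_ident]] by simp

lemma measurable_snd_nu [measurable]:
  "snd \<in> borel_measurable (M \<Otimes>\<^sub>M nu \<alpha>)"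
  using measurable_compose[OF measurable_snd measurable_nu_borel[OF measurable_ident]] by simp

lemma norm_bkern_commute: "norm (bkern s z \<xi>) = norm (bkern s \<xi> z)"
  by (metis cnj_bkern complex_mod_cnj)

lemma norm_bergman_proj_le:
  fixes z :: "complex ^ 'n"
  assumes "norm z < 1"
  shows "ennreal (norm (bergman_proj \<alpha> g z))
    \<le> (\<integral>\<^sup>+\<xi>. ennreal (norm (g \<xi>)) * ennreal (norm (bkern (real CARD('n) + 1 + \<alpha>) z \<xi>)) \<partial>nu \<alpha>)"
proof -
  let ?k = "\<lambda>\<xi>. g \<xi> * bkern (real CARD('n) + 1 + \<alpha>) z \<xi>"
  show ?thesis
  proof (cases "integrable (nu \<alpha>) ?k")
    case True
    from integral_norm_bound_ennreal[OF this] show ?thesis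
      unfolding bergman_proj_eq[OF assms] by (simp add: norm_mult ennreal_mult)
  next
    \<comment> \<open>A non-integrable function has Bochner integral 0 by convention, so the bound
      persists.\<close>
    case False
    thus ?thesis unfolding bergman_proj_eq[OF assms] by (simp add: not_integrable_integral_eq)
  qed
qed

lemma measurable_bergman_proj [measurable]:
  fixes g :: "complex ^ 'n \<Rightarrow> complex"
  assumes "\<alpha> > -1" and [measurable]: "g \<in> borel_measurable (nu \<alpha>)"
  shows "bergman_proj \<alpha> g \<in> borel_measurable (nu \<alpha>)"
proof -
  interpret finite_measure "nu \<alpha> :: (complex ^ 'n) measure" by (rule finite_measure_nu[OF assms(1)])
  have "(\<lambda>z. \<integral>\<xi>. g \<xi> * bkern (real CARD('n) + 1 + \<alpha>) z \<xi> \<partial>nu \<alpha>) \<in> borel_measurable (nu \<alpha>)"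
    by measurable
  thus ?thesis by (rule measurable_cong[THEN iffD1, rotated]) (simp add: bergman_proj_eq)
qed

text \<open>With t = \<rho>^(-a) the measure d\<rho>/\<rho> becomes dt/(a t). The substitution rule
  asks for an increasing map on a compact interval: hence the sign in \<open>?g\<close>, undone by a
  reflection, and the cut at \<open>e\<close>, removed by monotone convergence.\<close>

lemma Dini_weight_substitution:
  assumes \<Phi>: "growth_function \<Phi>" and a: "a > 0"
  shows "(\<integral>\<^sup>+\<rho>. ennreal (\<Phi> (\<rho> powr (- a)) / \<rho> powr (- a) / \<rho>) * indicator {0<..1} \<rho> \<partial>lborel)
    \<le> ennreal (1 / a) * (\<integral>\<^sup>+ t\<in>{1..}. ennreal (\<Phi> t / t\<^sup>2) \<partial>lborel)"
proof -
  define J where "J = (\<integral>\<^sup>+ t\<in>{1..}. ennreal (\<Phi> t / t\<^sup>2) \<partial>lborel)"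
  define F where "F \<rho> = ennreal (\<Phi> (\<rho> powr (- a)) / \<rho> powr (- a) / \<rho>)" for \<rho>
  have [measurable]: "F \<in> borel_measurable borel"
  proof -
    have [measurable]: "(\<lambda>\<rho>. \<Phi> (\<rho> powr (- a))) \<in> borel_measurable borel"
      by (rule growth_measurable[OF \<Phi>]) auto
    show ?thesis unfolding F_def by measurable
  qed
  have [measurable]: "(\<lambda>x. \<Phi> (max 0 (- x))) \<in> borel_measurable borel"
    by (rule growth_measurable[OF \<Phi>]) auto
  have cut: "(\<integral>\<^sup>+\<rho>. F \<rho> * indicator {e..1} \<rho> \<partial>lborel) \<le> ennreal (1 / a) * J" if e: "0 < e" "e < 1" for e
  proof -
    let ?f = "\<lambda>x. ennreal (\<Phi> (max 0 (- x)) / x\<^sup>2)"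
    let ?g = "\<lambda>\<rho>. - (\<rho> powr (- a))" and ?g' = "\<lambda>\<rho>. a * \<rho> powr (- a - 1)"
    have "(\<integral>\<^sup>+\<rho>. F \<rho> * indicator {e..1} \<rho> \<partial>lborel)
        = (\<integral>\<^sup>+\<rho>. ennreal (1 / a) * (?f (?g \<rho>) * ?g' \<rho> * indicator {e..1} \<rho>) \<partial>lborel)"
    proof (rule nn_integral_cong)
      fix \<rho> :: real
      show "F \<rho> * indicator {e..1} \<rho> = ennreal (1 / a) * (?f (?g \<rho>) * ?g' \<rho> * indicator {e..1} \<rho>)"
      proof (cases "\<rho> \<in> {e..1}")
        case True
        hence \<rho>: "\<rho> > 0" using e by auto
        define t where "t = \<rho> powr (- a)"
        have t: "t > 0" using \<rho> by (simp add: t_def)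
        have "\<rho> powr (- a - 1) = t / \<rho>" using \<rho> by (simp add: t_def powr_diff)
        hence "1 / a * (\<Phi> t / t\<^sup>2 * (a * \<rho> powr (- a - 1))) = \<Phi> t / t / \<rho>"
          using a \<rho> t by (simp add: power2_eq_square)
        moreover have "\<Phi> t \<ge> 0" using growth_nonneg[OF \<Phi>] t by simp
        moreover have "ennreal (1 / a) * (ennreal (\<Phi> t / t\<^sup>2) * ennreal (a * \<rho> powr (- a - 1)))
            = ennreal (1 / a * (\<Phi> t / t\<^sup>2 * (a * \<rho> powr (- a - 1))))"
          using a \<open>\<Phi> t \<ge> 0\<close> by (subst ennreal_mult[symmetric], simp, simp, subst ennreal_mult[symmetric]) simp_all
        moreover have "max 0 t = t" using t by simp
        ultimately show ?thesis using True a by (simp add: F_def t_def[symmetric])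
      qed simp
    qed
    also have "\<dots> = ennreal (1 / a) * (\<integral>\<^sup>+\<rho>. ?f (?g \<rho>) * ?g' \<rho> * indicator {e..1} \<rho> \<partial>lborel)"
      by (rule nn_integral_cmult) measurable
    also have "(\<integral>\<^sup>+\<rho>. ?f (?g \<rho>) * ?g' \<rho> * indicator {e..1} \<rho> \<partial>lborel)
        = (\<integral>\<^sup>+x. ?f x * indicator {?g e..?g 1} x \<partial>lborel)"
    proof (rule nn_integral_substitution_aux[symmetric, OF _ _ _ _ _ e(2)])
      show "?f \<in> borel_measurable borel" by measurable
      show "(?g has_real_derivative ?g' x) (at x)" if "x \<in> {e..1}" for x
        using that e by (auto intro!: derivative_eq_intros)
      show "continuous_on {e..1} ?g'" using e by (intro continuous_intros) auto
    qed (use a in auto)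
    also have "\<dots> = (\<integral>\<^sup>+x. ?f (0 - x) * indicator {?g e..?g 1} (0 - x) \<partial>lborel)"
      by (rule nn_integral_lborel_reflect[symmetric]) measurable
    also have "\<dots> \<le> J"
      unfolding J_def by (intro nn_integral_mono) (auto simp: indicator_def)
    finally show ?thesis by (simp add: mult_left_mono)
  qed
  \<comment> \<open>The denominator \<open>i + 2\<close> keeps the left end strictly below 1, as the
    bound on the cut-off integral requires.\<close>
  have "(\<integral>\<^sup>+\<rho>. F \<rho> * indicator {0<..1} \<rho> \<partial>lborel)
      = (\<integral>\<^sup>+\<rho>. (SUP i. F \<rho> * indicator {1 / real (i + 2)..1} \<rho>) \<partial>lborel)"
  proof (rule nn_integral_cong)
    fix \<rho> :: real
    show "F \<rho> * indicator {0<..1} \<rho> = (SUP i. F \<rho> * indicator {1 / real (i + 2)..1} \<rho>)"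
    proof (cases "\<rho> \<in> {0<..1}")
      case True
      then obtain i where i: "1 / real (Suc i) < \<rho>" using nat_approx_posE[of \<rho>] by auto
      have "1 / real (i + 2) \<le> 1 / real (Suc i)" by (intro divide_left_mono) auto
      hence "\<rho> \<in> {1 / real (i + 2)..1}" using i True by auto
      hence "F \<rho> \<le> F \<rho> * indicator {1 / real (i + 2)..1} \<rho>" by simp
      also have "\<dots> \<le> (SUP i. F \<rho> * indicator {1 / real (i + 2)..1} \<rho>)" by (intro SUP_upper) auto
      finally have "F \<rho> \<le> (SUP i. F \<rho> * indicator {1 / real (i + 2)..1} \<rho>)" .
      moreover have "(SUP i. F \<rho> * indicator {1 / real (i + 2)..1} \<rho>) \<le> F \<rho>"
        by (intro SUP_least) (auto simp: indicator_def)
      ultimately show ?thesis using True by (simp add: antisym)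
    next
      case False
      have "\<rho> \<notin> {1 / real (i + 2)..1}" for i :: nat
      proof
        assume "\<rho> \<in> {1 / real (i + 2)..1}"
        moreover have "1 / real (i + 2) > 0" by simp
        ultimately show False using False unfolding atLeastAtMost_iff greaterThanAtMost_iff by linarith
      qed
      thus ?thesis using False by simp
    qed
  qed
  also have "\<dots> = (SUP i. \<integral>\<^sup>+\<rho>. F \<rho> * indicator {1 / real (i + 2)..1} \<rho> \<partial>lborel)"
  proof (rule nn_integral_monotone_convergence_SUP)
    show "incseq (\<lambda>i \<rho>. F \<rho> * indicator {1 / real (i + 2)..1} \<rho>)"
    proof (intro incseq_SucI le_funI mult_left_mono)
      fix i :: nat and \<rho> :: real
      have "1 / real (Suc i + 2) \<le> 1 / real (i + 2)" by (intro divide_left_mono) auto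
      thus "(indicator {1 / real (i + 2)..1} \<rho> :: ennreal) \<le> indicator {1 / real (Suc i + 2)..1} \<rho>"
        by (auto simp: indicator_def)
    qed simp
  qed measurable
  also have "\<dots> \<le> ennreal (1 / a) * J" by (intro SUP_least cut) auto
  finally show ?thesis unfolding F_def J_def .
qed

text \<open>A bound on modulars at one fixed level \<open>A\<close>, uniform in \<open>g\<close>;
  scaling turns it into a norm inequality afterwards. Fubini moves the weight onto the kernel, where
  its integral in \<open>z\<close> is bounded uniformly in \<xi>.\<close>

lemma bergman_proj_L1_bound:
  assumes \<Phi>: "\<Phi> \<in> class_L p" and a: "\<alpha> > -1"
    and fin: "(\<integral>\<^sup>+ t\<in>{1..}. ennreal (\<Phi> t / t\<^sup>2) \<partial>lborel) < \<infinity>"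
    and A: "A \<ge> 0"
  shows "\<exists>M\<ge>0. \<forall>g :: complex ^ 'n \<Rightarrow> complex. g \<in> borel_measurable (nu \<alpha>) \<longrightarrow>
    (\<integral>\<^sup>+\<xi>. ennreal (norm (g \<xi>)) \<partial>nu \<alpha>) \<le> ennreal A \<longrightarrow>
    (\<integral>\<^sup>+z. ennreal (\<Phi> (norm (bergman_proj \<alpha> g z))) \<partial>nu \<alpha>) \<le> ennreal M"
proof -
  let ?s = "real CARD('n) + 1 + \<alpha>"
  have gr: "growth_function \<Phi>" and am: "antimono_on {0<..} (\<lambda>t. \<Phi> t / t)" using \<Phi> by (auto simp: class_L_def)
  \<comment> \<open>Half of 1 + \<alpha>, so that \<rho>^(\<alpha>-e) is integrable near 0. Since
    \<Phi> t \<le> \<Phi> 1 * t for t \<ge> 1, the threshold term is then integrable too.\<close>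
  define e where "e = (1 + \<alpha>) / 2"
  have e: "e > 0" "\<alpha> - e > -1" using a by (auto simp: e_def field_simps)
  define V where "V \<rho> = \<Phi> (\<rho> powr (- e)) / \<rho> powr (- e)" for \<rho>
  have [measurable]: "(\<lambda>\<rho>. \<Phi> (\<rho> powr (- e))) \<in> borel_measurable borel"
    by (rule growth_measurable[OF gr]) auto
  have [measurable]: "V \<in> borel_measurable borel" unfolding V_def by measurable
  have t1: "\<rho> powr (- e) \<ge> 1" if "0 < \<rho>" "\<rho> \<le> 1" for \<rho>
    using powr_mono2'[of "- e" \<rho> 1] that e by simp
  have ratio: "\<Phi> t / t \<le> \<Phi> 1" if "t \<ge> 1" for t
    using monotone_onD[OF am, of 1 t] that by simp
  have V: "0 \<le> V \<rho> \<and> V \<rho> \<le> \<Phi> 1" if "0 < \<rho>" "\<rho> \<le> 1" for \<rho>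
    using t1[OF that] ratio[OF t1[OF that]] growth_nonneg[OF gr, of "\<rho> powr (- e)"] by (auto simp: V_def)
  have Vfin: "(\<integral>\<^sup>+\<rho>. ennreal (V \<rho> / \<rho>) * indicator {0<..1} \<rho> \<partial>lborel) < \<infinity>"
  proof -
    have "(\<integral>\<^sup>+\<rho>. ennreal (V \<rho> / \<rho>) * indicator {0<..1} \<rho> \<partial>lborel)
        \<le> ennreal (1 / e) * (\<integral>\<^sup>+ t\<in>{1..}. ennreal (\<Phi> t / t\<^sup>2) \<partial>lborel)"
      unfolding V_def by (rule Dini_weight_substitution[OF gr e(1)])
    also have "\<dots> < \<infinity>" using fin by (simp add: ennreal_mult_less_top)
    finally show ?thesis .
  qed
  from kernel_integral_Dini_weight[OF a \<open>V \<in> borel_measurable borel\<close> V Vfin, where 'n='n]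
  obtain C where C: "C \<ge> 0" and K: "\<And>\<xi> :: complex ^ 'n. norm \<xi> < 1 \<Longrightarrow>
    (\<integral>\<^sup>+z. ennreal (V (1 - (norm z)\<^sup>2)) * ennreal (norm (bkern ?s z \<xi>)) \<partial>nu \<alpha>) \<le> ennreal C"
    by blast
  define T where "T = c_const TYPE('n) \<alpha> * (\<Phi> 1 * (Gamma (\<alpha> - e
      + 1) * gauss_integral TYPE('n) / Gamma (real CARD('n) + (\<alpha> - e) + 1)))"
  have T0: "T \<ge> 0"
    unfolding T_def using e gauss_integral_pos[of 0, where 'n='n] c_const_pos[OF a, where 'n='n] growth_nonneg[OF gr, of 1]
    by (intro mult_nonneg_nonneg divide_nonneg_nonneg less_imp_le[OF Gamma_real_pos]) (auto simp: add_nonneg_pos)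
  have Tint: "(\<integral>\<^sup>+z. ennreal (\<Phi> ((1 - (norm (z :: complex ^ 'n))\<^sup>2) powr (- e))) \<partial>nu \<alpha>) \<le> ennreal T"
  proof -
    have "(\<integral>\<^sup>+z. ennreal (\<Phi> ((1 - (norm (z :: complex ^ 'n))\<^sup>2) powr (- e))) \<partial>nu \<alpha>)
       \<le> (\<integral>\<^sup>+z. (ennreal (\<Phi> 1) * ennreal ((1 - (norm (z :: complex ^ 'n))\<^sup>2) powr (- e))) * 1 \<partial>nu \<alpha>)"
    proof (rule nn_integral_mono)
      fix z :: "complex ^ 'n" assume "z \<in> space (nu \<alpha>)"
      hence r: "0 < 1 - (norm z)\<^sup>2" "1 - (norm z)\<^sup>2 \<le> 1" by (auto simp: abs_square_less_1)
      have "\<Phi> ((1 - (norm z)\<^sup>2) powr (- e)) \<le> \<Phi> 1 * (1 - (norm z)\<^sup>2) powr (- e)"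
        using ratio[OF t1[OF r]] less_le_trans[OF zero_less_one t1[OF r]] by (subst (asm) pos_divide_le_eq)
      thus "ennreal (\<Phi> ((1 - (norm z)\<^sup>2) powr (- e))) \<le> (ennreal (\<Phi> 1) * ennreal ((1 - (norm z)\<^sup>2) powr (- e))) * 1"
        using growth_nonneg[OF gr, of 1] by (simp add: ennreal_leI flip: ennreal_mult)
    qed
    also have "\<dots> = ennreal (c_const TYPE('n) \<alpha>) * (\<integral>\<^sup>+z. (ennreal (\<Phi> 1)
        * ennreal ((1 - (norm z)\<^sup>2) powr (\<alpha> - e))) * indicator unit_ball (z :: complex ^ 'n) * 1 \<partial>lborel)"
      by (rule nn_integral_nu_weight[OF a, where v="\<lambda>\<rho>. ennreal (\<Phi> 1)
          * ennreal (\<rho> powr (- e))" and w="\<lambda>\<rho>. ennreal (\<Phi> 1) * ennreal (\<rho> powr (\<alpha> - e))"])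
         (auto simp: ennreal_mult[symmetric] powr_add[symmetric] mult.left_commute)
    also have "(\<integral>\<^sup>+z. (ennreal (\<Phi> 1) * ennreal ((1 - (norm z)\<^sup>2) powr (\<alpha> - e)))
        * indicator unit_ball (z :: complex ^ 'n) * 1 \<partial>lborel)
      = (\<integral>\<^sup>+z. ennreal (\<Phi> 1) * ennreal ((1 - (norm z)\<^sup>2) powr (\<alpha> - e) * indicator unit_ball (z :: complex ^ 'n)) \<partial>lborel)"
      by (intro nn_integral_cong) (auto simp: indicator_def)
    also have "\<dots> = ennreal (\<Phi> 1) * ennreal (Gamma (\<alpha> - e + 1) * gauss_integral TYPE('n) / Gamma (real CARD('n)
        + (\<alpha> - e) + 1))"
      by (subst nn_integral_cmult, measurable, subst nn_integral_ball_weight[OF e(2)]) simp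
    also have "ennreal (c_const TYPE('n) \<alpha>) * \<dots> = ennreal T"
    proof -
      have "ennreal x * (ennreal y * ennreal r) = ennreal (x * (y * r))" if "x \<ge> 0" "y \<ge> 0" for x y r
        using that by (simp add: ennreal_mult')
      thus ?thesis unfolding T_def using c_const_pos[OF a, where 'n='n] growth_nonneg[OF gr, of 1] by simp
    qed
    finally show ?thesis .
  qed
  show ?thesis
  proof (intro exI[of _ "C * A + T"] conjI allI impI)
    show "C * A + T \<ge> 0" using C A T0 by simp
    fix g :: "complex ^ 'n \<Rightarrow> complex" assume g [measurable]: "g \<in> borel_measurable (nu \<alpha>)"
      and gA: "(\<integral>\<^sup>+\<xi>. ennreal (norm (g \<xi>)) \<partial>nu \<alpha>) \<le> ennreal A"
    interpret nu: finite_measure "nu \<alpha> :: (complex ^ 'n) measure" by (rule finite_measure_nu[OF a])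
    interpret pair_sigma_finite "nu \<alpha> :: (complex ^ 'n) measure" "nu \<alpha> :: (complex ^ 'n) measure" by unfold_locales
    let ?V = "\<lambda>z :: complex ^ 'n. ennreal (V (1 - (norm z)\<^sup>2))"
    let ?k = "\<lambda>z \<xi> :: complex ^ 'n. ennreal (norm (g \<xi>)) * ennreal (norm (bkern ?s z \<xi>))"
    have "(\<integral>\<^sup>+z. ennreal (\<Phi> (norm (bergman_proj \<alpha> g z))) \<partial>nu \<alpha>)
      \<le> (\<integral>\<^sup>+z. ?V z * (\<integral>\<^sup>+\<xi>. ?k z \<xi> \<partial>nu \<alpha>) + ennreal (\<Phi> ((1 - (norm z)\<^sup>2) powr (- e))) \<partial>nu \<alpha>)"
    proof (rule nn_integral_mono)
      fix z :: "complex ^ 'n" assume "z \<in> space (nu \<alpha>)"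
      hence z: "norm z < 1" and r: "0 < 1 - (norm z)\<^sup>2" "1 - (norm z)\<^sup>2 \<le> 1" by (auto simp: abs_square_less_1)
      let ?u = "norm (bergman_proj \<alpha> g z)"
      have "\<Phi> ?u \<le> ?u * V (1 - (norm z)\<^sup>2) + \<Phi> ((1 - (norm z)\<^sup>2) powr (- e))"
        unfolding V_def using r by (intro class_L_le_tangent[OF \<Phi>]) auto
      hence "ennreal (\<Phi> ?u) \<le> ennreal (?u * V (1 - (norm z)\<^sup>2)) + ennreal (\<Phi> ((1 - (norm z)\<^sup>2) powr (- e)))"
        using V[OF r] growth_nonneg[OF gr, of "(1 - (norm z)\<^sup>2) powr (-
            e)"] by (simp add: ennreal_leI flip: ennreal_plus)
      also have "ennreal (?u * V (1 - (norm z)\<^sup>2)) = ?V z * ennreal ?u"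
        using V[OF r] by (simp add: ennreal_mult mult.commute)
      also have "\<dots> \<le> ?V z * (\<integral>\<^sup>+\<xi>. ?k z \<xi> \<partial>nu \<alpha>)"
        by (intro mult_left_mono norm_bergman_proj_le[OF z]) auto
      finally show "ennreal (\<Phi> ?u) \<le> ?V z * (\<integral>\<^sup>+\<xi>. ?k z \<xi> \<partial>nu \<alpha>) + ennreal (\<Phi> ((1 - (norm z)\<^sup>2) powr (- e)))"
        by (simp add: add_right_mono)
    qed
    also have "\<dots> = (\<integral>\<^sup>+z. ?V z * (\<integral>\<^sup>+\<xi>. ?k z \<xi> \<partial>nu \<alpha>) \<partial>nu \<alpha>)
        + (\<integral>\<^sup>+z. ennreal (\<Phi> ((1 - (norm (z :: complex ^ 'n))\<^sup>2) powr (- e))) \<partial>nu \<alpha>)"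
      by (rule nn_integral_add) measurable
    also have "(\<integral>\<^sup>+z. ?V z * (\<integral>\<^sup>+\<xi>. ?k z \<xi> \<partial>nu \<alpha>) \<partial>nu \<alpha>) = (\<integral>\<^sup>+z. \<integral>\<^sup>+\<xi>. ?V z * ?k z \<xi> \<partial>nu \<alpha> \<partial>nu \<alpha>)"
      by (intro nn_integral_cong nn_integral_cmult[symmetric]) measurable
    also have "\<dots> = (\<integral>\<^sup>+\<xi>. \<integral>\<^sup>+z. ?V z * ?k z \<xi> \<partial>nu \<alpha> \<partial>nu \<alpha>)"
      by (rule Fubini'[symmetric]) measurable
    also have "\<dots> = (\<integral>\<^sup>+\<xi>. ennreal (norm (g \<xi>)) * (\<integral>\<^sup>+z. ?V z * ennreal (norm (bkern ?s z \<xi>)) \<partial>nu \<alpha>) \<partial>nu \<alpha>)"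
    proof (rule nn_integral_cong)
      fix \<xi> :: "complex ^ 'n"
      have "(\<integral>\<^sup>+z. ?V z * ?k z \<xi> \<partial>nu \<alpha>) = (\<integral>\<^sup>+z. ennreal (norm (g \<xi>)) * (?V z * ennreal (norm (bkern ?s z \<xi>))) \<partial>nu \<alpha>)"
        by (intro nn_integral_cong) (simp add: mult.left_commute)
      also have "\<dots> = ennreal (norm (g \<xi>)) * (\<integral>\<^sup>+z. ?V z * ennreal (norm (bkern ?s z \<xi>)) \<partial>nu \<alpha>)"
        by (rule nn_integral_cmult) measurable
      finally show "(\<integral>\<^sup>+z. ?V z * ?k z \<xi> \<partial>nu \<alpha>) = \<dots>" .
    qed
    also have "\<dots> \<le> (\<integral>\<^sup>+\<xi>. ennreal (norm (g \<xi>)) * ennreal C \<partial>nu \<alpha>)"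
      by (intro nn_integral_mono mult_left_mono K) auto
    also have "\<dots> = (\<integral>\<^sup>+\<xi>. ennreal (norm (g \<xi>)) \<partial>nu \<alpha>) * ennreal C"
      by (rule nn_integral_multc) measurable
    also have "\<dots> \<le> ennreal A * ennreal C"
      by (intro mult_right_mono gA) auto
    finally have "(\<integral>\<^sup>+z. ennreal (\<Phi> (norm (bergman_proj \<alpha> g z))) \<partial>nu \<alpha>) \<le> ennreal A * ennreal C + ennreal T"
      using Tint by (meson add_mono order.trans order.refl)
    thus "(\<integral>\<^sup>+z. ennreal (\<Phi> (norm (bergman_proj \<alpha> g z))) \<partial>nu \<alpha>) \<le> ennreal (C * A + T)"
      using A C T0 by (simp add: ennreal_mult mult.commute)
  qed
qed

text \<open>For every \<open>l\<close> admissible for \<open>f\<close>, Young's inequality bounds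
  the integral norm of the scaled product by a constant depending on \<open>b\<close> alone; the
  modular bound on its projection then makes \<open>c * l\<close> admissible for the image.\<close>

lemma hankel_bounded_if_symbol:
  fixes b :: "complex ^ 'n \<Rightarrow> complex"
  assumes a: "\<alpha> > -1" and \<Phi>2: "\<Phi>2 \<in> class_L p" and p: "p > 0"
    and fin: "(\<integral>\<^sup>+ t\<in>{1..}. ennreal (\<Phi>2 t / t\<^sup>2) \<partial>lborel) < \<infinity>"
    and \<Phi>1: "lower_type_gt_1 \<Phi>1 \<eta>"
    and b: "b \<in> bergman_orlicz \<alpha> (complementary \<Phi>1)"
  shows "hankel_extends_bounded \<alpha> \<Phi>1 \<Phi>2 b"
proof -
  interpret lower_type_gt_1 \<Phi>1 \<eta> by (rule \<Phi>1)
  have hb: "holomorphic_Cn b unit_ball" and bfin: "(\<integral>\<^sup>+z. ennreal (complementary \<Phi>1 (norm (b z))) \<partial>nu \<alpha>) < \<infinity>"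
    using b by (auto simp: bergman_orlicz_def)
  have [measurable]: "b \<in> borel_measurable (nu \<alpha>)" by (rule holomorphic_Cn_measurable[OF hb])
  \<comment> \<open>The summand 1 is the bound on the \<Phi>1-modular of f / l.\<close>
  define A where "A = enn2real (\<integral>\<^sup>+z. ennreal (complementary \<Phi>1 (norm (b z))) \<partial>nu \<alpha>) + 1"
  have A: "A \<ge> 0" by (simp add: A_def)
  obtain M where M: "M \<ge> 0" "\<And>g :: complex ^ 'n \<Rightarrow> complex. g \<in> borel_measurable (nu \<alpha>) \<Longrightarrow>
    (\<integral>\<^sup>+\<xi>. ennreal (norm (g \<xi>)) \<partial>nu \<alpha>) \<le> ennreal A \<Longrightarrow>
    (\<integral>\<^sup>+z. ennreal (\<Phi>2 (norm (bergman_proj \<alpha> g z))) \<partial>nu \<alpha>) \<le> ennreal M"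
    using bergman_proj_L1_bound[OF \<Phi>2 a fin A, where 'n='n] by blast
  obtain C where C: "C > 0" "\<And>u c. u \<ge> 0 \<Longrightarrow> c \<ge> 1 \<Longrightarrow> \<Phi>2 (u / c) \<le> C * c powr (- p) * \<Phi>2 u"
    using class_L_lower_type[OF \<Phi>2] by blast
  have gr2: "growth_function \<Phi>2" using \<Phi>2 by (simp add: class_L_def)
  \<comment> \<open>Dividing the argument by \<open>c\<close> gains the factor C c^(-p) from the
    lower type, which has to bring the modular \<open>M\<close> down to 1.\<close>
  define c where "c = max 1 ((C * M) powr (1 / p))"
  have c: "c \<ge> 1" by (simp add: c_def)
  have cM: "C * c powr (- p) * M \<le> 1"
  proof -
    have "C * M = ((C * M) powr (1 / p)) powr p" using C M p by (simp add: powr_powr)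
    also have "\<dots> \<le> c powr p" using p by (intro powr_mono2) (auto simp: c_def)
    finally show ?thesis using c by (simp add: powr_minus field_simps)
  qed
  have key: "lux_norm \<alpha> \<Phi>2 (small_hankel \<alpha> b f) \<le> ennreal c * ennreal l"
    if f: "f \<in> bounded_holomorphic" and l: "l > 0" "(\<integral>\<^sup>+ z. ennreal (\<Phi>1 (norm (f z) / l)) \<partial>nu \<alpha>) \<le> 1" for f l
  proof -
    have [measurable]: "f \<in> borel_measurable (nu \<alpha>)"
      using f by (auto simp: bounded_holomorphic_def intro: holomorphic_Cn_measurable)
    have [measurable]: "(\<lambda>z. \<Phi>1 (norm (f z) / l)) \<in> borel_measurable (nu \<alpha>)"
      using l by (intro growth_measurable[OF growth]) auto
    define g where "g \<xi> = b \<xi> * cnj (f \<xi>) / of_real l" for \<xi>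
    have [measurable]: "g \<in> borel_measurable (nu \<alpha>)" unfolding g_def by measurable
    have "(\<integral>\<^sup>+\<xi>. ennreal (norm (g \<xi>)) \<partial>nu \<alpha>) \<le> (\<integral>\<^sup>+\<xi>. ennreal (\<Phi>1 (norm (f \<xi>) / l))
        + ennreal (complementary \<Phi>1 (norm (b \<xi>))) \<partial>nu \<alpha>)"
    proof (rule nn_integral_mono)
      fix \<xi>
      have "norm (g \<xi>) = norm (f \<xi>) / l * norm (b \<xi>)" using l by (simp add: g_def norm_mult norm_divide)
      also have "\<dots> \<le> \<Phi>1 (norm (f \<xi>) / l) + complementary \<Phi>1 (norm (b \<xi>))" using l by (intro Young) auto
      finally show "ennreal (norm (g \<xi>)) \<le> ennreal (\<Phi>1 (norm (f \<xi>) / l)) + ennreal (complementary \<Phi>1 (norm (b \<xi>)))"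
        using l growth_nonneg[OF growth, of "norm (f \<xi>) /
            l"] by (simp add: ennreal_leI complementary_nonneg flip: ennreal_plus)
    qed
    also have "\<dots> = (\<integral>\<^sup>+\<xi>. ennreal (\<Phi>1 (norm (f \<xi>) / l)) \<partial>nu \<alpha>) + (\<integral>\<^sup>+\<xi>. ennreal (complementary \<Phi>1 (norm (b \<xi>)))
        \<partial>nu \<alpha>)"
      by (rule nn_integral_add) measurable
    also have "\<dots> \<le> 1 + (\<integral>\<^sup>+\<xi>. ennreal (complementary \<Phi>1 (norm (b \<xi>))) \<partial>nu \<alpha>)" using l by (intro add_right_mono) auto
    also have "\<dots> = ennreal A" using bfin unfolding A_def by (simp add: add.commute)
    finally have gM: "(\<integral>\<^sup>+z. ennreal (\<Phi>2 (norm (bergman_proj \<alpha> g z))) \<partial>nu \<alpha>)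
        \<le> ennreal M" by (rule M(2)[rotated]) measurable
    have "(\<integral>\<^sup>+z. ennreal (\<Phi>2 (norm (small_hankel \<alpha> b f z) / (c * l))) \<partial>nu \<alpha>)
        \<le> (\<integral>\<^sup>+z. ennreal (C * c powr (- p)) * ennreal (\<Phi>2 (norm (bergman_proj \<alpha> g z))) \<partial>nu \<alpha>)"
    proof (rule nn_integral_mono)
      fix z :: "complex ^ 'n"
      have "small_hankel \<alpha> b f z = of_real l * bergman_proj \<alpha> g z"
        unfolding small_hankel_def bergman_proj_def g_def using l
        by (subst integral_mult_right_zero[symmetric]) (simp add: field_simps)
      hence "norm (small_hankel \<alpha> b f z) / (c * l) = norm (bergman_proj \<alpha> g z) / c" using l c by (simp add: norm_mult)
      thus "ennreal (\<Phi>2 (norm (small_hankel \<alpha> b f z) / (c * l)))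
          \<le> ennreal (C * c powr (- p)) * ennreal (\<Phi>2 (norm (bergman_proj \<alpha> g z)))"
        using C(2)[OF norm_ge_zero c, of "bergman_proj \<alpha> g z"] C(1) growth_nonneg[OF gr2, of "norm (bergman_proj
            \<alpha> g z)"]
        by (simp add: ennreal_leI flip: ennreal_mult)
    qed
    also have "\<dots> \<le> ennreal (C * c powr (- p)) * ennreal M"
    proof -
      have "(\<integral>\<^sup>+z. ennreal (C * c powr (- p)) * ennreal (\<Phi>2 (norm (bergman_proj \<alpha> g z))) \<partial>nu \<alpha>)
        = ennreal (C * c powr (- p)) * (\<integral>\<^sup>+z. ennreal (\<Phi>2 (norm (bergman_proj \<alpha> g z))) \<partial>nu \<alpha>)"
      proof -
        have [measurable]: "bergman_proj \<alpha> g \<in> borel_measurable (nu \<alpha>)"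
          by (rule measurable_bergman_proj[OF a]) measurable
        have "(\<lambda>z. \<Phi>2 (norm (bergman_proj \<alpha> g z))) \<in> borel_measurable (nu \<alpha>)"
          by (rule growth_measurable[OF gr2]) auto
        from measurable_compose[OF this measurable_ennreal] show ?thesis
          by (rule nn_integral_cmult)
      qed
      thus ?thesis using gM by (simp add: mult_left_mono)
    qed
    also have "\<dots> \<le> 1" using cM C M by (simp add: ennreal_le_1 flip: ennreal_mult)
    finally have le1: "(\<integral>\<^sup>+z. ennreal (\<Phi>2 (norm (small_hankel \<alpha> b f z) / (c * l))) \<partial>nu \<alpha>) \<le> 1" .
    have "lux_norm \<alpha> \<Phi>2 (small_hankel \<alpha> b f) \<le> ennreal (c * l)"
      unfolding lux_norm_def by (rule Inf_lower) (use le1 c l in auto)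
    thus ?thesis using c l by (simp add: ennreal_mult)
  qed
  show ?thesis
    unfolding hankel_extends_bounded_def
  proof (intro exI[of _ c] ballI)
    fix f :: "complex ^ 'n \<Rightarrow> complex" assume f: "f \<in> bounded_holomorphic"
    let ?X = "lux_norm \<alpha> \<Phi>2 (small_hankel \<alpha> b f)"
    have cc: "ennreal (1 / c) * ennreal c = 1" using c by (simp flip: ennreal_mult)
    \<comment> \<open>With the constant on the left, only a lower bound for the infimum is needed;
      this includes an empty set of admissible values, where the infimum is infinite.\<close>
    have "ennreal (1 / c) * ?X \<le> lux_norm \<alpha> \<Phi>1 f"
      unfolding lux_norm_def[of \<alpha> \<Phi>1]
    proof (rule Inf_greatest)
      fix x assume "x \<in> {ennreal l |l. l > 0 \<and> (\<integral>\<^sup>+ z. ennreal (\<Phi>1 (norm (f z) / l)) \<partial>nu \<alpha>) \<le> 1}"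
      hence "?X \<le> ennreal c * x" using key[OF f] by auto
      hence "ennreal (1 / c) * ?X \<le> ennreal (1 / c) * (ennreal c * x)" by (rule mult_left_mono) simp
      thus "ennreal (1 / c) * ?X \<le> x" by (simp only: mult.assoc[symmetric] cc mult_1)
    qed
    hence "ennreal c * (ennreal (1 / c) * ?X) \<le> ennreal c * lux_norm \<alpha> \<Phi>1 f" by (rule mult_left_mono) simp
    thus "lux_norm \<alpha> \<Phi>2 (small_hankel \<alpha> b f) \<le> ennreal c * lux_norm \<alpha> \<Phi>1 f"
      using cc by (simp add: mult.assoc[symmetric] mult.commute[of "ennreal c"])
  qed
qed

section \<open>The Bergman projection on Orlicz spaces\<close>

text \<open>After Fubini, the weight with exponent \<delta> cancels exactly the growth of the kernel
  integral in \<xi>.\<close>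

lemma Schur_weight:
  assumes a: "\<alpha> > -1" and \<delta>: "0 < \<delta>" "\<delta> < 1 + \<alpha>"
  shows "\<exists>C\<ge>0. \<forall>G :: complex ^ 'n \<Rightarrow> ennreal. G \<in> borel_measurable (nu \<alpha>) \<longrightarrow>
    (\<integral>\<^sup>+z. \<integral>\<^sup>+\<xi>. (G \<xi> * ennreal ((1 - (norm \<xi>)\<^sup>2) powr \<delta>)) *
        (ennreal ((1 - (norm z)\<^sup>2) powr (- \<delta>)) * ennreal (norm (bkern (real CARD('n) + 1 + \<alpha>) z \<xi>))) \<partial>nu \<alpha> \<partial>nu \<alpha>)
    \<le> ennreal C * (\<integral>\<^sup>+\<xi>. G \<xi> \<partial>nu \<alpha>)"
proof -
  let ?s = "real CARD('n) + 1 + \<alpha>"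
  obtain C where C: "C \<ge> 0" and K: "\<And>\<xi> :: complex ^ 'n. norm \<xi> < 1 \<Longrightarrow>
    (\<integral>\<^sup>+z. ennreal ((1 - (norm z)\<^sup>2) powr (- \<delta>)) * ennreal (norm (bkern ?s z \<xi>)) \<partial>nu \<alpha>)
    \<le> ennreal (C * (1 - (norm \<xi>)\<^sup>2) powr (- \<delta>))"
    using Forelli_Rudin[OF a \<delta>, where 'n='n] by blast
  show ?thesis
  proof (intro exI[of _ C] conjI allI impI C)
    fix G :: "complex ^ 'n \<Rightarrow> ennreal" assume [measurable]: "G \<in> borel_measurable (nu \<alpha>)"
    interpret nu: finite_measure "nu \<alpha> :: (complex ^ 'n) measure" by (rule finite_measure_nu[OF a])
    interpret pair_sigma_finite "nu \<alpha> :: (complex ^ 'n) measure" "nu \<alpha> :: (complex ^ 'n) measure" by unfold_locales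
    let ?H = "\<lambda>z :: complex ^ 'n. 1 - (norm z)\<^sup>2"
    have "(\<integral>\<^sup>+z. \<integral>\<^sup>+\<xi>. (G \<xi> * ennreal (?H \<xi> powr \<delta>)) * (ennreal (?H z powr (- \<delta>))
        * ennreal (norm (bkern ?s z \<xi>))) \<partial>nu \<alpha> \<partial>nu \<alpha>)
      = (\<integral>\<^sup>+\<xi>. \<integral>\<^sup>+z. (G \<xi> * ennreal (?H \<xi> powr \<delta>)) * (ennreal (?H z powr (- \<delta>)) * ennreal (norm (bkern ?s z \<xi>))) \<partial>nu \<alpha> \<partial>nu \<alpha>)"
      by (rule Fubini'[symmetric]) measurable
    also have "\<dots> = (\<integral>\<^sup>+\<xi>. (G \<xi> * ennreal (?H \<xi> powr \<delta>)) * (\<integral>\<^sup>+z. ennreal (?H z powr (- \<delta>))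
        * ennreal (norm (bkern ?s z \<xi>)) \<partial>nu \<alpha>) \<partial>nu \<alpha>)"
      by (intro nn_integral_cong nn_integral_cmult) measurable
    also have "\<dots> \<le> (\<integral>\<^sup>+\<xi>. ennreal C * G \<xi> \<partial>nu \<alpha>)"
    proof (rule nn_integral_mono)
      fix \<xi> :: "complex ^ 'n" assume "\<xi> \<in> space (nu \<alpha>)"
      hence \<xi>: "norm \<xi> < 1" by simp
      hence H: "?H \<xi> > 0" by (simp add: abs_square_less_1)
      have "(G \<xi> * ennreal (?H \<xi> powr \<delta>)) * (\<integral>\<^sup>+z. ennreal (?H z powr (- \<delta>)) * ennreal (norm (bkern ?s z \<xi>)) \<partial>nu \<alpha>)
          \<le> (G \<xi> * ennreal (?H \<xi> powr \<delta>)) * ennreal (C * ?H \<xi> powr (- \<delta>))"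
        by (intro mult_left_mono K \<xi>) auto
      also have "\<dots> = G \<xi> * ennreal (?H \<xi> powr \<delta> * (C * ?H \<xi> powr (- \<delta>)))"
        using C by (simp only: mult.assoc) (subst ennreal_mult, auto)
      also have "?H \<xi> powr \<delta> * (C * ?H \<xi> powr (- \<delta>)) = C" using H by (simp add: powr_minus)
      finally show "(G \<xi> * ennreal (?H \<xi> powr \<delta>)) * (\<integral>\<^sup>+z. ennreal (?H z powr (- \<delta>))
          * ennreal (norm (bkern ?s z \<xi>)) \<partial>nu \<alpha>) \<le> ennreal C * G \<xi>"
        by (simp add: mult.commute)
    qed
    also have "\<dots> = ennreal C * (\<integral>\<^sup>+\<xi>. G \<xi> \<partial>nu \<alpha>)" by (rule nn_integral_cmult) measurable
    finally show "(\<integral>\<^sup>+z. \<integral>\<^sup>+\<xi>. (G \<xi> * ennreal (?H \<xi> powr \<delta>)) * (ennreal (?H z powr (- \<delta>))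
        * ennreal (norm (bkern ?s z \<xi>))) \<partial>nu \<alpha> \<partial>nu \<alpha>)
      \<le> ennreal C * (\<integral>\<^sup>+\<xi>. G \<xi> \<partial>nu \<alpha>)" .
  qed
qed

text \<open>The upper exponent is written as 1 + r because only the excess over 1 survives the
  division by the Jensen density; both excesses must be positive to serve as exponents in
  \<open>Schur_weight\<close>. The value used later is r = q.\<close>

locale convex_growth = lower_type_gt_1 +
  fixes r :: real
  assumes r_pos: "r > 0"
    and upper: "\<exists>C\<ge>0. \<forall>u t. 1 \<le> u \<longrightarrow> 0 \<le> t \<longrightarrow> \<Phi> (u * t) \<le> C * u powr (1 + r) * \<Phi> t"
    and tangent: "\<And>y. y > 0 \<Longrightarrow> \<exists>m. \<forall>x\<ge>0. \<Phi> y + m * (x - y) \<le> \<Phi> x"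
begin

text \<open>Lower type for v \<le> 1, upper type for v \<ge> 1; the sum of powers avoids splitting
  the ball according to the size of the ratio.\<close>

lemma growth_ratio_bound:
  "\<exists>C\<ge>0. \<forall>v t. 0 < v \<longrightarrow> 0 \<le> t \<longrightarrow> \<Phi> (v * t) \<le> C * (v powr (1 + \<eta>) + v powr (1 + r)) * \<Phi> t"
proof -
  obtain C where C: "C \<ge> 0" "\<And>u t. 1 \<le> u \<Longrightarrow> 0 \<le> t \<Longrightarrow> \<Phi> (u * t) \<le> C * u powr (1 + r) * \<Phi> t"
    using upper by blast
  have "\<Phi> (v * t) \<le> (2 + C) * (v powr (1 + \<eta>) + v powr (1 + r)) * \<Phi> t" if "0 < v" "0 \<le> t" for v t
  proof -
    have n: "\<Phi> t \<ge> 0" using growth_nonneg[OF growth] that by simp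
    have "\<Phi> (v * t) \<le> (2 * v powr (1 + \<eta>) + C * v powr (1 + r)) * \<Phi> t"
    proof (cases "v \<le> 1")
      case True
      have "\<Phi> (v * t) \<le> 2 * v powr (1 + \<eta>) * \<Phi> t" using lower True that by simp
      moreover have "C * v powr (1 + r) * \<Phi> t \<ge> 0" using C n by simp
      ultimately show ?thesis by (simp add: distrib_right)
    next
      case False
      hence "\<Phi> (v * t) \<le> C * v powr (1 + r) * \<Phi> t" using C(2) that by simp
      moreover have "2 * v powr (1 + \<eta>) * \<Phi> t \<ge> 0" using n by simp
      ultimately show ?thesis unfolding distrib_right by linarith
    qed
    also have "\<dots> \<le> (2 + C) * (v powr (1 + \<eta>) + v powr (1 + r)) * \<Phi> t"
      using C n by (intro mult_right_mono) (auto simp: algebra_simps)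
    finally show ?thesis .
  qed
  thus ?thesis using C(1) by (intro exI[of _ "2 + C"]) auto
qed

text \<open>The supporting line at the mean \<open>y\<close> is integrated against \<open>k\<close>.
  Its negative intercept is moved to the other side so that all terms remain nonnegative.\<close>

lemma Jensen_subprobability:
  fixes k :: "'a \<Rightarrow> ennreal" and F :: "'a \<Rightarrow> real"
  assumes [measurable]: "k \<in> borel_measurable M" "F \<in> borel_measurable M"
    and k: "(\<integral>\<^sup>+x. k x \<partial>M) \<le> 1" and F: "\<And>x. x \<in> space M \<Longrightarrow> F x \<ge> 0"
    and y: "(\<integral>\<^sup>+x. ennreal (F x) * k x \<partial>M) = ennreal y" "y \<ge> 0"
  shows "ennreal (\<Phi> y) \<le> (\<integral>\<^sup>+x. ennreal (\<Phi> (F x)) * k x \<partial>M)"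
proof (cases "y = 0")
  case True thus ?thesis using growth by simp
next
  case False
  hence y0: "y > 0" using y by simp
  obtain m where m: "\<And>x. x \<ge> 0 \<Longrightarrow> \<Phi> y + m * (x - y) \<le> \<Phi> x" using tangent[OF y0] by blast
  \<comment> \<open>The line lies below \<Phi> 0 = 0 at the origin. This sign of the intercept is
    what permits total mass below 1.\<close>
  have d: "m * y - \<Phi> y \<ge> 0" using m[of 0] growth by simp
  have "m * y \<ge> 0" using d growth_nonneg[OF growth y(2)] by linarith
  hence m0: "m \<ge> 0" using y0 by (simp add: zero_le_mult_iff)
  have [measurable]: "(\<lambda>x. \<Phi> (F x)) \<in> borel_measurable M" by (rule growth_measurable[OF growth _ F]) auto
  let ?X = "\<integral>\<^sup>+x. ennreal (\<Phi> (F x)) * k x \<partial>M"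
  have "ennreal (m * y) = ennreal m * (\<integral>\<^sup>+x. ennreal (F x) * k x \<partial>M)"
    using m0 y by (simp add: ennreal_mult)
  also have "\<dots> = (\<integral>\<^sup>+x. ennreal m * (ennreal (F x) * k x) \<partial>M)"
    by (rule nn_integral_cmult[symmetric]) measurable
  also have "\<dots> \<le> (\<integral>\<^sup>+x. ennreal (\<Phi> (F x)) * k x + ennreal (m * y - \<Phi> y) * k x \<partial>M)"
  proof (rule nn_integral_mono)
    fix x assume x: "x \<in> space M"
    have "ennreal (m * F x) \<le> ennreal (\<Phi> (F x)) + ennreal (m * y - \<Phi> y)"
      using m[OF F[OF x]] d growth_nonneg[OF growth F[OF x]] by (simp add: ennreal_leI algebra_simps flip: ennreal_plus)
    hence "ennreal (m * F x) * k x \<le> (ennreal (\<Phi> (F x)) + ennreal (m * y - \<Phi> y)) * k x" by (rule mult_right_mono) simp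
    thus "ennreal m * (ennreal (F x) * k x) \<le> ennreal (\<Phi> (F x)) * k x + ennreal (m * y - \<Phi> y) * k x"
      using m0 F[OF x] by (simp add: ennreal_mult mult.assoc distrib_right)
  qed
  also have "\<dots> = ?X + ennreal (m * y - \<Phi> y) * (\<integral>\<^sup>+x. k x \<partial>M)"
    by (subst nn_integral_add, measurable, subst nn_integral_cmult) auto
  also have "\<dots> \<le> ?X + ennreal (m * y - \<Phi> y) * 1"
    by (intro add_left_mono mult_left_mono k) auto
  finally have le: "ennreal (m * y) \<le> ?X + ennreal (m * y - \<Phi> y)" by simp
  show ?thesis
  proof (cases ?X)
    case (real x)
    have "ennreal (m * y) \<le> ennreal (x + (m * y - \<Phi> y))" using le real d by simp
    hence "m * y \<le> x + (m * y - \<Phi> y)" using real d by (subst (asm) ennreal_le_iff) auto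
    thus ?thesis using real by (simp add: ennreal_leI)
  qed simp
qed

text \<open>A Schur test for Orlicz spaces: Jensen's inequality for the sub-probability measure with density
  proportional to \<open>h \<xi> * |K (z, \<xi>)|\<close>, \<open>h \<xi> = (1 - |\<xi>|\<^sup>2) powr (- e)\<close>.\<close>

lemma bergman_proj_Orlicz_bound:
  assumes a: "\<alpha> > -1"
  shows "\<exists>D\<ge>0. \<forall>g :: complex ^ 'n \<Rightarrow> complex. g \<in> borel_measurable (nu \<alpha>) \<longrightarrow> bounded (g ` unit_ball) \<longrightarrow>
    (\<integral>\<^sup>+z. ennreal (\<Phi> (norm (bergman_proj \<alpha> g z))) \<partial>nu \<alpha>) \<le> ennreal D * (\<integral>\<^sup>+\<xi>. ennreal (\<Phi> (norm (g \<xi>))) \<partial>nu \<alpha>)"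
proof -
  let ?s = "real CARD('n) + 1 + \<alpha>"
  let ?H = "\<lambda>z :: complex ^ 'n. 1 - (norm z)\<^sup>2"
  let ?K = "\<lambda>z \<xi> :: complex ^ 'n. norm (bkern ?s z \<xi>)"
  have s: "?s \<ge> 0" using a by (simp add: add_nonneg_nonneg add.assoc)
  \<comment> \<open>Chosen so small that \<open>e\<close>, e \<eta> and e r all lie below 1 +
    \<alpha>, the range of the kernel estimate.\<close>
  define e where "e = (1 + \<alpha>) / (2 * (1 + \<eta> + r))"
  have den: "1 + \<eta> + r > 0" using eta_pos r_pos by simp
  have e0: "e > 0" using a den by (simp add: e_def)
  have esmall: "e * x < 1 + \<alpha>" if "0 \<le> x" "x \<le> 1 + \<eta> + r" for x
  proof -
    have "e * x \<le> e * (1 + \<eta> + r)" using e0 that by (intro mult_left_mono) auto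
    also have "\<dots> = (1 + \<alpha>) / 2"
    proof -
      have "a / (2 * d) * d = a / 2" if "d > 0" for a d :: real using that by simp
      thus ?thesis unfolding e_def using den by blast
    qed
    also have "\<dots> < 1 + \<alpha>" using a by simp
    finally show ?thesis .
  qed
  obtain A0 where A0: "A0 \<ge> 0" and FR: "\<And>\<xi> :: complex ^ 'n. norm \<xi> < 1 \<Longrightarrow>
      (\<integral>\<^sup>+z. ennreal (?H z powr (- e)) * ennreal (?K z \<xi>) \<partial>nu \<alpha>) \<le> ennreal (A0 * ?H \<xi> powr (- e))"
    using Forelli_Rudin[OF a e0, where 'n='n] esmall[of 1] eta_pos r_pos by auto
  define A where "A = A0 + 1"
  have A: "A \<ge> 1" "A0 \<le> A" using A0 by (auto simp: A_def)
  obtain C1 where C1: "C1 \<ge> 0" and S1: "\<And>G :: complex ^ 'n \<Rightarrow> ennreal. G \<in> borel_measurable (nu \<alpha>) \<Longrightarrow>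
    (\<integral>\<^sup>+z. \<integral>\<^sup>+\<xi>. (G \<xi> * ennreal (?H \<xi> powr (e * \<eta>))) * (ennreal (?H z powr (- (e * \<eta>))) * ennreal (?K z \<xi>)) \<partial>nu \<alpha> \<partial>nu \<alpha>)
    \<le> ennreal C1 * (\<integral>\<^sup>+\<xi>. G \<xi> \<partial>nu \<alpha>)"
    using Schur_weight[OF a, of "e * \<eta>", where 'n='n] esmall[of \<eta>] e0 eta_pos r_pos by auto
  obtain C2 where C2: "C2 \<ge> 0" and S2: "\<And>G :: complex ^ 'n \<Rightarrow> ennreal. G \<in> borel_measurable (nu \<alpha>) \<Longrightarrow>
    (\<integral>\<^sup>+z. \<integral>\<^sup>+\<xi>. (G \<xi> * ennreal (?H \<xi> powr (e * r))) * (ennreal (?H z powr (- (e * r))) * ennreal (?K z \<xi>)) \<partial>nu \<alpha> \<partial>nu \<alpha>)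
    \<le> ennreal C2 * (\<integral>\<^sup>+\<xi>. G \<xi> \<partial>nu \<alpha>)"
    using Schur_weight[OF a, of "e * r", where 'n='n] esmall[of r] e0 eta_pos r_pos by auto
  obtain C where C: "C \<ge> 0" "\<And>v t. 0 < v \<Longrightarrow> 0 \<le> t \<Longrightarrow> \<Phi> (v * t) \<le> C * (v powr (1 + \<eta>) + v powr (1 + r)) * \<Phi> t"
    using growth_ratio_bound by blast
  define D where "D = C1 * (C * A powr \<eta>) + C2 * (C * A powr r)"
  show ?thesis
  proof (intro exI[of _ D] conjI allI impI)
    show "D \<ge> 0" using C C1 C2 by (simp add: D_def)
    fix g :: "complex ^ 'n \<Rightarrow> complex"
    assume [measurable]: "g \<in> borel_measurable (nu \<alpha>)" and bg: "bounded (g ` unit_ball)"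
    obtain B where B: "\<And>\<xi>. norm \<xi> < 1 \<Longrightarrow> norm (g \<xi>) \<le> B" using bg unfolding bounded_iff by (meson imageI mem_ball_0)
    have B0: "B \<ge> 0" using order.trans[OF norm_ge_zero B[of 0]] by simp
    have [measurable]: "(\<lambda>\<xi>. \<Phi> (norm (g \<xi>))) \<in> borel_measurable (nu \<alpha>)" by (rule growth_measurable[OF growth]) auto
    let ?G1 = "\<lambda>\<xi>. ennreal (C * A powr \<eta>) * ennreal (\<Phi> (norm (g \<xi>)))"
    let ?G2 = "\<lambda>\<xi>. ennreal (C * A powr r) * ennreal (\<Phi> (norm (g \<xi>)))"
    let ?T1 = "\<lambda>z \<xi>. (?G1 \<xi> * ennreal (?H \<xi> powr (e * \<eta>))) * (ennreal (?H z powr (- (e * \<eta>))) * ennreal (?K z \<xi>))"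
    let ?T2 = "\<lambda>z \<xi>. (?G2 \<xi> * ennreal (?H \<xi> powr (e * r))) * (ennreal (?H z powr (- (e * r))) * ennreal (?K z \<xi>))"
    interpret nu: finite_measure "nu \<alpha> :: (complex ^ 'n) measure" by (rule finite_measure_nu[OF a])
    have pt: "ennreal (\<Phi> (norm (bergman_proj \<alpha> g z))) \<le> (\<integral>\<^sup>+\<xi>. ?T1 z \<xi> + ?T2 z \<xi> \<partial>nu \<alpha>)" if z: "norm z < 1" for z
    proof -
      have Hz: "?H z > 0" using z by (simp add: abs_square_less_1)
      define u where "u = (\<integral>\<^sup>+\<xi>. ennreal (norm (g \<xi>)) * ennreal (?K z \<xi>) \<partial>nu \<alpha>)"
      \<comment> \<open>Boundedness of \<open>g\<close> makes \<open>u\<close> finite, so that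
        Jensen's inequality can be applied at a real mean; the bound \<open>B\<close> does not enter
        the final constant.\<close>
      have "u \<le> (\<integral>\<^sup>+\<xi>. ennreal B * ennreal ((1 - norm z) powr (- ?s)) \<partial>(nu \<alpha> :: (complex ^ 'n) measure))"
        unfolding u_def
      proof (intro nn_integral_mono mult_mono ennreal_leI)
        fix \<xi> :: "complex ^ 'n" assume "\<xi> \<in> space (nu \<alpha>)"
        hence \<xi>: "norm \<xi> < 1" by simp
        show "norm (g \<xi>) \<le> B" by (rule B[OF \<xi>])
        show "?K z \<xi> \<le> (1 - norm z) powr (- ?s)"
          using z \<xi> s by (intro norm_bkern_le) (auto simp: mult_left_le)
      qed auto
      also have "\<dots> < \<infinity>" by (simp add: prob_nu[OF a] ennreal_mult_less_top)
      finally have u_fin: "u < \<infinity>" .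
      define y where "y = enn2real u"
      have y: "u = ennreal y" "y \<ge> 0" using u_fin by (auto simp: y_def)
      \<comment> \<open>The integrand |g| |K| is split as (v |g|) (|K| / v). The factor in
        \<open>z\<close> normalises the density \<open>?k\<close>, and \<open>A\<close> bounds its
        total mass by 1.\<close>
      let ?v = "\<lambda>\<xi>. A * ?H z powr (- e) * ?H \<xi> powr e"
      let ?k = "\<lambda>\<xi>. ennreal (1 / (A * ?H z powr (- e))) * (ennreal (?H \<xi> powr (- e)) * ennreal (?K \<xi> z))"
      have v0: "?v \<xi> > 0" if "norm \<xi> < 1" for \<xi>
      proof -
        have "?H \<xi> > 0" using that by (simp add: abs_square_less_1)
        hence "?H \<xi> powr e > 0" "?H z powr (- e) > 0" using Hz by (simp_all only: powr_gt_zero)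
        thus ?thesis using A by simp
      qed
      have kv: "?k \<xi> = ennreal (?K z \<xi> / ?v \<xi>)" if "norm \<xi> < 1" for \<xi>
      proof -
        have "?k \<xi> = ennreal (1 / (A * ?H z powr (- e)) * (?H \<xi> powr (- e) * ?K \<xi> z))"
          using A by (subst ennreal_mult, simp, simp, subst ennreal_mult) simp_all
        also have "1 / (A * ?H z powr (- e)) * (?H \<xi> powr (- e) * ?K \<xi> z) = ?K z \<xi> / ?v \<xi>"
          using that by (simp add: powr_minus norm_bkern_commute[of _ \<xi> z] field_simps)
        finally show ?thesis .
      qed
      have k1: "(\<integral>\<^sup>+\<xi>. ?k \<xi> \<partial>nu \<alpha>) \<le> 1"
      proof -
        have "(\<integral>\<^sup>+\<xi>. ?k \<xi> \<partial>nu \<alpha>) = ennreal (1 / (A * ?H z powr (- e))) * (\<integral>\<^sup>+\<xi>. ennreal (?H \<xi> powr (- e))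
            * ennreal (?K \<xi> z) \<partial>nu \<alpha>)"
          by (rule nn_integral_cmult) measurable
        also have "\<dots> \<le> ennreal (1 / (A * ?H z powr (- e))) * ennreal (A * ?H z powr (- e))"
          using A by (intro mult_left_mono order.trans[OF FR[OF z]] ennreal_leI mult_right_mono) auto
        also have "\<dots> = 1" using A Hz by (simp flip: ennreal_mult)
        finally show ?thesis .
      qed
      have Fk: "(\<integral>\<^sup>+\<xi>. ennreal (?v \<xi> * norm (g \<xi>)) * ?k \<xi> \<partial>nu \<alpha>) = ennreal y"
      proof -
        have "(\<integral>\<^sup>+\<xi>. ennreal (?v \<xi> * norm (g \<xi>)) * ?k \<xi> \<partial>nu \<alpha>) = u"
          unfolding u_def
        proof (rule nn_integral_cong)
          fix \<xi> :: "complex ^ 'n" assume "\<xi> \<in> space (nu \<alpha>)"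
          hence \<xi>: "norm \<xi> < 1" by simp
          have "?v \<xi> * norm (g \<xi>) * (?K z \<xi> / ?v \<xi>) = norm (g \<xi>) * ?K z \<xi>"
          proof -
            have "V * G * (k / V) = G * k" if "V > 0" for V G k :: real using that by simp
            thus ?thesis using v0[OF \<xi>] by blast
          qed
          thus "ennreal (?v \<xi> * norm (g \<xi>)) * ?k \<xi> = ennreal (norm (g \<xi>)) * ennreal (?K z \<xi>)"
            unfolding kv[OF \<xi>] using v0[OF \<xi>]
            by (subst ennreal_mult[symmetric], simp, simp, subst ennreal_mult[symmetric]) simp_all
        qed
        thus ?thesis using y by simp
      qed
      have "ennreal (norm (bergman_proj \<alpha> g z)) \<le> ennreal y"
        using norm_bergman_proj_le[OF z, of \<alpha> g] y unfolding u_def by simp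
      hence "norm (bergman_proj \<alpha> g z) \<le> y" using y by (subst (asm) ennreal_le_iff) auto
      hence "ennreal (\<Phi> (norm (bergman_proj \<alpha> g z))) \<le> ennreal (\<Phi> y)"
        by (intro ennreal_leI growth_mono[OF growth]) auto
      also have "\<dots> \<le> (\<integral>\<^sup>+\<xi>. ennreal (\<Phi> (?v \<xi> * norm (g \<xi>))) * ?k \<xi> \<partial>nu \<alpha>)"
      proof (rule Jensen_subprobability[OF _ _ k1 _ Fk y(2)])
        fix \<xi> :: "complex ^ 'n" assume "\<xi> \<in> space (nu \<alpha>)"
        hence "norm \<xi> < 1" by simp
        thus "?v \<xi> * norm (g \<xi>) \<ge> 0" using v0[of \<xi>] by simp
      qed measurable
      also have "\<dots> \<le> (\<integral>\<^sup>+\<xi>. ?T1 z \<xi> + ?T2 z \<xi> \<partial>nu \<alpha>)"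
      proof (rule nn_integral_mono)
        fix \<xi> :: "complex ^ 'n" assume "\<xi> \<in> space (nu \<alpha>)"
        hence \<xi>: "norm \<xi> < 1" by simp
        hence H\<xi>: "?H \<xi> > 0" by (simp add: abs_square_less_1)
        let ?P = "\<Phi> (norm (g \<xi>))"
        have P: "?P \<ge> 0" by (rule growth_nonneg[OF growth]) simp
        \<comment> \<open>One power of \<open>?v\<close> cancels in the density; the remaining
          powers with exponents \<eta> and r are products of opposite powers in \<open>z\<close> and
          \<xi>, exactly the weights of \<open>Schur_weight\<close>.\<close>
        have vp: "?v \<xi> powr x = A powr x * ?H z powr (- (e * x)) * ?H \<xi> powr (e * x)" for x
          using A Hz H\<xi> by (simp add: powr_mult powr_powr)
        have "\<Phi> (?v \<xi> * norm (g \<xi>)) * (?K z \<xi> / ?v \<xi>) \<le> C * (?v \<xi> powr (1 + \<eta>) + ?v \<xi> powr (1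
            + r)) * ?P * (?K z \<xi> / ?v \<xi>)"
          using v0[OF \<xi>] by (intro mult_right_mono C(2)) auto
        also have "\<dots> = C * (?v \<xi> powr \<eta> + ?v \<xi> powr r) * ?P * ?K z \<xi>"
        proof -
          have "C * (V powr (1 + \<eta>) + V powr (1 + r)) * P * (k / V)
              = C * (V powr \<eta> + V powr r) * P * k" if "V > 0" for V P k :: real
            using that by (simp add: powr_add field_simps)
          thus ?thesis using v0[OF \<xi>] by blast
        qed
        also have "\<dots> = (C * A powr \<eta>) * ?P * ?H \<xi> powr (e * \<eta>) * (?H z powr (- (e * \<eta>)) * ?K z \<xi>)
            + (C * A powr r) * ?P * ?H \<xi> powr (e * r) * (?H z powr (- (e * r)) * ?K z \<xi>)"
          unfolding vp by (simp add: algebra_simps)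
        finally have "ennreal (\<Phi> (?v \<xi> * norm (g \<xi>)) * (?K z \<xi> / ?v \<xi>)) \<le>
            ennreal ((C * A powr \<eta>) * ?P * ?H \<xi> powr (e * \<eta>) * (?H z powr (- (e * \<eta>)) * ?K z \<xi>)
            + (C * A powr r) * ?P * ?H \<xi> powr (e * r) * (?H z powr (- (e * r)) * ?K z \<xi>))"
          by (rule ennreal_leI)
        also have "\<dots> = ?T1 z \<xi> + ?T2 z \<xi>"
        proof -
          have "ennreal (c * p * h * (j * k) + c' * p * h' * (j' * k))
              = (ennreal c * ennreal p * ennreal h) * (ennreal j * ennreal k) + (ennreal c' * ennreal p * ennreal h') * (ennreal j' * ennreal k)"
            if "c \<ge> 0" "c' \<ge> 0" "p \<ge> 0" "h \<ge> 0" "h' \<ge> 0" "j \<ge> 0" "j' \<ge> 0" "k \<ge> 0" for c c' p h h' j j' k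
            using that by (simp add: ennreal_plus ennreal_mult)
          thus ?thesis using C(1) P by simp
        qed
        finally show "ennreal (\<Phi> (?v \<xi> * norm (g \<xi>))) * ?k \<xi> \<le> ?T1 z \<xi> + ?T2 z \<xi>"
          unfolding kv[OF \<xi>] using v0[OF \<xi>] growth_nonneg[OF growth, of "?v \<xi> * norm (g \<xi>)"]
          by (subst ennreal_mult[symmetric]) auto
      qed
      finally show ?thesis .
    qed
    have "(\<integral>\<^sup>+z. ennreal (\<Phi> (norm (bergman_proj \<alpha> g z))) \<partial>nu \<alpha>) \<le> (\<integral>\<^sup>+z. \<integral>\<^sup>+\<xi>. ?T1 z \<xi> + ?T2 z \<xi> \<partial>nu \<alpha> \<partial>nu \<alpha>)"
      using pt by (intro nn_integral_mono) auto
    also have "\<dots> = (\<integral>\<^sup>+z. (\<integral>\<^sup>+\<xi>. ?T1 z \<xi> \<partial>nu \<alpha>) + (\<integral>\<^sup>+\<xi>. ?T2 z \<xi> \<partial>nu \<alpha>) \<partial>nu \<alpha>)"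
      by (intro nn_integral_cong nn_integral_add) measurable
    also have "\<dots> = (\<integral>\<^sup>+z. \<integral>\<^sup>+\<xi>. ?T1 z \<xi> \<partial>nu \<alpha> \<partial>nu \<alpha>) + (\<integral>\<^sup>+z. \<integral>\<^sup>+\<xi>. ?T2 z \<xi> \<partial>nu \<alpha> \<partial>nu \<alpha>)"
      by (rule nn_integral_add) measurable
    also have "\<dots> \<le> ennreal C1 * (\<integral>\<^sup>+\<xi>. ?G1 \<xi> \<partial>nu \<alpha>) + ennreal C2 * (\<integral>\<^sup>+\<xi>. ?G2 \<xi> \<partial>nu \<alpha>)"
      by (intro add_mono S1 S2) measurable
    also have "\<dots> = ennreal C1 * (ennreal (C * A powr \<eta>) * (\<integral>\<^sup>+\<xi>. ennreal (\<Phi> (norm (g \<xi>))) \<partial>nu \<alpha>))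
        + ennreal C2 * (ennreal (C * A powr r) * (\<integral>\<^sup>+\<xi>. ennreal (\<Phi> (norm (g \<xi>))) \<partial>nu \<alpha>))"
      by (subst (1 2) nn_integral_cmult) auto
    also have "\<dots> = ennreal D * (\<integral>\<^sup>+\<xi>. ennreal (\<Phi> (norm (g \<xi>))) \<partial>nu \<alpha>)"
    proof -
      have "ennreal c1 * (ennreal d1 * X) + ennreal c2 * (ennreal d2 * X) = ennreal (c1 * d1 + c2 * d2) * X"
        if "c1 \<ge> 0" "c2 \<ge> 0" "d1 \<ge> 0" "d2 \<ge> 0" for c1 c2 d1 d2 X
        using that by (simp add: ennreal_mult ennreal_plus distrib_right mult.assoc)
      thus ?thesis unfolding D_def using C(1) C1 C2 by simp
    qed
    finally show "(\<integral>\<^sup>+z. ennreal (\<Phi> (norm (bergman_proj \<alpha> g z))) \<partial>nu \<alpha>)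
        \<le> ennreal D * (\<integral>\<^sup>+\<xi>. ennreal (\<Phi> (norm (g \<xi>))) \<partial>nu \<alpha>)" .
  qed
qed

end

section \<open>Duality and point evaluations\<close>

lemma Re_less_1_not_nonpos: "norm u < 1 \<Longrightarrow> 1 - (u :: complex) \<notin> \<real>\<^sub>\<le>\<^sub>0"
  using complex_Re_le_cmod[of u] by (auto simp: complex_nonpos_Reals_iff)

text \<open>Here \<open>f i\<close> is the i-th derivative of the power. The remainder is quadratic
  with a constant uniform on the disc, which allows differentiation under the integral sign.\<close>

lemma powr_Taylor_2:
  fixes u w :: complex
  assumes "norm u \<le> \<rho>" "norm w \<le> \<rho>" "\<rho> < 1" "s > 0"
  shows "norm ((1 - w) powr of_real (- s) - (1 - u) powr of_real (- s) - of_real s * (w - u)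
      * (1 - u) powr of_real (- (s + 1)))
    \<le> s * (s + 1) * (1 - \<rho>) powr (- (s + 2)) * (norm (w - u))\<^sup>2"
proof -
  define f where "f i x = of_real (pochhammer s i) * (1 - x) powr of_real (- (s + real i))" for i and x :: complex
  have "norm (f 0 w - (\<Sum>i\<le>1. f i u * (w - u) ^ i / fact i))
      \<le> s * (s + 1) * (1 - \<rho>) powr (- (s + 2)) * norm (w - u) ^ Suc 1 / fact 1"
  proof (rule complex_Taylor[where S="cball (0 :: complex) \<rho>"])
    fix i and x :: complex assume x: "x \<in> cball 0 \<rho>"
    hence nx: "1 - x \<notin> \<real>\<^sub>\<le>\<^sub>0" using assms by (intro Re_less_1_not_nonpos) auto
    have "((\<lambda>x. of_real (pochhammer s i) * (1 - x) powr of_real (- (s + real i))) has_field_derivative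
        of_real (pochhammer s i) * (of_real (- (s + real i)) * (1 - x) powr (of_real (- (s + real i)) - 1) * (- 1))) (at x within cball 0 \<rho>)"
      using nx by (auto intro!: derivative_eq_intros)
    also have "of_real (pochhammer s i) * (of_real (- (s + real i)) * (1 - x) powr (of_real (- (s
        + real i)) - 1) * (- 1)) = f (Suc i) x"
    proof -
      have "of_real (- (s + real i)) - 1 = (of_real (- (s + real (Suc i))) :: complex)" by simp
      thus ?thesis unfolding f_def pochhammer_Suc by (simp only:) (simp add: algebra_simps)
    qed
    finally show "(f i has_field_derivative f (Suc i) x) (at x within cball 0 \<rho>)" unfolding f_def .
  next
    fix x :: complex assume "x \<in> cball 0 \<rho>"
    hence x: "norm x \<le> \<rho>" by simp
    have "norm (1 - x) \<ge> 1 - \<rho>" using norm_triangle_ineq2[of 1 x] x by simp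
    hence "norm (1 - x) powr (- (s + 2)) \<le> (1 - \<rho>) powr (- (s + 2))" using assms by (intro powr_mono2') auto
    moreover have "pochhammer s (Suc 1) = s * (s + 1)" by (simp add: pochhammer_Suc)
    moreover have "norm (f (Suc 1) x) = pochhammer s (Suc 1) * norm (1 - x) powr (- (s + 2))"
      using assms unfolding f_def norm_mult norm_of_real
      by (subst norm_powr_real_powr') (auto simp: pochhammer_Suc)
    ultimately show "norm (f (Suc 1) x) \<le> s * (s + 1) * (1 - \<rho>) powr (- (s + 2))"
      using assms by (simp add: mult_left_mono)
  qed (use assms in auto)
  moreover have "f 0 w - (\<Sum>i\<le>1. f i u * (w - u) ^ i / fact i)
    = (1 - w) powr of_real (- s) - (1 - u) powr of_real (- s) - of_real s * (w - u) * (1 - u) powr of_real (- (s + 1))"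
  proof -
    have "f 0 w - (\<Sum>i\<le>1. f i u * (w - u) ^ i / fact i) = f 0 w - f 0 u - (w - u) * f (Suc 0) u" by simp
    moreover have "f 0 x = (1 - x) powr of_real (- s)" for x by (simp add: f_def)
    moreover have "f (Suc 0) u = of_real s * (1 - u) powr of_real (- (s + 1))"
      by (simp only: f_def pochhammer_Suc0 of_nat_Suc of_nat_0 add_0_right)
    ultimately show ?thesis by (simp only:) simp
  qed
  ultimately show ?thesis by (simp add: power2_eq_square)
qed

section \<open>Projections of bounded functions supported in a smaller ball\<close>

context
  fixes \<alpha> \<rho> B :: real and g :: "complex ^ 'n \<Rightarrow> complex"
  assumes a: "\<alpha> > -1" and meas [measurable]: "g \<in> borel_measurable (nu \<alpha>)"
    and \<rho>: "0 \<le> \<rho>" "\<rho> < 1" and B: "\<And>\<xi>. norm (g \<xi>) \<le> B" and supp: "\<And>\<xi>. norm \<xi> > \<rho> \<Longrightarrow> g \<xi> = 0"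
begin

lemma compact_support_kernel_bound:
  assumes "norm z < 1" "s \<ge> 0"
  shows "norm (g \<xi> * bkern s z \<xi>) \<le> B * (1 - \<rho>) powr (- s)"
proof (cases "norm \<xi> > \<rho>")
  case True
  have "B \<ge> 0" using order.trans[OF norm_ge_zero B] .
  thus ?thesis using supp[OF True] by simp
next
  case False
  have "norm z * norm \<xi> \<le> 1 * \<rho>" using False assms by (intro mult_mono) auto
  hence "norm (bkern s z \<xi>) \<le> (1 - \<rho>) powr (- s)" using assms \<rho> by (intro norm_bkern_le) auto
  thus ?thesis using B[of \<xi>] order.trans[OF norm_ge_zero B[of \<xi>]] unfolding norm_mult by (intro mult_mono) auto
qed

lemma compact_support_integrable:
  assumes "norm z < 1" "s \<ge> 0"
  shows "integrable (nu \<alpha>) (\<lambda>\<xi>. g \<xi> * bkern s z \<xi>)"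
proof -
  interpret finite_measure "nu \<alpha> :: (complex ^ 'n) measure" by (rule finite_measure_nu[OF a])
  show ?thesis
    by (rule integrable_const_bound[where B="B * (1 - \<rho>) powr (- s)"])
       (use compact_support_kernel_bound[OF assms] in auto)
qed

lemma measure_nu_1: "measure (nu \<alpha> :: (complex ^ 'n) measure) unit_ball = 1"
  by (simp add: measure_def prob_nu[OF a])

lemma norm_integral_nu_le:
  fixes f :: "complex ^ 'n \<Rightarrow> complex"
  assumes "integrable (nu \<alpha>) f" "\<And>\<xi>. norm \<xi> < 1 \<Longrightarrow> norm (f \<xi>) \<le> K"
  shows "norm (\<integral>\<xi>. f \<xi> \<partial>nu \<alpha>) \<le> K"
proof -
  interpret finite_measure "nu \<alpha> :: (complex ^ 'n) measure" by (rule finite_measure_nu[OF a])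
  have "norm (\<integral>\<xi>. f \<xi> \<partial>nu \<alpha>) \<le> (\<integral>\<xi>. K \<partial>(nu \<alpha> :: (complex ^ 'n) measure))"
    by (rule order.trans[OF integral_norm_bound], rule integral_mono[OF integrable_norm[OF assms(1)]])
       (use assms(2) in auto)
  thus ?thesis by (simp add: measure_nu_1)
qed

text \<open>On the support of \<open>g\<close> the form stays in a disc of radius \<rho> < 1, so the
  kernel and its Taylor remainder are bounded uniformly up to the boundary in
  \<open>z\<close>.\<close>

lemma bergman_proj_bounded_holomorphic: "bergman_proj \<alpha> g \<in> bounded_holomorphic"
proof -
  let ?s = "real CARD('n) + 1 + \<alpha>"
  have s: "?s > 0" using a by (simp add: add_nonneg_pos add.assoc)
  interpret finite_measure "nu \<alpha> :: (complex ^ 'n) measure" by (rule finite_measure_nu[OF a])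
  have B0: "B \<ge> 0" using order.trans[OF norm_ge_zero B] .
  define M where "M = B * (?s * (?s + 1) * (1 - \<rho>) powr (- (?s + 2)))"
  have M: "M \<ge> 0" using s B0 by (simp add: M_def)
  have "bounded (bergman_proj \<alpha> g ` unit_ball)"
  proof (rule boundedI)
    fix y assume "y \<in> bergman_proj \<alpha> g ` unit_ball"
    then obtain z where z: "norm z < 1" "y = bergman_proj \<alpha> g z" by auto
    show "norm y \<le> B * (1 - \<rho>) powr (- ?s)"
      unfolding z(2) bergman_proj_eq[OF z(1)] using z s
      by (intro norm_integral_nu_le compact_support_integrable compact_support_kernel_bound) auto
  qed
  moreover have "holomorphic_Cn (bergman_proj \<alpha> g) unit_ball"
    unfolding holomorphic_Cn_def
  proof
    fix z :: "complex ^ 'n" assume "z \<in> unit_ball"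
    hence z: "norm z < 1" by simp
    \<comment> \<open>The integral of the kernel differentiated in direction \<open>h\<close>. It is
      complex linear because the form is linear in its first argument.\<close>
    define D where "D h = (\<integral>\<xi>. of_real ?s * hermitian h \<xi> * (g \<xi> * bkern (?s + 1) z \<xi>) \<partial>nu \<alpha>)" for h :: "complex ^ 'n"
    have bd: "norm (of_real ?s * hermitian h \<xi> * (g \<xi> * bkern (?s + 1) z \<xi>))
        \<le> norm h * (?s * (B * (1 - \<rho>) powr (- (?s + 1))))"
      if "norm \<xi> < 1" for h \<xi>
    proof -
      have "norm (hermitian h \<xi>) \<le> norm h" using norm_hermitian_le[of h \<xi>] that mult_left_le[of "norm \<xi>" "norm
          h"] by simp
      hence "(?s * norm (hermitian h \<xi>)) * norm (g \<xi> * bkern (?s + 1) z \<xi>)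
          \<le> (?s * norm h) * (B * (1 - \<rho>) powr (- (?s + 1)))"
        using s by (intro mult_mono compact_support_kernel_bound[OF z] mult_left_mono) auto
      thus ?thesis using s by (simp only: norm_mult norm_of_real abs_of_pos mult_ac)
    qed
    have int: "integrable (nu \<alpha>) (\<lambda>\<xi>. of_real ?s * hermitian h \<xi> * (g \<xi> * bkern (?s + 1) z \<xi>))" for h
      by (rule integrable_const_bound[where B="norm h * (?s * (B * (1 - \<rho>) powr (- (?s + 1))))"])
         (use bd in auto)
    have D_smult: "D (c *s h) = c * D h" for c h
      unfolding D_def by (subst integral_mult_right_zero[symmetric]) (simp only: hermitian_smult_left mult_ac)
    have bl: "bounded_linear D"
    proof (rule bounded_linear_intro[where K="?s * (B * (1 - \<rho>) powr (- (?s + 1)))"])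
      show "D (x + y) = D x + D y" for x y
        unfolding D_def hermitian_add_left distrib_left distrib_right
        by (rule Bochner_Integration.integral_add) (rule int)+
      show "D (c *\<^sub>R x) = c *\<^sub>R D x" for c x
      proof -
        have "c *\<^sub>R x = of_real c *s x" by (simp add: vec_eq_iff scaleR_conv_of_real[symmetric])
        thus ?thesis by (simp add: D_smult scaleR_conv_of_real)
      qed
      show "norm (D x) \<le> norm x * (?s * (B * (1 - \<rho>) powr (- (?s + 1))))" for x
        unfolding D_def by (rule norm_integral_nu_le[OF int bd])
    qed
    have quad: "norm (bergman_proj \<alpha> g y - bergman_proj \<alpha> g z - D (y - z)) \<le> M * (norm (y - z))\<^sup>2" if y: "norm y
        < 1" for y
    proof -
      let ?R = "\<lambda>\<xi>. (g \<xi> * bkern ?s y \<xi> - g \<xi> * bkern ?s z \<xi>) - of_real ?s * hermitian (y - z) \<xi> * (g \<xi>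
          * bkern (?s + 1) z \<xi>)"
      note i = compact_support_integrable[OF y less_imp_le[OF s]] compact_support_integrable[OF z less_imp_le[OF s]]
      have iR: "integrable (nu \<alpha>) ?R" by (intro Bochner_Integration.integrable_diff i int)
      have "bergman_proj \<alpha> g y - bergman_proj \<alpha> g z - D (y - z) = (\<integral>\<xi>. ?R \<xi> \<partial>nu \<alpha>)"
        unfolding bergman_proj_eq[OF y] bergman_proj_eq[OF z] D_def
        by (simp only: Bochner_Integration.integral_diff i int Bochner_Integration.integrable_diff)
      also have "norm \<dots> \<le> M * (norm (y - z))\<^sup>2"
      proof (rule norm_integral_nu_le[OF iR])
        fix \<xi> :: "complex ^ 'n" assume \<xi>: "norm \<xi> < 1"
        show "norm (?R \<xi>) \<le> M * (norm (y - z))\<^sup>2"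
        proof (cases "norm \<xi> > \<rho>")
          case True thus ?thesis using supp[OF True] M by simp
        next
          case False
          have u: "norm (hermitian z \<xi>) \<le> \<rho>" "norm (hermitian y \<xi>) \<le> \<rho>"
            using norm_hermitian_le[of z \<xi>] norm_hermitian_le[of y \<xi>] False y z \<rho>
              mult_mono[of "norm z" 1 "norm \<xi>" \<rho>] mult_mono[of "norm y" 1 "norm \<xi>" \<rho>] by auto
          have hd: "norm (hermitian y \<xi> - hermitian z \<xi>) \<le> norm (y - z)"
            using norm_hermitian_le[of "y - z" \<xi>] \<xi> mult_left_le[of "norm \<xi>" "norm (y - z)"]
            by (simp add: hermitian_diff_left)
          have "?R \<xi> = g \<xi> * (bkern ?s y \<xi> - bkern ?s z \<xi> - of_real ?s * (hermitian y \<xi> - hermitian z \<xi>)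
              * bkern (?s + 1) z \<xi>)"
            by (simp add: hermitian_diff_left algebra_simps)
          hence "norm (?R \<xi>) = norm (g \<xi>) * norm (bkern ?s y \<xi> - bkern ?s z \<xi> - of_real ?s
              * (hermitian y \<xi> - hermitian z \<xi>) * bkern (?s + 1) z \<xi>)"
            by (simp only: norm_mult)
          also have "\<dots> \<le> B * (?s * (?s + 1) * (1 - \<rho>) powr (- (?s + 2)) * (norm (hermitian y \<xi> - hermitian z \<xi>))\<^sup>2)"
            unfolding bkern_eq[OF y \<xi>] bkern_eq[OF z \<xi>]
            by (intro mult_mono B powr_Taylor_2 u \<rho> s B0) auto
          also have "\<dots> = M * (norm (hermitian y \<xi> - hermitian z \<xi>))\<^sup>2" by (simp only: M_def mult.assoc)
          also have "\<dots> \<le> M * (norm (y - z))\<^sup>2" using hd M by (intro mult_left_mono power_mono) auto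
          finally show ?thesis .
        qed
      qed
      finally show ?thesis .
    qed
    have "(bergman_proj \<alpha> g has_derivative D) (at z within unit_ball)"
      unfolding has_derivative_within_alt
    proof (intro conjI bl allI impI)
      fix \<epsilon> :: real assume \<epsilon>: "0 < \<epsilon>"
      show "\<exists>d>0. \<forall>y\<in>unit_ball. norm (y - z) < d \<longrightarrow> norm (bergman_proj \<alpha> g y - bergman_proj \<alpha> g z - D (y - z))
          \<le> \<epsilon> * norm (y - z)"
      proof (intro exI[of _ "\<epsilon> / (M + 1)"] conjI ballI impI)
        show "\<epsilon> / (M + 1) > 0" using \<epsilon> M by simp
        fix y :: "complex ^ 'n" assume y: "y \<in> unit_ball" "norm (y - z) < \<epsilon> / (M + 1)"
        have "(M + 1) * norm (y - z) \<le> \<epsilon>" using y(2) M by (simp add: field_simps)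
        hence "M * norm (y - z) \<le> \<epsilon>" unfolding distrib_right mult_1 using norm_ge_zero[of "y - z"] by linarith
        hence "M * norm (y - z) * norm (y - z) \<le> \<epsilon> * norm (y - z)" by (intro mult_right_mono) auto
        thus "norm (bergman_proj \<alpha> g y - bergman_proj \<alpha> g z - D (y - z)) \<le> \<epsilon> * norm (y - z)"
          using quad[of y] y by (simp add: power2_eq_square mult.assoc)
      qed
    qed
    thus "\<exists>D. (bergman_proj \<alpha> g has_derivative D) (at z within unit_ball) \<and> (\<forall>c v. D (c *s v) = c * D v)"
      using D_smult by blast
  qed
  ultimately show ?thesis by (simp add: bounded_holomorphic_def)
qed

text \<open>The kernel is bounded on the support of \<open>g\<close>, so the double integral
  converges absolutely for integrable \<open>b\<close>; Hermitian symmetry of the kernel then leaves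
  the reproducing formula for \<open>b\<close>.\<close>

lemma bergman_proj_self_adjoint:
  assumes hb: "holomorphic_Cn b unit_ball" and ib: "integrable (nu \<alpha>) b"
  shows "(\<integral>z. b z * cnj (bergman_proj \<alpha> g z) \<partial>nu \<alpha>) = (\<integral>\<xi>. b \<xi> * cnj (g \<xi>) \<partial>nu \<alpha>)"
proof -
  let ?s = "real CARD('n) + 1 + \<alpha>"
  have s: "?s \<ge> 0" using a by (simp add: add_nonneg_nonneg add.assoc)
  have [measurable]: "b \<in> borel_measurable (nu \<alpha>)" by (rule holomorphic_Cn_measurable[OF hb])
  interpret nu: finite_measure "nu \<alpha> :: (complex ^ 'n) measure" by (rule finite_measure_nu[OF a])
  interpret pair_sigma_finite "nu \<alpha> :: (complex ^ 'n) measure" "nu \<alpha> :: (complex ^ 'n) measure" by unfold_locales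
  let ?F = "\<lambda>z \<xi>. b z * cnj (g \<xi> * bkern ?s z \<xi>)"
  let ?K = "B * (1 - \<rho>) powr (- ?s)"
  have int: "integrable (nu \<alpha> \<Otimes>\<^sub>M nu \<alpha>) (\<lambda>(z, \<xi>). ?F z \<xi>)"
  proof (rule integrableI_bounded)
    show "(\<lambda>(z, \<xi>). ?F z \<xi>) \<in> borel_measurable (nu \<alpha> \<Otimes>\<^sub>M nu \<alpha>)" by measurable
    have "(\<integral>\<^sup>+p. ennreal (norm (case p of (z, \<xi>) \<Rightarrow> ?F z \<xi>)) \<partial>(nu \<alpha> \<Otimes>\<^sub>M nu \<alpha>))
      = (\<integral>\<^sup>+z. \<integral>\<^sup>+\<xi>. ennreal (norm (?F z \<xi>)) \<partial>nu \<alpha> \<partial>nu \<alpha>)"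
      by (subst nu.nn_integral_fst[symmetric]) auto
    also have "\<dots> \<le> (\<integral>\<^sup>+z. \<integral>\<^sup>+\<xi>. ennreal (norm (b z) * ?K) \<partial>(nu \<alpha> :: (complex ^ 'n) measure) \<partial>nu \<alpha>)"
    proof (intro nn_integral_mono ennreal_leI)
      fix z \<xi> :: "complex ^ 'n" assume "z \<in> space (nu \<alpha>)"
      hence "norm z < 1" by simp
      from compact_support_kernel_bound[OF this s, of \<xi>] show "norm (?F z \<xi>) \<le> norm (b z) * ?K"
        unfolding norm_mult complex_mod_cnj by (intro mult_left_mono) auto
    qed
    also have "\<dots> = (\<integral>\<^sup>+z. ennreal (norm (b z)) * ennreal ?K \<partial>nu \<alpha>)"
      by (intro nn_integral_cong) (simp add: prob_nu[OF a] ennreal_mult')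
    also have "\<dots> = (\<integral>\<^sup>+z. ennreal (norm (b z)) \<partial>nu \<alpha>) * ennreal ?K" by (rule nn_integral_multc) measurable
    also have "\<dots> < \<infinity>" using ib by (simp add: integrable_iff_bounded ennreal_mult_less_top)
    finally show "(\<integral>\<^sup>+p. ennreal (norm (case p of (z, \<xi>) \<Rightarrow> ?F z \<xi>)) \<partial>(nu \<alpha> \<Otimes>\<^sub>M nu \<alpha>)) < \<infinity>" .
  qed
  have "(\<integral>z. b z * cnj (bergman_proj \<alpha> g z) \<partial>nu \<alpha>) = (\<integral>z. \<integral>\<xi>. ?F z \<xi> \<partial>nu \<alpha> \<partial>nu \<alpha>)"
  proof (intro Bochner_Integration.integral_cong refl)
    fix z :: "complex ^ 'n" assume "z \<in> space (nu \<alpha>)"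
    hence z: "norm z < 1" by simp
    show "b z * cnj (bergman_proj \<alpha> g z) = (\<integral>\<xi>. ?F z \<xi> \<partial>nu \<alpha>)"
      unfolding bergman_proj_eq[OF z] by (simp only: integral_mult_right_zero Bochner_Integration.integral_cnj)
  qed
  also have "\<dots> = (\<integral>\<xi>. \<integral>z. ?F z \<xi> \<partial>nu \<alpha> \<partial>nu \<alpha>)" using Fubini_integral[OF int] by simp
  also have "\<dots> = (\<integral>\<xi>. b \<xi> * cnj (g \<xi>) \<partial>nu \<alpha>)"
  proof (intro Bochner_Integration.integral_cong refl)
    fix \<xi> :: "complex ^ 'n" assume "\<xi> \<in> space (nu \<alpha>)"
    hence \<xi>: "norm \<xi> < 1" by simp
    have "(\<integral>z. ?F z \<xi> \<partial>nu \<alpha>) = (\<integral>z. cnj (g \<xi>) * (b z * bkern ?s \<xi> z) \<partial>nu \<alpha>)"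
      by (intro Bochner_Integration.integral_cong refl) (simp add: cnj_bkern)
    also have "\<dots> = cnj (g \<xi>) * b \<xi>"
      by (simp only: integral_mult_right_zero bergman_reproducing[OF hb a ib \<xi>])
    finally show "(\<integral>z. ?F z \<xi> \<partial>nu \<alpha>) = b \<xi> * cnj (g \<xi>)" by (simp add: mult.commute)
  qed
  finally show ?thesis .
qed

end

text \<open>The kernel is holomorphic in \<open>z\<close> along every complex line, and a rotation
  mean around \<open>z\<close> replaces it by its value at the centre.\<close>

lemma bkern_mean_value:
  fixes z \<xi> :: "complex ^ 'n"
  assumes \<xi>: "norm \<xi> < 1" and r: "norm z + r < 1" "r > 0" and s: "s \<ge> 0"
  shows "(\<integral>u. indicator (ball 0 r) u *\<^sub>R bkern s (z + u) \<xi> \<partial>lborel)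
      = measure lborel (ball (0 :: complex ^ 'n) r) *\<^sub>R bkern s z \<xi>"
    and "integrable lborel (\<lambda>u. indicator (ball 0 r) u *\<^sub>R bkern s (z + u) \<xi>)" (is ?int)
proof -
  have fin: "emeasure lborel (ball (0 :: complex ^ 'n) r) < \<infinity>" by (rule emeasure_lborel_ball_finite)
  show int: ?int
  proof (rule Bochner_Integration.integrable_bound)
    show "integrable lborel (\<lambda>u. ((1 - (norm z + r)) powr (- s))
        *\<^sub>R (indicator (ball (0 :: complex ^ 'n) r) u :: real))"
      using fin by (intro integrable_scaleR_right integrable_real_indicator) auto
    show "AE u in lborel. norm (indicator (ball 0 r) u *\<^sub>R bkern s (z + u) \<xi>)
        \<le> norm (((1 - (norm z + r)) powr (- s)) *\<^sub>R (indicator (ball 0 r) u :: real))"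
    proof (rule AE_I2)
      fix u :: "complex ^ 'n"
      have "norm (bkern s (z + u) \<xi>) \<le> (1 - (norm z + r)) powr (- s)" if "norm u < r"
      proof (rule norm_bkern_le[OF _ r(1) s])
        have "norm (z + u) * norm \<xi> \<le> norm (z + u)" using \<xi> by (simp add: mult_left_le)
        also have "\<dots> \<le> norm z + r" using norm_triangle_ineq[of z u] that by simp
        finally show "norm (z + u) * norm \<xi> \<le> norm z + r" .
      qed
      thus "norm (indicator (ball 0 r) u *\<^sub>R bkern s (z + u) \<xi>)
          \<le> norm (((1 - (norm z + r)) powr (- s)) *\<^sub>R (indicator (ball 0 r) u :: real))"
        by (auto simp: indicator_def)
    qed
  qed measurable
  have "(\<integral>u. indicator (ball 0 r) u *\<^sub>R bkern s (z + u) \<xi> \<partial>lborel)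
      = (\<integral>u. indicator (ball (0 :: complex ^ 'n) r) u *\<^sub>R bkern s z \<xi> \<partial>lborel)"
  proof (rule integral_rotation_mean[OF int])
    fix u :: "complex ^ 'n"
    show "(\<integral>t. indicator (ball 0 r) (cisp t *s u) *\<^sub>R bkern s (z + cisp t *s u) \<xi> \<partial>circ)
        = indicator (ball 0 r) u *\<^sub>R bkern s z \<xi>"
    proof (cases "norm u < r")
      case False thus ?thesis by simp
    next
      case True
      have z1: "norm z < 1" using r by simp
      \<comment> \<open>The largest radius for which the disc through \<open>z\<close> in direction
        \<open>u\<close> stays in the ball; it exceeds 1. For u = 0 any number above 1 will
        do.\<close>
      define R where "R = (if u = 0 then 2 else (1 - norm z) / norm u)"
      have R1: "R > 1" using True r by (auto simp: R_def field_simps)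
      have in_ball: "norm (z + \<mu> *s u) < 1" if "norm \<mu> < R" for \<mu>
      proof (cases "u = 0")
        case True thus ?thesis using z1 by simp
      next
        case False
        have "norm (z + \<mu> *s u) \<le> norm z + norm \<mu> * norm u" using norm_triangle_ineq[of z "\<mu> *s u"] by simp
        also have "norm \<mu> * norm u < 1 - norm z" using that False by (simp add: R_def field_simps)
        finally show ?thesis by simp
      qed
      let ?h = "\<lambda>\<mu>. exp (of_real (- s) * Ln (1 - hermitian z \<xi> - \<mu> * hermitian u \<xi>))"
      have herm: "hermitian (z + \<mu> *s u) \<xi> = hermitian z \<xi> + \<mu> * hermitian u \<xi>" for \<mu>
        by (simp add: hermitian_add_left)
      have nz: "1 - hermitian z \<xi> - \<mu> * hermitian u \<xi> \<notin> \<real>\<^sub>\<le>\<^sub>0" if "norm \<mu> < R" for \<mu>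
        using Re_less_1_not_nonpos[OF hermitian_norm_less_1[OF in_ball[OF that] \<xi>]] by (simp add: herm algebra_simps)
      have eq: "bkern s (z + \<mu> *s u) \<xi> = ?h \<mu>" if "norm \<mu> < R" for \<mu>
      proof -
        have "1 - hermitian z \<xi> - \<mu> * hermitian u \<xi> \<noteq> 0" using nz[OF that] by auto
        thus ?thesis unfolding bkern_eq[OF in_ball[OF that] \<xi>] herm by (simp add: powr_def algebra_simps)
      qed
      have "?h holomorphic_on ball 0 R" using nz by (intro holomorphic_intros) auto
      from circ_mean_value[OF this, of 1] R1 have "(\<integral>t. ?h (cisp t) \<partial>circ) = ?h 0" by simp
      moreover have "?h 0 = bkern s z \<xi>" using eq[of 0] R1 by simp
      moreover have "?h (cisp t) = bkern s (z + cisp t *s u) \<xi>" for t using eq[of "cisp t"] R1 by simp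
      ultimately show ?thesis using True by simp
    qed
  qed
  also have "\<dots> = measure lborel (ball (0 :: complex ^ 'n) r) *\<^sub>R bkern s z \<xi>"
    using fin by simp
  finally show "(\<integral>u. indicator (ball 0 r) u *\<^sub>R bkern s (z + u) \<xi> \<partial>lborel)
      = measure lborel (ball (0 :: complex ^ 'n) r) *\<^sub>R bkern s z \<xi>" .
qed

text \<open>The mean value property passes from the kernel to the projection by Fubini. This covers
  integrable \<open>g\<close> without a support condition, such as the product of \<open>b\<close>
  with a conjugated bounded function.\<close>

lemma bergman_proj_sub_mean:
  fixes z :: "complex ^ 'n"
  assumes a: "\<alpha> > -1" and ig: "integrable (nu \<alpha>) g" and r: "norm z + r < 1" "r > 0"
  shows "ennreal (measure lborel (ball (0 :: complex ^ 'n) r) * norm (bergman_proj \<alpha> g z))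
    \<le> (\<integral>\<^sup>+y. ennreal (norm (bergman_proj \<alpha> g y)) * indicator (ball z r) y \<partial>lborel)"
proof -
  let ?s = "real CARD('n) + 1 + \<alpha>"
  have s: "?s \<ge> 0" using a by (simp add: add_nonneg_nonneg add.assoc)
  have z: "norm z < 1" using r by simp
  have [measurable]: "g \<in> borel_measurable (nu \<alpha>)" using ig by auto
  interpret nu: finite_measure "nu \<alpha> :: (complex ^ 'n) measure" by (rule finite_measure_nu[OF a])
  interpret pair_sigma_finite "lborel :: (complex ^ 'n) measure" "nu \<alpha> :: (complex ^ 'n) measure" by unfold_locales
  let ?K = "(1 - (norm z + r)) powr (- ?s)"
  have fin: "emeasure lborel (ball (0 :: complex ^ 'n) r) < \<infinity>" by (rule emeasure_lborel_ball_finite)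
  have zu: "norm (z + u) < norm z + r" if "norm u < r" for u
    using norm_triangle_ineq[of z u] that by simp
  have kb: "norm (bkern ?s (z + u) \<xi>) \<le> ?K" if "norm u < r" "norm \<xi> < 1" for u \<xi>
  proof (rule norm_bkern_le[OF _ r(1) s])
    have "norm (z + u) * norm \<xi> \<le> norm (z + u)" using that by (simp add: mult_left_le)
    thus "norm (z + u) * norm \<xi> \<le> norm z + r" using zu[OF that(1)] by simp
  qed
  let ?F = "\<lambda>u \<xi>. indicator (ball 0 r) u *\<^sub>R (g \<xi> * bkern ?s (z + u) \<xi>)"
  have int: "integrable (lborel \<Otimes>\<^sub>M nu \<alpha>) (\<lambda>(u, \<xi>). ?F u \<xi>)"
  proof (rule integrableI_bounded)
    show "(\<lambda>(u, \<xi>). ?F u \<xi>) \<in> borel_measurable (lborel \<Otimes>\<^sub>M nu \<alpha>)" by measurable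
    have "(\<integral>\<^sup>+p. ennreal (norm (case p of (u, \<xi>) \<Rightarrow> ?F u \<xi>)) \<partial>(lborel \<Otimes>\<^sub>M nu \<alpha>))
      = (\<integral>\<^sup>+u. \<integral>\<^sup>+\<xi>. ennreal (norm (?F u \<xi>)) \<partial>nu \<alpha> \<partial>lborel)"
      by (subst nu.nn_integral_fst[symmetric]) auto
    also have "\<dots> \<le> (\<integral>\<^sup>+u. \<integral>\<^sup>+\<xi>. (indicator (ball (0 :: complex ^ 'n) r) u * ennreal ?K) * ennreal (norm (g \<xi>))
        \<partial>nu \<alpha> \<partial>lborel)"
    proof (intro nn_integral_mono)
      fix u \<xi> :: "complex ^ 'n" assume "\<xi> \<in> space (nu \<alpha>)"
      hence \<xi>: "norm \<xi> < 1" by simp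
      show "ennreal (norm (?F u \<xi>)) \<le> (indicator (ball 0 r) u * ennreal ?K) * ennreal (norm (g \<xi>))"
      proof (cases "norm u < r")
        case True
        have "norm (g \<xi> * bkern ?s (z + u) \<xi>) \<le> ?K * norm (g \<xi>)"
          using mult_right_mono[OF kb[OF True \<xi>] norm_ge_zero[of "g \<xi>"]] by (simp add: norm_mult mult.commute)
        thus ?thesis using True by (simp add: ennreal_leI flip: ennreal_mult)
      qed simp
    qed
    also have "\<dots> = emeasure lborel (ball (0 :: complex ^ 'n) r) * ennreal ?K * (\<integral>\<^sup>+\<xi>. ennreal (norm (g \<xi>)) \<partial>nu \<alpha>)"
      by (simp add: nn_integral_cmult nn_integral_multc)
    also have "\<dots> < \<infinity>" using ig fin by (simp add: integrable_iff_bounded ennreal_mult_less_top)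
    finally show "(\<integral>\<^sup>+p. ennreal (norm (case p of (u, \<xi>) \<Rightarrow> ?F u \<xi>)) \<partial>(lborel \<Otimes>\<^sub>M nu \<alpha>)) < \<infinity>" .
  qed
  have eq: "(\<integral>\<xi>. ?F u \<xi> \<partial>nu \<alpha>) = indicator (ball 0 r) u *\<^sub>R bergman_proj \<alpha> g (z + u)" for u
  proof (cases "norm u < r")
    case True
    hence "norm (z + u) < 1" using zu[OF True] r by simp
    thus ?thesis by (simp add: bergman_proj_eq)
  qed simp
  have intL: "integrable lborel (\<lambda>u. indicator (ball 0 r) u *\<^sub>R bergman_proj \<alpha> g (z + u))"
    using integrable_fst'[OF int] by (simp only: eq prod.case)
  have "(\<integral>u. indicator (ball 0 r) u *\<^sub>R bergman_proj \<alpha> g (z + u) \<partial>lborel) = (\<integral>u. \<integral>\<xi>. ?F u \<xi> \<partial>nu \<alpha> \<partial>lborel)"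
    by (simp only: eq)
  also have "\<dots> = (\<integral>\<xi>. \<integral>u. ?F u \<xi> \<partial>lborel \<partial>nu \<alpha>)" using Fubini_integral[OF int] by simp
  also have "\<dots> = (\<integral>\<xi>. measure lborel (ball (0 :: complex ^ 'n) r) *\<^sub>R (g \<xi> * bkern ?s z \<xi>) \<partial>nu \<alpha>)"
  proof (intro Bochner_Integration.integral_cong refl)
    fix \<xi> :: "complex ^ 'n" assume "\<xi> \<in> space (nu \<alpha>)"
    hence \<xi>: "norm \<xi> < 1" by simp
    have "(\<integral>u. ?F u \<xi> \<partial>lborel) = (\<integral>u. g \<xi> * (indicator (ball 0 r) u *\<^sub>R bkern ?s (z + u) \<xi>) \<partial>lborel)"
      by (simp add: mult_scaleR_right)
    also have "\<dots> = measure lborel (ball (0 :: complex ^ 'n) r) *\<^sub>R (g \<xi> * bkern ?s z \<xi>)"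
      by (subst integral_mult_right_zero, subst bkern_mean_value(1)[OF \<xi> r s]) (simp only: mult_scaleR_right)
    finally show "(\<integral>u. ?F u \<xi> \<partial>lborel) = \<dots>" .
  qed
  also have "\<dots> = measure lborel (ball (0 :: complex ^ 'n) r) *\<^sub>R bergman_proj \<alpha> g z"
    by (simp add: bergman_proj_eq[OF z])
  finally have mean: "(\<integral>u. indicator (ball 0 r) u *\<^sub>R bergman_proj \<alpha> g (z + u) \<partial>lborel)
      = measure lborel (ball (0 :: complex ^ 'n) r) *\<^sub>R bergman_proj \<alpha> g z" .
  have "ennreal (measure lborel (ball (0 :: complex ^ 'n) r) * norm (bergman_proj \<alpha> g z))
      = ennreal (norm (\<integral>u. indicator (ball 0 r) u *\<^sub>R bergman_proj \<alpha> g (z + u) \<partial>lborel))"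
    unfolding mean by simp
  also have "\<dots> \<le> (\<integral>\<^sup>+u. ennreal (norm (indicator (ball 0 r) u *\<^sub>R bergman_proj \<alpha> g (z + u))) \<partial>lborel)"
    by (rule integral_norm_bound_ennreal[OF intL])
  also have "\<dots> = (\<integral>\<^sup>+u. ennreal (norm (bergman_proj \<alpha> g (u + z))) * indicator (ball z r) (u + z) \<partial>lborel)"
    by (intro nn_integral_cong) (auto simp: indicator_def dist_norm add.commute)
  also have "\<dots> = (\<integral>\<^sup>+y. ennreal (norm (bergman_proj \<alpha> g y)) * indicator (ball z r) y \<partial>lborel)"
  proof (rule nn_integral_lborel_translate)
    have "bergman_proj \<alpha> g \<in> borel_measurable (nu \<alpha>)" by (rule measurable_bergman_proj[OF a]) measurable
    hence [measurable]: "(\<lambda>y. indicator unit_ball y *\<^sub>R bergman_proj \<alpha> g y) \<in> borel_measurable borel"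
      by (simp only: borel_measurable_nu_iff)
    have "y \<in> unit_ball" if "y \<in> ball z r" for y
      using zu[of "y - z"] that r by (simp add: dist_norm norm_minus_commute)
    hence "(\<lambda>y. ennreal (norm (bergman_proj \<alpha> g y)) * indicator (ball z r) y)
        = (\<lambda>y. ennreal (norm (indicator unit_ball y *\<^sub>R bergman_proj \<alpha> g y)) * indicator (ball z r) y)"
      by (auto simp: indicator_def fun_eq_iff)
    also have "\<dots> \<in> borel_measurable borel" by measurable
    finally show "(\<lambda>y. ennreal (norm (bergman_proj \<alpha> g y)) * indicator (ball z r) y) \<in> borel_measurable borel" .
  qed
  finally show ?thesis .
qed

text \<open>The mean value inequality for \<open>|F|\<close> self-improves to one for \<open>|F| powr p\<close>: take a near-maximum of
  \<open>(1/2 - |z|) powr N * |F z|\<close> with \<open>N = 2 n / p\<close> and absorb \<open>|F| powr (1 - p)\<close>.\<close>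

lemma sub_mean_self_improve:
  fixes u :: "complex ^ 'n \<Rightarrow> real"
  assumes p: "0 < p" "p \<le> 1" and u0: "\<And>y. u y \<ge> 0"
    and bdd: "\<And>z. norm z < 1/2 \<Longrightarrow> u z \<le> K"
    and mean: "\<And>z r. r > 0 \<Longrightarrow> norm z + r < 1/2 \<Longrightarrow>
      ennreal (measure lborel (ball (0 :: complex ^ 'n) r) * u z) \<le> (\<integral>\<^sup>+y. ennreal (u y) * indicator (ball z r) y \<partial>lborel)"
    and Q: "(\<integral>\<^sup>+y. ennreal (u y powr p) * indicator (ball 0 (1/2)) y \<partial>lborel) \<le> ennreal Q" "Q \<ge> 0"
    and meas: "(\<lambda>y. u y powr p * indicator (ball 0 (1/2)) y) \<in> borel_measurable borel"
  defines "N \<equiv> 2 * real CARD('n) / p" and "v \<equiv> unit_ball_vol (real (2 * CARD('n)))"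
  shows "u 0 \<le> 2 powr N * (2 powr N * Q / v) powr (1 / p)"
proof -
  have v: "v > 0" unfolding v_def by (rule unit_ball_vol_pos) simp
  have N: "N > 0" using p by (simp add: N_def)
  define f where "f z = (1/2 - norm z) powr N * u z" for z
  have bddf: "bdd_above (f ` ball 0 (1/2))"
  proof (rule bdd_aboveI2[where M="1 * K"])
    fix z :: "complex ^ 'n" assume "z \<in> ball 0 (1/2)"
    hence z: "norm z < 1/2" by simp
    have "1/2 - norm z \<le> 1" using norm_ge_zero[of z] by linarith
    hence "(1/2 - norm z) powr N \<le> 1" using z N by (intro powr_le1) auto
    thus "f z \<le> 1 * K" unfolding f_def using bdd[OF z] u0[of z] by (intro mult_mono) auto
  qed
  define M where "M = (SUP z\<in>ball 0 (1/2). f z)"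
  have fM: "f z \<le> M" if "norm z < 1/2" for z
    unfolding M_def using that by (intro cSUP_upper bddf) auto
  have M0: "M \<ge> 0" using fM[of 0] u0[of 0] by (simp add: f_def order.trans[rotated])
  define W where "W = 2 powr N * Q / v"
  have W0: "W \<ge> 0" using v Q by (simp add: W_def)
  have step: "f z \<le> W * M powr (1 - p)" if z: "norm z < 1/2" and Mp: "M > 0" for z
  proof -
    \<comment> \<open>Half the distance to the boundary: throughout the ball around \<open>z\<close>
      that distance remains at least \<open>r\<close>, so \<open>M\<close> bounds \<open>u\<close>
      there by M r^(-N).\<close>
    define r where "r = (1/2 - norm z) / 2"
    have r: "r > 0" "norm z + r < 1/2" using z by (auto simp: r_def field_simps)
    define X where "X = (M * r powr (- N)) powr (1 - p)"
    have X0: "X \<ge> 0" by (simp add: X_def)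
    have uy: "u y \<le> u y powr p * X" if y: "y \<in> ball z r" for y
    proof (cases "u y = 0")
      case False
      have "norm y \<le> norm z + norm (y - z)" using norm_triangle_ineq[of z "y - z"] by simp
      hence ny: "norm y < norm z + r" using y by (simp add: dist_norm norm_minus_commute)
      have ry: "r \<le> 1/2 - norm y" using ny by (simp add: r_def field_simps)
      have "r powr N * u y \<le> f y" unfolding f_def using ry r N u0 by (intro mult_right_mono powr_mono2) auto
      also have "\<dots> \<le> M" using ny r by (intro fM) auto
      finally have "u y \<le> M * r powr (- N)" using r by (simp add: powr_minus field_simps)
      hence "u y powr (1 - p) \<le> X" unfolding X_def using p u0 by (intro powr_mono2) auto
      moreover have "u y = u y powr p * u y powr (1 - p)" using u0[of y] False by (simp flip: powr_add)
      ultimately show ?thesis by (metis mult_left_mono powr_ge_zero)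
    qed simp
    have sub: "ball z r \<subseteq> ball 0 (1/2)"
    proof
      fix y assume "y \<in> ball z r"
      thus "y \<in> ball 0 (1/2)" using norm_triangle_ineq[of z "y - z"] r by (simp add: dist_norm norm_minus_commute)
    qed
    have "ennreal (measure lborel (ball (0 :: complex ^ 'n) r) * u z)
        \<le> (\<integral>\<^sup>+y. ennreal (u y) * indicator (ball z r) y \<partial>lborel)"
      by (rule mean) (use r in auto)
    also have "\<dots> \<le> (\<integral>\<^sup>+y. ennreal X * ennreal (u y powr p * indicator (ball 0 (1/2)) y) \<partial>lborel)"
    proof (rule nn_integral_mono)
      fix y
      show "ennreal (u y) * indicator (ball z r) y \<le> ennreal X * ennreal (u y powr p * indicator (ball 0 (1/2)) y)"
      proof (cases "y \<in> ball z r")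
        case True
        hence y2: "y \<in> ball 0 (1/2)" using sub by blast
        have "ennreal (u y) \<le> ennreal (X * u y powr
            p)" using uy[OF True] by (intro ennreal_leI) (simp add: mult.commute)
        thus ?thesis using True y2 X0 by (simp add: ennreal_mult)
      qed simp
    qed
    also have "\<dots> = ennreal X * (\<integral>\<^sup>+y. ennreal (u y powr p * indicator (ball 0 (1/2)) y) \<partial>lborel)"
      by (rule nn_integral_cmult) (use meas in measurable)
    also have "\<dots> \<le> ennreal X * ennreal Q"
      using Q(1) by (intro mult_left_mono) (auto simp: ennreal_mult'' ennreal_indicator)
    finally have "measure lborel (ball (0 :: complex ^ 'n) r) * u z \<le> X * Q"
      using X0 Q(2) by (simp flip: ennreal_mult)
    hence le: "v * r powr (2 * real CARD('n)) * u z \<le> X * Q"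
      using r by (simp add: content_ball v_def powr_realpow[symmetric] mult.commute[of _ 2])
    have "X = M powr (1 - p) * r powr (- N * (1 - p))" using M0 r by (simp add: X_def powr_mult powr_powr)
    \<comment> \<open>This is where N = 2n/p comes from: the volume factor r^(2n) cancels and r^N is
      left in front of \<open>u z\<close>.\<close>
    moreover have "- N * (1 - p) = 2 * real CARD('n) - N" using p by (simp add: N_def field_simps)
    ultimately have X: "X = M powr (1 - p) * (r powr (2 * real CARD('n)) / r powr N)" by (simp add: powr_diff)
    have "r powr (2 * real CARD('n)) > 0" "r powr N > 0" using r by auto
    hence "r powr N * u z \<le> M powr (1 - p) * Q / v" using le v unfolding X by (simp add: field_simps)
    hence "2 powr N * (r powr N * u z) \<le> 2 powr N * (M powr (1 - p) * Q / v)" by (intro mult_left_mono) auto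
    moreover have "f z = 2 powr N * (r powr N * u z)"
    proof -
      have "1/2 - norm z = 2 * r" by (simp add: r_def)
      thus ?thesis using r by (simp add: f_def powr_mult)
    qed
    ultimately show ?thesis by (simp add: W_def mult_ac)
  qed
  have "M \<le> W powr (1 / p)"
  proof (cases "M = 0")
    case False
    hence Mp: "M > 0" using M0 by simp
    \<comment> \<open>The pointwise bound passes to the supremum. Since \<open>M\<close> is finite
      and positive, its power with exponent 1 - p can be cancelled.\<close>
    have "M \<le> W * M powr (1 - p)" unfolding M_def[symmetric]
      by (subst (1) M_def) (intro cSUP_least, auto intro: step[OF _ Mp])
    moreover have "M = M powr p * M powr (1 - p)" using Mp by (simp flip: powr_add)
    ultimately have "M powr p * M powr (1 - p) \<le> W * M powr (1 - p)" by simp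
    hence "M powr p \<le> W" using Mp by simp
    hence "(M powr p) powr (1 / p) \<le> W powr (1 / p)" using p by (intro powr_mono2) auto
    thus ?thesis using Mp p by (simp add: powr_powr)
  qed simp
  moreover have "u 0 = 2 powr N * f 0" using u0 by (simp add: f_def powr_divide)
  ultimately have "u 0 \<le> 2 powr N * W powr (1 / p)" using fM[of 0] by (simp add: mult_left_mono order.trans)
  thus ?thesis by (simp add: W_def)
qed

text \<open>The modular controls the integral of p-th powers over the half ball, where the weight is
  bounded below; the self-improved mean value inequality reaches the origin from there.\<close>

lemma point_evaluation_bound:
  assumes a: "\<alpha> > -1" and \<Phi>: "\<Phi> \<in> class_L p" and p: "0 < p" "p \<le> 1"
  shows "\<exists>C\<ge>0. \<forall>g :: complex ^ 'n \<Rightarrow> complex. integrable (nu \<alpha>) g \<longrightarrow>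
    (\<integral>\<^sup>+z. ennreal (\<Phi> (norm (bergman_proj \<alpha> g z))) \<partial>nu \<alpha>) \<le> 1 \<longrightarrow> norm (bergman_proj \<alpha> g 0) \<le> C"
proof -
  let ?s = "real CARD('n) + 1 + \<alpha>"
  have s: "?s \<ge> 0" using a by (simp add: add_nonneg_nonneg add.assoc)
  have gr: "growth_function \<Phi>" using \<Phi> by (simp add: class_L_def)
  obtain c where c: "c > 0" "\<And>t. t \<ge> 1 \<Longrightarrow> t powr p \<le> c * \<Phi> t" using class_L_ge_powr[OF \<Phi>] by blast
  \<comment> \<open>On the half ball the base of the weight lies between 3/4 and 1; the minimum
    covers both signs of \<alpha>.\<close>
  define w0 where "w0 = c_const TYPE('n) \<alpha> * min 1 ((3/4) powr \<alpha>)"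
  have w0: "w0 > 0" using c_const_pos[OF a, where 'n='n] by (simp add: w0_def)
  have wt_ge: "wt \<alpha> y \<ge> w0" if y: "norm y < 1/2" for y :: "complex ^ 'n"
  proof -
    have "(norm y)\<^sup>2 \<le> (1/2)\<^sup>2" using y by (intro power_mono) auto
    hence ny: "3/4 \<le> 1 - (norm y)\<^sup>2" "1 - (norm y)\<^sup>2 \<le> 1" by (auto simp: power2_eq_square)
    have "min 1 ((3/4) powr \<alpha>) \<le> (1 - (norm y)\<^sup>2) powr \<alpha>"
    proof (cases "\<alpha> \<ge> 0")
      case True thus ?thesis using ny powr_mono2[of \<alpha> "3/4" "1 - (norm y)\<^sup>2"] by simp
    next
      case False thus ?thesis using ny powr_mono2'[of \<alpha> "1 - (norm y)\<^sup>2" 1] by simp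
    qed
    thus ?thesis using y c_const_pos[OF a, where 'n='n] unfolding wt_def w0_def by (simp add: mult_left_mono)
  qed
  define vol where "vol = measure lborel (ball (0 :: complex ^ 'n) (1/2))"
  define Q where "Q = vol + c / w0"
  have Q0: "Q \<ge> 0" using c w0 by (simp add: Q_def vol_def)
  define C where "C = 2 powr (2 * real CARD('n) / p) * (2 powr (2 * real CARD('n) / p)
      * Q / unit_ball_vol (real (2 * CARD('n)))) powr (1 / p)"
  show ?thesis
  proof (intro exI[of _ C] conjI allI impI)
    show "C \<ge> 0" by (simp add: C_def)
    fix g :: "complex ^ 'n \<Rightarrow> complex"
    assume ig: "integrable (nu \<alpha>) g" and le1: "(\<integral>\<^sup>+z. ennreal (\<Phi> (norm (bergman_proj \<alpha> g z))) \<partial>nu \<alpha>) \<le> 1"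
    define u where "u y = norm (bergman_proj \<alpha> g y)" for y
    have [measurable]: "g \<in> borel_measurable (nu \<alpha>)" using ig by auto
    have mP: "bergman_proj \<alpha> g \<in> borel_measurable (nu \<alpha>)" by (rule measurable_bergman_proj[OF a]) measurable
    hence [measurable]: "(\<lambda>y. indicator unit_ball y *\<^sub>R bergman_proj \<alpha> g y) \<in> borel_measurable borel"
      by (simp only: borel_measurable_nu_iff)
    have m\<Phi>: "(\<lambda>y. \<Phi> (u y)) \<in> borel_measurable (nu \<alpha>)"
      unfolding u_def using mP by (intro growth_measurable[OF gr]) auto
    show "norm (bergman_proj \<alpha> g 0) \<le> C"
      unfolding C_def u_def[symmetric]
    proof (rule sub_mean_self_improve[OF p])
      show "u y \<ge> 0" for y by (simp add: u_def)
      show "u z \<le> enn2real (\<integral>\<^sup>+\<xi>. ennreal (norm (g \<xi>)) \<partial>nu \<alpha>) * 2 powr ?s" if z: "norm z < 1/2" for z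
      proof -
        have fin: "(\<integral>\<^sup>+\<xi>. ennreal (norm (g \<xi>)) \<partial>nu \<alpha>) < \<infinity>" using ig by (simp add: integrable_iff_bounded)
        have "ennreal (u z) \<le> (\<integral>\<^sup>+\<xi>. ennreal (norm (g \<xi>)) * ennreal (norm (bkern ?s z \<xi>)) \<partial>nu \<alpha>)"
          unfolding u_def using z by (intro norm_bergman_proj_le) simp
        also have "\<dots> \<le> (\<integral>\<^sup>+\<xi>. ennreal (norm (g \<xi>)) * ennreal (2 powr ?s) \<partial>nu \<alpha>)"
        proof (intro nn_integral_mono mult_left_mono ennreal_leI)
          fix \<xi> :: "complex ^ 'n" assume "\<xi> \<in> space (nu \<alpha>)"
          hence "norm z * norm \<xi> \<le> 1/2 * 1" using z by (intro mult_mono) auto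
          hence "norm (bkern ?s z \<xi>) \<le> (1 - 1/2) powr (- ?s)" using s by (intro norm_bkern_le) auto
          also have "\<dots> = 2 powr ?s"
          proof -
            have "(1 - 1/2) powr (- x) = 2 powr x" for x :: real by (simp add: powr_minus_divide powr_divide)
            thus ?thesis .
          qed
          finally show "norm (bkern ?s z \<xi>) \<le> 2 powr ?s" .
        qed simp
        also have "\<dots> = (\<integral>\<^sup>+\<xi>. ennreal (norm (g \<xi>)) \<partial>nu \<alpha>)
            * ennreal (2 powr ?s)" by (rule nn_integral_multc) measurable
        also have "\<dots> = ennreal (enn2real (\<integral>\<^sup>+\<xi>. ennreal (norm (g \<xi>)) \<partial>nu \<alpha>) * 2 powr ?s)"
          using fin by (simp add: ennreal_mult)
        finally show ?thesis by (subst (asm) ennreal_le_iff) auto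
      qed
      show "ennreal (measure lborel (ball (0 :: complex ^ 'n) r) * u z)
          \<le> (\<integral>\<^sup>+y. ennreal (u y) * indicator (ball z r) y \<partial>lborel)"
        if "r > 0" "norm z + r < 1/2" for z r
        unfolding u_def using that by (intro bergman_proj_sub_mean[OF a ig]) auto
      show "Q \<ge> 0" by (rule Q0)
      have "(\<lambda>y. u y powr p * indicator (ball 0 (1/2)) y)
          = (\<lambda>y. norm (indicator unit_ball y *\<^sub>R bergman_proj \<alpha> g y) powr p * indicator (ball 0 (1/2)) y)"
        by (auto simp: u_def indicator_def fun_eq_iff)
      also have "\<dots> \<in> borel_measurable borel" by measurable
      finally show "(\<lambda>y. u y powr p * indicator (ball 0 (1/2)) y) \<in> borel_measurable borel" .
      have "(\<integral>\<^sup>+y. ennreal (u y powr p) * indicator (ball 0 (1/2)) y \<partial>lborel)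
        \<le> (\<integral>\<^sup>+y. indicator (ball (0 :: complex ^ 'n) (1/2)) y + ennreal (c / w0) * (ennreal (wt \<alpha> y) * ennreal (\<Phi> (u y))) \<partial>lborel)"
      proof (rule nn_integral_mono)
        fix y :: "complex ^ 'n"
        show "ennreal (u y powr p) * indicator (ball 0 (1/2)) y
            \<le> indicator (ball 0 (1/2)) y + ennreal (c / w0) * (ennreal (wt \<alpha> y) * ennreal (\<Phi> (u y)))"
        proof (cases "norm y < 1/2")
          case True
          have \<Phi>0: "\<Phi> (u y) \<ge> 0" by (rule growth_nonneg[OF gr]) (simp add: u_def)
          have "u y powr p \<le> 1 + c * \<Phi> (u y)"
          proof (cases "u y \<ge> 1")
            case True thus ?thesis using c(2)[OF True] by simp
          next
            case False
            hence "u y powr p \<le> 1" using p by (intro powr_le1) (auto simp: u_def)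
            moreover have "c * \<Phi> (u y) \<ge> 0" using c \<Phi>0 by simp
            ultimately show ?thesis by linarith
          qed
          also have "c * \<Phi> (u y) \<le> c / w0 * (wt \<alpha> y * \<Phi> (u y))"
          proof -
            have "c / w0 * (w0 * \<Phi> (u y)) \<le> c / w0 * (wt \<alpha> y * \<Phi> (u y))"
              using c w0 \<Phi>0 wt_ge[OF True] by (intro mult_left_mono mult_right_mono) auto
            thus ?thesis using w0 by simp
          qed
          finally have "ennreal (u y powr p) \<le> ennreal (1 + c / w0 * (wt \<alpha> y * \<Phi> (u y)))" by (simp add: ennreal_leI)
          also have "\<dots> = 1 + ennreal (c / w0) * (ennreal (wt \<alpha> y) * ennreal (\<Phi> (u y)))"
            using c w0 \<Phi>0 wt_nonneg[OF a, of y] by (subst ennreal_plus) (auto simp: ennreal_mult[symmetric] simp del: ennreal_plus)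
          finally show ?thesis using True by simp
        qed simp
      qed
      also have "\<dots> = emeasure lborel (ball (0 :: complex ^ 'n) (1/2))
          + ennreal (c / w0) * (\<integral>\<^sup>+y. ennreal (wt \<alpha> y) * ennreal (\<Phi> (u y)) \<partial>lborel)"
      proof -
        have "(\<lambda>y. \<Phi> (u y)) \<in> borel_measurable (nu \<alpha>)" by (rule m\<Phi>)
        hence [measurable]: "(\<lambda>y. indicator unit_ball y *\<^sub>R \<Phi> (u y)) \<in> borel_measurable borel"
          by (simp only: borel_measurable_nu_iff)
        have "(\<lambda>y. ennreal (wt \<alpha> y) * ennreal (\<Phi> (u y)))
            = (\<lambda>y. ennreal (wt \<alpha> y) * ennreal (indicator unit_ball y *\<^sub>R \<Phi> (u y)))"
          by (auto simp: wt_def indicator_def fun_eq_iff)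
        also have "\<dots> \<in> borel_measurable borel" by measurable
        finally have [measurable]: "(\<lambda>y. ennreal (wt \<alpha> y) * ennreal (\<Phi> (u y))) \<in> borel_measurable borel" .
        show ?thesis by (subst nn_integral_add, simp, measurable, subst nn_integral_cmult) auto
      qed
      also have "(\<integral>\<^sup>+y. ennreal (wt \<alpha> y) * ennreal (\<Phi> (u y)) \<partial>lborel) = (\<integral>\<^sup>+y. ennreal (\<Phi> (u y)) \<partial>nu \<alpha>)"
        by (rule nn_integral_nu[OF a, symmetric]) (rule measurable_compose[OF m\<Phi> measurable_ennreal])
      also have "emeasure lborel (ball (0 :: complex ^ 'n) (1/2)) + ennreal (c / w0) * \<dots>
          \<le> ennreal vol + ennreal (c / w0) * 1"
        using le1 emeasure_lborel_ball_finite[of "0 :: complex ^ 'n" "1/2"]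
        by (intro add_mono mult_left_mono) (auto simp: vol_def u_def emeasure_eq_ennreal_measure)
      also have "\<dots> = ennreal Q" using c w0 by (simp add: Q_def vol_def)
      finally show "(\<integral>\<^sup>+y. ennreal (u y powr p) * indicator (ball 0 (1/2)) y \<partial>lborel) \<le> ennreal Q" .
    qed
  qed
qed

section \<open>Bounded Hankel operators\<close>

text \<open>The Dini condition supplies the lower exponent above 1; convexity and differentiability
  at interior points supply the supporting lines for Jensen's inequality.\<close>

lemma class_U_convex_growth:
  assumes \<Phi>: "\<Phi> \<in> class_U q" and q: "q \<ge> 1"
    and Dini: "\<exists>C>0. \<forall>t>0. (\<integral>\<^sup>+ s\<in>{0<..<t}. ennreal (\<Phi> s / s\<^sup>2) \<partial>lborel) \<le> ennreal (C * (\<Phi> t / t))"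
  shows "\<exists>\<eta>. convex_growth \<Phi> \<eta> q"
proof -
  have gr: "growth_function \<Phi>" and up: "upper_type q \<Phi>" and mono: "mono_on {0<..} (\<lambda>t. \<Phi> t / t)"
    and conv: "convex_on {0..} \<Phi>" and reg: "regular_growth \<Phi>" using \<Phi> by (auto simp: class_U_def)
  from Dini obtain C where "C > 0" "\<And>t. t > 0 \<Longrightarrow> (\<integral>\<^sup>+ s\<in>{0<..<t}. ennreal (\<Phi> s / s\<^sup>2) \<partial>lborel)
      \<le> ennreal (C * (\<Phi> t / t))" by blast
  from Dini_imp_lower_type[OF gr mono this] obtain \<eta> where \<eta>: "\<eta> > 0"
    "\<And>s t. 0 < s \<Longrightarrow> s \<le> 1 \<Longrightarrow> 0 \<le> t \<Longrightarrow> \<Phi> (s * t) \<le> 2 * s powr (1 + \<eta>) * \<Phi> t" by blast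
  have "convex_growth \<Phi> \<eta> q"
  proof
    show "q > 0" using q by simp
    from up obtain A where A: "A > 0" "\<And>s u. s > 0 \<Longrightarrow> u \<ge> 1 \<Longrightarrow> \<Phi> (s * u) \<le> A * u powr q * \<Phi> s"
      unfolding upper_type_def by blast
    show "\<exists>C\<ge>0. \<forall>u t. 1 \<le> u \<longrightarrow> 0 \<le> t \<longrightarrow> \<Phi> (u * t) \<le> C * u powr (1 + q) * \<Phi> t"
    proof (intro exI[of _ A] conjI allI impI)
      fix u t :: real assume u: "1 \<le> u" and t: "0 \<le> t"
      show "\<Phi> (u * t) \<le> A * u powr (1 + q) * \<Phi> t"
      proof (cases "t = 0")
        case False
        have "\<Phi> (u * t) \<le> A * u powr q * \<Phi> t" using A(2)[of t u] u t False by (simp add: mult.commute)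
        also have "\<dots> \<le> A * u powr (1 + q) * \<Phi> t"
          using A(1) u growth_nonneg[OF gr t] by (intro mult_right_mono mult_left_mono powr_mono) auto
        finally show ?thesis .
      qed (use gr in simp)
    qed (use A in simp)
    fix y :: real assume y: "y > 0"
    have "\<Phi> differentiable (at y)"
      using reg y by (auto simp: regular_growth_def C1_differentiable_on_eq)
    then obtain m where "(\<Phi> has_real_derivative m) (at y)"
      using real_differentiable_def by blast
    hence m: "(\<Phi> has_real_derivative m) (at y within {0..})" by (rule has_field_derivative_at_within)
    have "interior {0::real..} = {0<..}" by (rule interior_real_atLeast)
    hence "\<Phi> x - \<Phi> y \<ge> m * (x - y)" if "x \<ge> 0" for x
      using that y by (intro convex_on_imp_above_tangent[OF conv _ _ _ m]) auto
    hence "\<forall>x\<ge>0. \<Phi> y + m * (x - y) \<le> \<Phi> x" by (auto simp: algebra_simps)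
    thus "\<exists>m. \<forall>x\<ge>0. \<Phi> y + m * (x - y) \<le> \<Phi> x" by blast
  qed (use gr mono \<eta> class_U_pos[OF \<Phi>] in auto)
  thus ?thesis ..
qed

lemma lux_norm_le:
  "l > 0 \<Longrightarrow> (\<integral>\<^sup>+ z. ennreal (\<Phi> (norm (f z) / l)) \<partial>nu \<alpha>) \<le> 1 \<Longrightarrow> lux_norm \<alpha> \<Phi> f \<le> ennreal l"
  unfolding lux_norm_def by (rule Inf_lower) auto

lemma lux_norm_lessE:
  assumes "lux_norm \<alpha> \<Phi> f < ennreal L"
  obtains l where "0 < l" "l < L" "(\<integral>\<^sup>+ z. ennreal (\<Phi> (norm (f z) / l)) \<partial>nu \<alpha>) \<le> 1"
  using assms unfolding lux_norm_def Inf_less_iff by (auto simp: ennreal_less_iff)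

context convex_growth
begin

text \<open>The constant depends neither on \<rho> nor on \<open>B\<close>, only on the modular
  bound for \<open>g\<close>; this is what survives the exhaustion of the ball.\<close>

lemma hankel_pairing_bound:
  fixes b :: "complex ^ 'n \<Rightarrow> complex"
  assumes a: "\<alpha> > -1" and \<Phi>2: "\<Phi>2 \<in> class_L p" and p: "0 < p" "p \<le> 1"
    and hb: "holomorphic_Cn b unit_ball" and ib: "integrable (nu \<alpha>) b"
    and hankel: "hankel_extends_bounded \<alpha> \<Phi> \<Phi>2 b"
  shows "\<exists>C\<ge>0. \<forall>g \<rho> B. g \<in> borel_measurable (nu \<alpha>) \<longrightarrow> 0 \<le> \<rho> \<longrightarrow> \<rho> < 1 \<longrightarrow> (\<forall>\<xi>. norm (g \<xi>) \<le> B) \<longrightarrow>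
    (\<forall>\<xi>. \<rho> < norm \<xi> \<longrightarrow> g \<xi> = 0) \<longrightarrow> (\<integral>\<^sup>+\<xi>. ennreal (\<Phi> (norm (g \<xi>))) \<partial>nu \<alpha>) \<le> 1 \<longrightarrow>
    norm (\<integral>\<xi>. b \<xi> * cnj (g \<xi>) \<partial>nu \<alpha>) \<le> C"
proof -
  have [measurable]: "b \<in> borel_measurable (nu \<alpha>)" by (rule holomorphic_Cn_measurable[OF hb])
  obtain H0 where H0: "\<And>f. f \<in> bounded_holomorphic \<Longrightarrow> lux_norm \<alpha> \<Phi>2 (small_hankel \<alpha> b f) \<le> ennreal H0 * lux_norm \<alpha> \<Phi> f"
    using hankel unfolding hankel_extends_bounded_def by blast
  \<comment> \<open>The given constant may be negative, in which case \<open>ennreal\<close> already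
    reads it as 0.\<close>
  define H where "H = max 0 H0"
  have H: "H \<ge> 0" "ennreal H0 = ennreal H" by (auto simp: H_def max_def ennreal_neg)
  obtain D0 where D0: "D0 \<ge> 0" and OB: "\<And>g :: complex ^ 'n \<Rightarrow> complex. g \<in> borel_measurable (nu \<alpha>) \<Longrightarrow>
      bounded (g ` unit_ball) \<Longrightarrow>
    (\<integral>\<^sup>+z. ennreal (\<Phi> (norm (bergman_proj \<alpha> g z))) \<partial>nu \<alpha>) \<le> ennreal D0 * (\<integral>\<^sup>+\<xi>. ennreal (\<Phi> (norm (g \<xi>))) \<partial>nu \<alpha>)"
    using bergman_proj_Orlicz_bound[OF a, where 'n='n] by blast
  define D where "D = D0 + 1"
  have D: "D \<ge> 1" "D0 \<le> D" using D0 by (auto simp: D_def)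
  obtain E where E: "E \<ge> 0" and PE: "\<And>g :: complex ^ 'n \<Rightarrow> complex. integrable (nu \<alpha>) g \<Longrightarrow>
    (\<integral>\<^sup>+z. ennreal (\<Phi>2 (norm (bergman_proj \<alpha> g z))) \<partial>nu \<alpha>) \<le> 1 \<Longrightarrow> norm (bergman_proj \<alpha> g 0) \<le> E"
    using point_evaluation_bound[OF a \<Phi>2 p, where 'n='n] by blast
  show ?thesis
  proof (intro exI[of _ "E * (H * D + 1)"] conjI allI impI)
    show "E * (H * D + 1) \<ge> 0" using E H D by simp
    fix g :: "complex ^ 'n \<Rightarrow> complex" and \<rho> B :: real
    assume [measurable]: "g \<in> borel_measurable (nu \<alpha>)" and \<rho>: "0 \<le> \<rho>" "\<rho> < 1" and "\<forall>\<xi>. norm (g \<xi>) \<le> B"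
      and "\<forall>\<xi>. \<rho> < norm \<xi> \<longrightarrow> g \<xi> = 0" and g1: "(\<integral>\<^sup>+\<xi>. ennreal (\<Phi> (norm (g \<xi>))) \<partial>nu \<alpha>) \<le> 1"
    hence B: "\<And>\<xi>. norm (g \<xi>) \<le> B" and supp: "\<And>\<xi>. \<rho> < norm \<xi> \<Longrightarrow> g \<xi> = 0" by blast+
    define f where "f = bergman_proj \<alpha> g"
    have f: "f \<in> bounded_holomorphic"
      unfolding f_def by (rule bergman_proj_bounded_holomorphic[OF a _ \<rho> B supp]) measurable
    obtain L where L: "\<And>z. norm z < 1 \<Longrightarrow> norm (f z) \<le> L"
    proof -
      have "bounded (f ` unit_ball)" using f by (simp add: bounded_holomorphic_def)
      thus ?thesis using that unfolding bounded_iff by (meson imageI mem_ball_0)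
    qed
    have [measurable]: "f \<in> borel_measurable (nu \<alpha>)"
      using f by (auto simp: bounded_holomorphic_def intro: holomorphic_Cn_measurable)
    have [measurable]: "(\<lambda>z. \<Phi> (norm (f z))) \<in> borel_measurable (nu \<alpha>)" by (rule growth_measurable[OF growth]) auto
    have bg: "bounded (g ` unit_ball)" using B by (auto intro: boundedI)
    have "(\<integral>\<^sup>+z. ennreal (\<Phi> (norm (f z) / D)) \<partial>nu \<alpha>) \<le> (\<integral>\<^sup>+z. ennreal (1 / D) * ennreal (\<Phi> (norm (f z))) \<partial>nu \<alpha>)"
    proof (rule nn_integral_mono)
      fix z
      have "\<Phi> (norm (f z) / D) \<le> 1 / D * \<Phi> (norm (f z))" using growth_divide_le[OF growth ratio_mono _ D(1)] by simp
      thus "ennreal (\<Phi> (norm (f z) / D)) \<le> ennreal (1 / D) * ennreal (\<Phi> (norm (f z)))"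
        using D growth_nonneg[OF growth, of "norm (f z)"] by (subst ennreal_mult[symmetric]) (auto intro: ennreal_leI)
    qed
    also have "\<dots> = ennreal (1 / D) * (\<integral>\<^sup>+z. ennreal (\<Phi> (norm (f z))) \<partial>nu \<alpha>)" by (rule nn_integral_cmult) measurable
    also have "\<dots> \<le> ennreal (1 / D) * (ennreal D * 1)"
      unfolding f_def using D
      by (intro mult_left_mono order.trans[OF OB] mult_mono ennreal_leI g1 bg) auto
    also have "\<dots> = 1" using D by (simp flip: ennreal_mult)
    finally have "lux_norm \<alpha> \<Phi> f \<le> ennreal D" using D by (intro lux_norm_le) auto
    hence "lux_norm \<alpha> \<Phi>2 (small_hankel \<alpha> b f) \<le> ennreal H * ennreal D"
      using H0[OF f] H(2) by (metis mult_left_mono order.trans zero_le)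
    \<comment> \<open>The infimum need not be attained; the added 1 gives a strict inequality and
      with it an admissible \<open>l\<close>.\<close>
    also have "\<dots> < ennreal (H * D + 1)" using H D by (simp add: ennreal_less_iff flip: ennreal_mult)
    finally obtain l where l: "0 < l" "l < H * D + 1" "(\<integral>\<^sup>+ z. ennreal (\<Phi>2 (norm (small_hankel \<alpha> b f z) / l))
        \<partial>nu \<alpha>) \<le> 1"
      by (rule lux_norm_lessE)
    define k where "k \<xi> = b \<xi> * cnj (f \<xi>) / of_real l" for \<xi>
    have bf: "integrable (nu \<alpha>) (\<lambda>\<xi>. b \<xi> * cnj (f \<xi>))"
    proof (rule Bochner_Integration.integrable_bound[OF integrable_mult_right[OF integrable_norm[OF ib], of L]])
      show "AE \<xi> in nu \<alpha>. norm (b \<xi> * cnj (f \<xi>)) \<le> norm (L * norm (b \<xi>))"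
      proof (rule AE_I2)
        fix \<xi> :: "complex ^ 'n" assume "\<xi> \<in> space (nu \<alpha>)"
        hence "norm (f \<xi>) \<le> L" using L by simp
        hence "norm (b \<xi>) * norm (f \<xi>) \<le> L * norm (b \<xi>)" by (metis mult.commute mult_right_mono norm_ge_zero)
        thus "norm (b \<xi> * cnj (f \<xi>)) \<le> norm (L * norm (b \<xi>))" by (simp add: norm_mult)
      qed
    qed measurable
    hence ik: "integrable (nu \<alpha>) k" unfolding k_def by simp
    have kP: "small_hankel \<alpha> b f z = of_real l * bergman_proj \<alpha> k z" for z
      unfolding small_hankel_def bergman_proj_def k_def using l
      by (subst integral_mult_right_zero[symmetric]) (simp add: field_simps)
    have "norm (bergman_proj \<alpha> k 0) \<le> E"
    proof (rule PE[OF ik])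
      have "norm (small_hankel \<alpha> b f z) / l = norm (bergman_proj \<alpha> k z)" for z using l by (simp add: kP norm_mult)
      thus "(\<integral>\<^sup>+z. ennreal (\<Phi>2 (norm (bergman_proj \<alpha> k z))) \<partial>nu \<alpha>) \<le> 1" using l(3) by simp
    qed
    hence "norm (small_hankel \<alpha> b f 0) \<le> l * E" using l by (simp add: kP norm_mult)
    also have "\<dots> \<le> E * (H * D + 1)" using l E by (subst mult.commute) (intro mult_left_mono, auto)
    \<comment> \<open>At the origin the form vanishes, so the kernel is 1 and the operator becomes a
      plain integral.\<close>
    also have "small_hankel \<alpha> b f 0 = (\<integral>\<xi>. b \<xi> * cnj (f \<xi>) \<partial>nu \<alpha>)"
      unfolding small_hankel_def bergman_proj_def by simp
    also have "\<dots> = (\<integral>\<xi>. b \<xi> * cnj (g \<xi>) \<partial>nu \<alpha>)"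
      unfolding f_def by (rule bergman_proj_self_adjoint[OF a _ \<rho> B supp hb ib]) measurable
    finally show "norm (\<integral>\<xi>. b \<xi> * cnj (g \<xi>) \<partial>nu \<alpha>) \<le> E * (H * D + 1)" .
  qed
qed

lemma complementary_0 [simp]: "complementary \<Phi> 0 = 0"
  using complementary_nonneg[of 0] complementary_le[of 0 0] growth_nonneg[OF growth] by (auto intro: antisym)

text \<open>The extremal function for the pairing is a multiple of \<open>sgn b * \<Psi> x / x\<close> with \<open>x = |b| / \<lambda>\<close>; cutting it
  off and dividing by its modular would contradict the pairing bound if the modular exceeded \<open>1\<close>.\<close>

lemma symbol_if_hankel_bounded:
  fixes b :: "complex ^ 'n \<Rightarrow> complex"
  assumes a: "\<alpha> > -1" and \<Phi>2: "\<Phi>2 \<in> class_L p" and p: "0 < p" "p \<le> 1"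
    and hb: "holomorphic_Cn b unit_ball" and ib: "integrable (nu \<alpha>) b"
    and hankel: "hankel_extends_bounded \<alpha> \<Phi> \<Phi>2 b"
  shows "b \<in> bergman_orlicz \<alpha> (complementary \<Phi>)"
proof -
  let ?\<Psi> = "complementary \<Phi>"
  have [measurable]: "b \<in> borel_measurable (nu \<alpha>)" by (rule holomorphic_Cn_measurable[OF hb])
  interpret nu: finite_measure "nu \<alpha> :: (complex ^ 'n) measure" by (rule finite_measure_nu[OF a])
  obtain C where C: "C \<ge> 0" and P: "\<forall>g \<rho> B. g \<in> borel_measurable (nu \<alpha>) \<longrightarrow> 0 \<le> \<rho> \<longrightarrow> \<rho> < 1 \<longrightarrow> (\<forall>\<xi>. norm (g \<xi>) \<le> B) \<longrightarrow>
    (\<forall>\<xi>. \<rho> < norm \<xi> \<longrightarrow> g \<xi> = 0) \<longrightarrow> (\<integral>\<^sup>+\<xi>. ennreal (\<Phi> (norm (g \<xi>))) \<partial>nu \<alpha>) \<le> 1 \<longrightarrow>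
    norm (\<integral>\<xi>. b \<xi> * cnj (g \<xi>) \<partial>nu \<alpha>) \<le> C"
    using hankel_pairing_bound[OF a \<Phi>2 p hb ib hankel] by (elim exE conjE) (rule that)
  note pair = P[rule_format]
  \<comment> \<open>The contradiction below comes from a pairing of exactly l/2, which must exceed
    \<open>C\<close>.\<close>
  define l where "l = 2 * C + 2"
  have l: "l \<ge> 1" "l / 2 > C" using C by (auto simp: l_def)
  define x where "x \<xi> = norm (b \<xi>) / l" for \<xi>
  have x0: "x \<xi> \<ge> 0" for \<xi> using l by (simp add: x_def)
  have [measurable]: "x \<in> borel_measurable (nu \<alpha>)" unfolding x_def by measurable
  have \<Psi>x: "(\<lambda>\<xi>. ?\<Psi> (x \<xi>)) \<in> borel_measurable (nu \<alpha>)"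
    by (rule measurable_compose[OF _ measurable_complementary]) measurable
  note [measurable] = this
  have cut: "(\<integral>\<^sup>+\<xi>. ennreal (?\<Psi> (x \<xi>)) * indicator (cball 0 \<rho>) \<xi> \<partial>nu \<alpha>) \<le> 1" if \<rho>: "0 \<le> \<rho>" "\<rho> < 1" for \<rho>
  proof -
    have [measurable]: "cball (0 :: complex ^ 'n) \<rho> \<in> sets borel" by (auto intro: borel_closed)
    have indm [measurable]: "(indicator (cball 0 \<rho>) :: complex ^ 'n \<Rightarrow> real) \<in> borel_measurable (nu \<alpha>)"
      by (rule measurable_nu_borel) measurable
    have "compact (b ` cball 0 \<rho>)"
      using \<rho> by (intro compact_continuous_image continuous_on_subset[OF holomorphic_Cn_continuous_on[OF hb]]) auto
    then obtain b1 where b1: "\<And>\<xi>. norm \<xi> \<le> \<rho> \<Longrightarrow> norm (b \<xi>) \<le> b1"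
      using compact_imp_bounded bounded_iff by (metis imageI mem_cball_0)
    define Y where "Y = ?\<Psi> (b1 / l)"
    have Y: "?\<Psi> (x \<xi>) \<le> Y" if "norm \<xi> \<le> \<rho>" for \<xi>
      unfolding Y_def x_def using b1[OF that] l by (intro complementary_mono divide_right_mono) auto
    have Y0: "Y \<ge> 0" by (simp add: Y_def complementary_nonneg)
    obtain T where T: "T > 0" "\<And>t. t \<ge> T \<Longrightarrow> 1 * t \<le> \<Phi> t" using superlinear by blast
    \<comment> \<open>Where \<open>b\<close> vanishes, division by zero gives the value 0. The
      factor 2 is the one for which \<Phi> of this ratio is at most the complementary
      function.\<close>
    define m where "m \<xi> = ?\<Psi> (x \<xi>) / (2 * x \<xi>)" for \<xi>
    have m0: "m \<xi> \<ge> 0" for \<xi> using x0 complementary_nonneg by (simp add: m_def)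
    have \<Phi>m: "\<Phi> (m \<xi>) \<le> ?\<Psi> (x \<xi>)" for \<xi>
    proof (cases "x \<xi> = 0")
      case True thus ?thesis using growth by (simp add: m_def)
    next
      case False thus ?thesis using growth_complementary_ratio[of "x \<xi>"] x0[of \<xi>] by (simp add: m_def)
    qed
    have mb: "m \<xi> \<le> max T Y" if "norm \<xi> \<le> \<rho>" for \<xi>
      using T(2)[of "m \<xi>"] \<Phi>m[of \<xi>] Y[OF that] by (cases "m \<xi> \<ge> T") auto
    \<comment> \<open>The cut-off to a smaller ball makes this integral finite before anything is
      known about \<open>b\<close> near the boundary.\<close>
    define J where "J = (\<integral>\<xi>. ?\<Psi> (x \<xi>) * indicator (cball 0 \<rho>) \<xi> \<partial>nu \<alpha>)"
    have iJ: "integrable (nu \<alpha>) (\<lambda>\<xi>. ?\<Psi> (x \<xi>) * indicator (cball 0 \<rho>) \<xi>)"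
      by (rule nu.integrable_const_bound[where B=Y])
         (use Y Y0 complementary_nonneg in \<open>auto simp: indicator_def\<close>)
    have nJ: "(\<integral>\<^sup>+\<xi>. ennreal (?\<Psi> (x \<xi>) * indicator (cball 0 \<rho>) \<xi>) \<partial>nu \<alpha>) = ennreal J"
      unfolding J_def by (rule nn_integral_eq_integral[OF iJ]) (auto simp: complementary_nonneg)
    have "J \<le> 1"
    proof (rule ccontr)
      assume "\<not> J \<le> 1"
      hence J: "J > 1" by simp
      \<comment> \<open>If J > 1, then \<Phi> (m / J) \<le> \<Phi> m / J brings the modular of
        \<open>g\<close> down to at most 1, while the pairing with \<open>b\<close> equals l/2
        whatever \<open>J\<close> is.\<close>
      define g where "g \<xi> = of_real (indicator (cball 0 \<rho>) \<xi> * m \<xi> / J) * sgn (b \<xi>)" for \<xi>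
      have "m \<in> borel_measurable (nu \<alpha>)" unfolding m_def by measurable
      note [measurable] = this
      have [measurable]: "g \<in> borel_measurable (nu \<alpha>)" unfolding g_def sgn_div_norm by measurable
      have ng: "norm (g \<xi>) \<le> indicator (cball 0 \<rho>) \<xi> * m \<xi> / J" for \<xi>
        unfolding g_def norm_mult norm_of_real norm_sgn using J m0[of \<xi>] by simp
      have "norm (\<integral>\<xi>. b \<xi> * cnj (g \<xi>) \<partial>nu \<alpha>) \<le> C"
      proof (rule pair[OF _ \<rho>, where B="max T Y"])
        show "norm (g \<xi>) \<le> max T Y" for \<xi>
        proof (cases "norm \<xi> \<le> \<rho>")
          case True
          have "m \<xi> / J \<le> m \<xi>" using J mult_right_mono[of 1 J "m \<xi>"] m0[of \<xi>] by (simp add: field_simps)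
          thus ?thesis using ng[of \<xi>] mb[OF True] True by simp
        next
          case False thus ?thesis using ng[of \<xi>] T(1) by simp
        qed
        show "g \<xi> = 0" if "\<rho> < norm \<xi>" for \<xi> using that by (simp add: g_def)
        have "(\<integral>\<^sup>+\<xi>. ennreal (\<Phi> (norm (g \<xi>))) \<partial>nu \<alpha>)
            \<le> (\<integral>\<^sup>+\<xi>. ennreal (1 / J) * ennreal (?\<Psi> (x \<xi>) * indicator (cball 0 \<rho>) \<xi>) \<partial>nu \<alpha>)"
        proof (rule nn_integral_mono)
          fix \<xi>
          have "\<Phi> (norm (g \<xi>)) \<le> 1 / J * (?\<Psi> (x \<xi>) * indicator (cball 0 \<rho>) \<xi>)"
          proof (cases "norm \<xi> \<le> \<rho>")
            case True
            have "\<Phi> (norm (g \<xi>)) \<le> \<Phi> (m \<xi> / J)" using ng[of \<xi>] True by (intro growth_mono[OF growth]) auto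
            also have "\<dots> \<le> \<Phi> (m \<xi>) / J" using J m0 by (intro growth_divide_le[OF growth ratio_mono]) auto
            also have "\<dots> \<le> ?\<Psi> (x \<xi>) / J" using J \<Phi>m by (intro divide_right_mono) auto
            finally show ?thesis using True by simp
          next
            case False thus ?thesis using growth by (simp add: g_def)
          qed
          thus "ennreal (\<Phi> (norm (g \<xi>))) \<le> ennreal (1 / J) * ennreal (?\<Psi> (x \<xi>) * indicator (cball 0 \<rho>) \<xi>)"
            using J complementary_nonneg[of "x \<xi>"] by (subst ennreal_mult[symmetric]) (auto intro: ennreal_leI)
        qed
        also have "\<dots> = ennreal (1 / J) * ennreal J" unfolding nJ[symmetric] by (rule nn_integral_cmult) measurable
        also have "\<dots> = 1" using J by (simp flip: ennreal_mult)
        finally show "(\<integral>\<^sup>+\<xi>. ennreal (\<Phi> (norm (g \<xi>))) \<partial>nu \<alpha>) \<le> 1" .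
      qed measurable
      moreover have "(\<integral>\<xi>. b \<xi> * cnj (g \<xi>) \<partial>nu \<alpha>) = of_real (l / 2)"
      proof -
        have "b \<xi> * cnj (g \<xi>) = of_real (l / (2 * J) * (?\<Psi> (x \<xi>) * indicator (cball 0 \<rho>) \<xi>))" for \<xi>
        proof (cases "b \<xi> = 0")
          case True thus ?thesis by (simp add: x_def)
        next
          case False
          have "b \<xi> * cnj (sgn (b \<xi>)) = of_real (norm (b \<xi>))"
            using False by (simp add: sgn_div_norm scaleR_conv_of_real complex_norm_square[symmetric] power2_eq_square field_simps)
          hence "b \<xi> * cnj (g \<xi>) = of_real (norm (b \<xi>) * (indicator (cball 0 \<rho>) \<xi> * m \<xi> / J))"
            by (simp add: g_def mult_ac)
          also have "norm (b \<xi>) * (indicator (cball 0 \<rho>) \<xi> * m \<xi> / J)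
              = l / (2 * J) * (?\<Psi> (x \<xi>) * indicator (cball 0 \<rho>) \<xi>)"
            using False l J by (simp add: m_def x_def field_simps)
          finally show ?thesis .
        qed
        hence "(\<integral>\<xi>. b \<xi> * cnj (g \<xi>) \<partial>nu \<alpha>) = of_real (l / (2 * J) * J)"
          unfolding J_def by (simp only: integral_complex_of_real integral_mult_right_zero)
        thus ?thesis using J by simp
      qed
      ultimately show False using l C by simp
    qed
    moreover have "(\<integral>\<^sup>+\<xi>. ennreal (?\<Psi> (x \<xi>)) * indicator (cball 0 \<rho>) \<xi> \<partial>nu \<alpha>) = ennreal J"
      unfolding nJ[symmetric] by (intro nn_integral_cong) (simp add: ennreal_mult'' ennreal_indicator)
    ultimately show ?thesis by (simp add: ennreal_le_1)
  qed
  have "(\<integral>\<^sup>+\<xi>. ennreal (?\<Psi> (x \<xi>)) \<partial>nu \<alpha>) = (\<integral>\<^sup>+\<xi>. (SUP i. ennreal (?\<Psi> (x \<xi>))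
      * indicator (cball 0 (1 - 1 / real (Suc i))) \<xi>) \<partial>nu \<alpha>)"
  proof (rule nn_integral_cong)
    fix \<xi> :: "complex ^ 'n" assume "\<xi> \<in> space (nu \<alpha>)"
    hence "0 < 1 - norm \<xi>" by simp
    then obtain i where "1 / real (Suc i) < 1 - norm \<xi>" using nat_approx_posE by blast
    hence "ennreal (?\<Psi> (x \<xi>)) \<le> ennreal (?\<Psi> (x \<xi>))
        * indicator (cball 0 (1 - 1 / real (Suc i))) \<xi>" by (simp add: indicator_def)
    also have "\<dots> \<le> (SUP i. ennreal (?\<Psi> (x \<xi>)) * indicator (cball 0 (1 - 1 / real (Suc i)))
        \<xi>)" by (intro SUP_upper) auto
    finally have "ennreal (?\<Psi> (x \<xi>)) \<le> (SUP i. ennreal (?\<Psi> (x \<xi>)) * indicator (cball 0 (1 - 1 / real (Suc i))) \<xi>)" .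
    moreover have "(SUP i. ennreal (?\<Psi> (x \<xi>)) * indicator (cball 0 (1 - 1 / real (Suc i))) \<xi>) \<le> ennreal (?\<Psi> (x \<xi>))"
      by (intro SUP_least) (auto simp: indicator_def)
    ultimately show "ennreal (?\<Psi> (x \<xi>)) = (SUP i. ennreal (?\<Psi> (x \<xi>))
        * indicator (cball 0 (1 - 1 / real (Suc i))) \<xi>)" by (rule antisym)
  qed
  also have "\<dots> = (SUP i. \<integral>\<^sup>+\<xi>. ennreal (?\<Psi> (x \<xi>)) * indicator (cball 0 (1 - 1 / real (Suc i))) \<xi> \<partial>nu \<alpha>)"
  proof (rule nn_integral_monotone_convergence_SUP)
    show "incseq (\<lambda>i \<xi>. ennreal (?\<Psi> (x \<xi>)) * indicator (cball (0 :: complex ^ 'n) (1 - 1 / real (Suc i))) \<xi>)"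
    proof (intro incseq_SucI le_funI mult_left_mono)
      fix i :: nat and \<xi> :: "complex ^ 'n"
      have "1 / real (Suc (Suc i)) \<le> 1 / real (Suc i)" by (intro divide_left_mono) auto
      thus "(indicator (cball 0 (1 - 1 / real (Suc i))) \<xi> :: ennreal)
          \<le> indicator (cball 0 (1 - 1 / real (Suc (Suc i)))) \<xi>"
        by (auto simp: indicator_def)
    qed simp
    fix i
    have "(indicator (cball (0 :: complex ^ 'n) (1 - 1 / real (Suc i))) :: _ \<Rightarrow> ennreal) \<in> borel_measurable (nu \<alpha>)"
      by (intro measurable_nu_borel borel_measurable_indicator borel_closed closed_cball)
    thus "(\<lambda>\<xi>. ennreal (?\<Psi> (x \<xi>)) * indicator (cball 0 (1 - 1 / real (Suc i))) \<xi>) \<in> borel_measurable (nu \<alpha>)"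
      by (intro borel_measurable_times_ennreal measurable_compose[OF \<Psi>x measurable_ennreal])
  qed
  also have "\<dots> \<le> 1" by (intro SUP_least cut) (auto simp: field_simps)
  finally have fin: "(\<integral>\<^sup>+\<xi>. ennreal (?\<Psi> (x \<xi>)) \<partial>nu \<alpha>) \<le> 1" .
  \<comment> \<open>Membership in the space concerns \<open>b\<close> itself, not b / l; the
    doubling property removes the scale.\<close>
  obtain M where M: "M \<ge> 0" "\<And>y. ?\<Psi> (l * y) \<le> M * ?\<Psi> y" using complementary_doubling[OF l(1)] by blast
  have "(\<integral>\<^sup>+\<xi>. ennreal (?\<Psi> (norm (b \<xi>))) \<partial>nu \<alpha>) \<le> (\<integral>\<^sup>+\<xi>. ennreal M * ennreal (?\<Psi> (x \<xi>)) \<partial>nu \<alpha>)"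
  proof (rule nn_integral_mono)
    fix \<xi>
    have "l * x \<xi> = norm (b \<xi>)" using l by (simp add: x_def)
    thus "ennreal (?\<Psi> (norm (b \<xi>))) \<le> ennreal M * ennreal (?\<Psi> (x \<xi>))"
      using M(2)[of "x \<xi>"] M(1) complementary_nonneg by (simp add: ennreal_leI flip: ennreal_mult)
  qed
  also have "\<dots> = ennreal M * (\<integral>\<^sup>+\<xi>. ennreal (?\<Psi> (x \<xi>)) \<partial>nu \<alpha>)"
    by (rule nn_integral_cmult) (rule measurable_compose[OF \<Psi>x measurable_ennreal])
  also have "\<dots> \<le> ennreal M * 1" using fin by (intro mult_left_mono) auto
  also have "\<dots> < \<infinity>" by simp
  finally show ?thesis using hb by (simp add: bergman_orlicz_def)
qed

end

lemma bergman_space2_integrable: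
  fixes b :: "complex ^ 'n \<Rightarrow> complex"
  assumes a: "\<alpha> > -1" and b: "b \<in> bergman_space2 \<alpha>"
  shows "holomorphic_Cn b unit_ball" "integrable (nu \<alpha>) b"
proof -
  show hb: "holomorphic_Cn b unit_ball" using b by (simp add: bergman_space2_def bergman_orlicz_def)
  have fin: "(\<integral>\<^sup>+z. ennreal ((norm (b z))\<^sup>2) \<partial>nu \<alpha>) < \<infinity>" using b by (simp add: bergman_space2_def bergman_orlicz_def)
  have [measurable]: "b \<in> borel_measurable (nu \<alpha>)" by (rule holomorphic_Cn_measurable[OF hb])
  show "integrable (nu \<alpha>) b"
  proof (rule integrableI_bounded)
    have "(\<integral>\<^sup>+z. ennreal (norm (b z)) \<partial>nu \<alpha>) \<le> (\<integral>\<^sup>+z. 1 + ennreal ((norm (b z))\<^sup>2) \<partial>nu \<alpha>)"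
    proof (rule nn_integral_mono)
      fix z
      have "norm (b z) \<le> 1 + (norm (b z))\<^sup>2"
      proof -
        have "2 * norm (b z) \<le> 1 + (norm (b z))\<^sup>2"
          using zero_le_power2[of "norm (b z) - 1"] by (simp add: power2_diff)
        thus ?thesis using norm_ge_zero[of "b z"] by linarith
      qed
      thus "ennreal (norm (b z)) \<le> 1 + ennreal ((norm (b z))\<^sup>2)"
        by (metis ennreal_1 ennreal_leI ennreal_plus zero_le_one zero_le_power2)
    qed
    also have "\<dots> = 1 + (\<integral>\<^sup>+z. ennreal ((norm (b z))\<^sup>2) \<partial>nu \<alpha>)"
      by (subst nn_integral_add) (auto simp: prob_nu[OF a])
    also have "\<dots> < \<infinity>" using fin by simp
    finally show "(\<integral>\<^sup>+z. ennreal (norm (b z)) \<partial>nu \<alpha>) < \<infinity>" .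
  qed measurable
qed

theorem theorem4p5:
  fixes \<alpha> q p :: real and \<Phi>1 \<Phi>2 \<Psi>1 :: "real \<Rightarrow> real"
    and b :: "complex ^ 'n \<Rightarrow> complex"
  assumes "\<alpha> > -1" and "q \<ge> 1" and "0 < p" and "p \<le> 1"
    and "\<Phi>1 \<in> class_U q" and "\<Phi>2 \<in> class_L p"
    and "\<Psi>1 = complementary \<Phi>1"
    and "\<exists>C>0. \<forall>t>0.
           (\<integral>\<^sup>+ s\<in>{0<..<t}. ennreal (\<Phi>1 s / s\<^sup>2) \<partial>lborel) \<le> ennreal (C * (\<Phi>1 t / t))"
    and "(\<integral>\<^sup>+ t\<in>{1..}. ennreal (\<Phi>2 t / t\<^sup>2) \<partial>lborel) < \<infinity>"
    and "b \<in> bergman_space2 \<alpha>"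
  shows "hankel_extends_bounded \<alpha> \<Phi>1 \<Phi>2 b \<longleftrightarrow> b \<in> bergman_orlicz \<alpha> \<Psi>1"
proof -
  obtain \<eta> where "convex_growth \<Phi>1 \<eta> q" using class_U_convex_growth assms by blast
  then interpret convex_growth \<Phi>1 \<eta> q .
  show ?thesis
    unfolding \<open>\<Psi>1 = complementary \<Phi>1\<close>
    using symbol_if_hankel_bounded[OF assms(1,6,3,4) bergman_space2_integrable[OF assms(1,10)]]
      hankel_bounded_if_symbol[OF assms(1,6,3,9) lower_type_gt_1_axioms]
    by blast
qed

end
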